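(* Let $M\subset\mathbb{R}^4$ be a non-degenerate surface with affine metric $g$. Consider a $g$-orthonormal local tangent frame $\{X_1,X_2\}$ and the local basis $\{\xi_1,\xi_2\}$ of the affine normal plane bundle $\sigma$ of $M$ satisfying $[X_1,X_2,\xi_1,\xi_2]=1$ and $$h^1(X_1,X_1)=1,\quad h^1(X_1,X_2)=0,\quad h^1(X_2,X_2)=-\epsilon,\qquad h^2(X_1,X_1)=0,\quad h^2(X_1,X_2)=1,\quad h^2(X_2,X_2)=0.$$ Let $H$, $\eta$, $G_1$, $G_2$ be the associated quantities defined in the context, and consider the equations $$( * )\qquad d\eta(X_1)+\epsilon G_1=0,\qquad d\eta(X_2)-G_2=0 .$$ (1) Assume that there exists a parallel symplectic form $\Omega$ such that $M$ is $\Omega$-Lagrangian. Then the affine normal plane bundle is $\Omega$-Lagrangian, $\Omega\wedge\Omega=c\,[\cdot,\cdot,\cdot,\cdot]$ for some constant $c$, and $[A,B]^t$ belongs to the kernel of $H$, where $A=\Omega(X_1,\xi_2)=\Omega(X_2,\xi_1)$ and $B=\Omega(X_1,\xi_1)=-\epsilon\,\Omega(X_2,\xi_2)$ (these equalities being part of the conclusion). Moreover $\eta$ satisfies equations $( * )$. (2) If $\operatorname{rank}(H)=1$ and $\ker(H)$ satisfies equations $( * )$ (that is, the function $\eta$ defined from $\ker(H)$ satisfies them), then there exists a parallel symplectic form $\Omega$ such that $M$ is $\Omega$-Lagrangian.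
   Context: $\mathbb{R}^4$ carries its standard flat connection $D$ and a parallel volume form $[\cdot,\cdot,\cdot,\cdot]$. A symplectic form $\Omega$ on $\mathbb{R}^4$ is parallel if $D\Omega=0$. $M$ is $\Omega$-Lagrangian if $\Omega$ vanishes on the tangent planes of $M$; a transversal plane bundle $\sigma$ along $M$ is $\Omega$-Lagrangian if $\Omega$ vanishes on the planes of $\sigma$. Affine metric. For a local tangent frame $u=\{X_1,X_2\}$ of $M$ set $G_u(Y,Z)=\frac12([X_1,X_2,D_YX_1,D_ZX_2]+[X_1,X_2,D_ZX_1,D_YX_2])$ and $\Delta(u)=G_u(X_1,X_1)G_u(X_2,X_2)-G_u(X_1,X_2)^2$. $M$ is non-degenerate if $\Delta(u)\neq0$ (a condition independent of $u$); then $g=\Delta(u)^{-1/3}G_u$ is independent of $u$ and is called the affine metric. Put $\epsilon=1$ if $g$ is definite and $\epsilon=-1$ if $g$ is indefinite. A $g$-orthonormal local frame is one with $g(X_1,X_1)=\epsilon$, $g(X_1,X_2)=0$, $g(X_2,X_2)=1$. Transversal bundles. For a transversal plane bundle $\sigma$ and tangent fields $X,Y$, write $D_XY=\nabla_XY+h(X,Y)$ with $\nabla_XY$ tangent to $M$ and $h(X,Y)\in\sigma$; for a local basis $\{\xi_1,\xi_2\}$ of $\sigma$ write $h=h^1\xi_1+h^2\xi_2$. For each $g$-orthonormal local frame there is a unique local basis $\{\xi_1,\xi_2\}$ of $\sigma$ satisfying the normalization displayed in the claim. Write $\nabla_{X_i}X_j=\Gamma_{ij}^1X_1+\Gamma_{ij}^2X_2$,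 $D_X\xi_i=-S_iX+\tau_i^1(X)\xi_1+\tau_i^2(X)\xi_2$ with $S_iX$ tangent, and $S_iX_j=\lambda_{ij}^1X_1+\lambda_{ij}^2X_2$. Affine normal plane bundle: the unique transversal plane bundle $\sigma$ such that, with $\nabla(g)(X,Y,Z)=(\nabla_Xg)(Y,Z)$ and a $g$-orthonormal local frame, $\epsilon\nabla(g)(X_1,X_1,X_1)+\nabla(g)(X_1,X_2,X_2)=0$, $\epsilon\nabla(g)(X_2,X_1,X_1)+\nabla(g)(X_2,X_2,X_2)=0$, $\nabla(g)(X_2,X_1,X_1)+\nabla(g)(X_1,X_2,X_1)=0$, $\nabla(g)(X_1,X_2,X_2)+\nabla(g)(X_2,X_1,X_2)=0$. All quantities below are computed with this $\sigma$. Matrices. $L=(L_{ij})$ is the $2\times2$ matrix with $L_{11}=\lambda_{11}^1-\lambda_{21}^2$, $L_{12}=-\epsilon\lambda_{11}^2-\lambda_{21}^1$, $L_{21}=\lambda_{12}^1-\lambda_{22}^2$, $L_{22}=-\epsilon\lambda_{12}^2-\lambda_{22}^1$. The cubic forms are $C^i(X,Y,Z)=(\nabla_Xh^i)(Y,Z)+\tau_1^i(X)h^1(Y,Z)+\tau_2^i(X)h^2(Y,Z)$, $i=1,2$, and $F=(F_{ij})$ is the $2\times2$ matrix with $F_{i1}=3C^i(X_1,X_1,X_2)-\epsilon C^i(X_2,X_2,X_2)$, $F_{i2}=\epsilon C^i(X_1,X_1,X_1)-3C^i(X_1,X_2,X_2)$. $H$ is the matrix whose rows are the two rows of $L$ followed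 by the two rows of $F$, so that $[A,B]^t\in\ker H$ means $L[A,B]^t=0$ and $F[A,B]^t=0$. The rank of $H$ is independent of the choice of the $g$-orthonormal frame. $G_1=\Gamma_{22}^2-\epsilon\Gamma_{11}^2+\tau_1^1(X_2)-\epsilon\tau_1^2(X_1)$ and $G_2=\Gamma_{11}^1-\epsilon\Gamma_{22}^1-\tau_2^2(X_1)+\tau_1^2(X_2)$. The function $\eta$. For a column vector $[A,B]^t$ in the kernel of $H$ (in part (1), the one given there), $\eta=\tan^{-1}(B/A)$ if $\epsilon=1$ and $\eta=\tanh^{-1}(B/A)$ if $\epsilon=-1$. The validity of the equations $( * )$ is independent of the choice of the local frame.
   Formalization: In part (2) the surface M is assumed connected; without this the claim fails, since two disjoint pieces may be Lagrangian only for different, non-proportional symplectic forms. *)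

theory Defs
  imports "HOL-Analysis.Analysis"
begin

type_synonym R4 = "real^4"

text \<open>Vector fields and functions along a surface are total functions on the ambient space; only
  their values on the surface (or on the open piece of it where they are defined) matter. A frame or
  a local basis is a family of vector fields indexed by the two-element type \<^typ>\<open>2\<close>.\<close>


section \<open>Smooth surfaces in four-space\<close>

primrec Ck_on :: "nat \<Rightarrow> 'a::euclidean_space set \<Rightarrow> ('a \<Rightarrow> 'b::real_normed_vector) \<Rightarrow> bool" where
  "Ck_on 0 U f \<longleftrightarrow> continuous_on U f"
| "Ck_on (Suc k) U f \<longleftrightarrow> (\<forall>x\<in>U. f differentiable (at x)) \<and>
     (\<forall>v. Ck_on k U (\<lambda>x. frechet_derivative f (at x) v))"

text \<open>To be used for open sets only.\<close>

definition smooth_on :: "'a::euclidean_space set \<Rightarrow> ('a \<Rightarrow> 'b::real_normed_vector) \<Rightarrow> bool" where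
  "smooth_on U f \<longleftrightarrow> (\<forall>k. Ck_on k U f)"

text \<open>Smoothness on an arbitrary subset: near each point \<open>f\<close> is the restriction of a smooth map
  defined on an open set of the ambient space.\<close>

definition smooth_along :: "'a::euclidean_space set \<Rightarrow> ('a \<Rightarrow> 'b::real_normed_vector) \<Rightarrow> bool" where
  "smooth_along S f \<longleftrightarrow> (\<forall>p\<in>S. \<exists>W F. open W \<and> p \<in> W \<and> smooth_on W F \<and> (\<forall>q\<in>S \<inter> W. F q = f q))"

text \<open>Every point has a relatively open neighbourhood in \<open>M\<close> that is diffeomorphic to an open
  subset of the plane.\<close>

definition smooth_surface :: "R4 set \<Rightarrow> bool" where
  "smooth_surface M \<longleftrightarrow>
     (\<forall>p\<in>M. \<exists>V (U :: (real^2) set) \<phi> \<psi>.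
        openin (top_of_set M) V \<and> p \<in> V \<and> open U \<and>
        smooth_on U \<phi> \<and> smooth_along V \<psi> \<and>
        \<phi> ` U = V \<and> (\<forall>u\<in>U. \<psi> (\<phi> u) = u))"

definition tangent_space :: "R4 set \<Rightarrow> R4 \<Rightarrow> R4 set" where
  "tangent_space M p =
     {v. \<exists>\<gamma>::real \<Rightarrow> R4. \<gamma> 0 = p \<and> (\<forall>t. \<gamma> t \<in> M) \<and> (\<gamma> has_vector_derivative v) (at 0)}"

text \<open>The flat derivative \<open>D\<^sub>Y f\<close> along \<open>M\<close>, for a tangent field \<open>Y\<close> and a vector-valued or
  scalar-valued \<open>f\<close>. The derivative of \<open>f\<close> within \<open>M\<close> is unique only on the tangent plane, and it is
  only applied to tangent vectors.\<close>

definition Dflat :: "R4 set \<Rightarrow> (R4 \<Rightarrow> R4) \<Rightarrow> (R4 \<Rightarrow> 'b::real_normed_vector) \<Rightarrow> R4 \<Rightarrow> 'b" where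
  "Dflat M Y f p = frechet_derivative f (at p within M) (Y p)"


section \<open>Parallel forms\<close>

definition parallel_volume_form :: "(R4 \<Rightarrow> R4 \<Rightarrow> R4 \<Rightarrow> R4 \<Rightarrow> R4 \<Rightarrow> real) \<Rightarrow> bool" where
  "parallel_volume_form vol \<longleftrightarrow>
     (\<forall>p a b c. linear (\<lambda>x. vol p x a b c) \<and> linear (\<lambda>x. vol p a x b c) \<and>
                linear (\<lambda>x. vol p a b x c) \<and> linear (\<lambda>x. vol p a b c x)) \<and>
     (\<forall>p x a b. vol p x x a b = 0 \<and> vol p a x x b = 0 \<and> vol p a b x x = 0) \<and>
     (\<forall>p. \<exists>a b c d. vol p a b c d \<noteq> 0) \<and>
     (\<forall>p a b c d. ((\<lambda>q. vol q a b c d) has_derivative (\<lambda>_. 0)) (at p))"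

text \<open>Closedness need not be required: a parallel form is closed.\<close>

definition parallel_symplectic_form :: "(R4 \<Rightarrow> R4 \<Rightarrow> R4 \<Rightarrow> real) \<Rightarrow> bool" where
  "parallel_symplectic_form \<Omega> \<longleftrightarrow>
     (\<forall>p. bilinear (\<Omega> p)) \<and> (\<forall>p v. \<Omega> p v v = 0) \<and>
     (\<forall>p v. (\<forall>w. \<Omega> p v w = 0) \<longrightarrow> v = 0) \<and>
     (\<forall>p v w. ((\<lambda>q. \<Omega> q v w) has_derivative (\<lambda>_. 0)) (at p))"

text \<open>\<open>\<Omega> \<and> \<Omega>\<close>, in the convention where the wedge product is a sum over shuffles.\<close>

definition wedge_square :: "(R4 \<Rightarrow> R4 \<Rightarrow> R4 \<Rightarrow> real) \<Rightarrow> R4 \<Rightarrow> R4 \<Rightarrow> R4 \<Rightarrow> R4 \<Rightarrow> R4 \<Rightarrow> real" where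
  "wedge_square \<Omega> p a b c d =
     2 * (\<Omega> p a b * \<Omega> p c d - \<Omega> p a c * \<Omega> p b d + \<Omega> p a d * \<Omega> p b c)"

definition lagrangian_bundle ::
    "(R4 \<Rightarrow> R4 \<Rightarrow> R4 \<Rightarrow> real) \<Rightarrow> R4 set \<Rightarrow> (R4 \<Rightarrow> R4 set) \<Rightarrow> bool" where
  "lagrangian_bundle \<Omega> M \<sigma> \<longleftrightarrow> (\<forall>p\<in>M. \<forall>v\<in>\<sigma> p. \<forall>w\<in>\<sigma> p. \<Omega> p v w = 0)"

definition lagrangian_surface :: "(R4 \<Rightarrow> R4 \<Rightarrow> R4 \<Rightarrow> real) \<Rightarrow> R4 set \<Rightarrow> bool" where
  "lagrangian_surface \<Omega> M \<longleftrightarrow> lagrangian_bundle \<Omega> M (tangent_space M)"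


section \<open>Frames and transversal bundles\<close>

definition local_basis ::
    "R4 set \<Rightarrow> (R4 \<Rightarrow> R4 set) \<Rightarrow> R4 set \<Rightarrow> (2 \<Rightarrow> R4 \<Rightarrow> R4) \<Rightarrow> bool" where
  "local_basis M \<sigma> V E \<longleftrightarrow>
     openin (top_of_set M) V \<and> (\<forall>i. smooth_along V (E i)) \<and>
     (\<forall>p\<in>V. E 1 p \<noteq> E 2 p \<and> independent {E 1 p, E 2 p} \<and> span {E 1 p, E 2 p} = \<sigma> p)"

definition local_frame :: "R4 set \<Rightarrow> R4 set \<Rightarrow> (2 \<Rightarrow> R4 \<Rightarrow> R4) \<Rightarrow> bool" where
  "local_frame M V X \<longleftrightarrow> local_basis M (tangent_space M) V X"

definition transversal_bundle :: "R4 set \<Rightarrow> (R4 \<Rightarrow> R4 set) \<Rightarrow> bool" where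
  "transversal_bundle M \<sigma> \<longleftrightarrow>
     (\<forall>p\<in>M. \<exists>V E. p \<in> V \<and> local_basis M \<sigma> V E) \<and>
     (\<forall>p\<in>M. tangent_space M p \<inter> \<sigma> p = {0})"

definition tangent_part :: "R4 set \<Rightarrow> (R4 \<Rightarrow> R4 set) \<Rightarrow> R4 \<Rightarrow> R4 \<Rightarrow> R4" where
  "tangent_part M \<sigma> p w = (THE t. t \<in> tangent_space M p \<and> w - t \<in> \<sigma> p)"

definition transversal_part :: "R4 set \<Rightarrow> (R4 \<Rightarrow> R4 set) \<Rightarrow> R4 \<Rightarrow> R4 \<Rightarrow> R4" where
  "transversal_part M \<sigma> p w = w - tangent_part M \<sigma> p w"

text \<open>The \<open>k\<close>-th component of a vector in the plane spanned by \<open>E 1 p\<close> and \<open>E 2 p\<close>.\<close>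

definition component :: "(2 \<Rightarrow> R4 \<Rightarrow> R4) \<Rightarrow> 2 \<Rightarrow> R4 \<Rightarrow> R4 \<Rightarrow> real" where
  "component E k p w = representation {E 1 p, E 2 p} w (E k p)"


section \<open>The affine metric\<close>

definition G_form ::
    "R4 set \<Rightarrow> (R4 \<Rightarrow> R4 \<Rightarrow> R4 \<Rightarrow> R4 \<Rightarrow> R4 \<Rightarrow> real) \<Rightarrow> (2 \<Rightarrow> R4 \<Rightarrow> R4)
      \<Rightarrow> (R4 \<Rightarrow> R4) \<Rightarrow> (R4 \<Rightarrow> R4) \<Rightarrow> R4 \<Rightarrow> real" where
  "G_form M vol u Y Z p =
     (1/2) * (vol p (u 1 p) (u 2 p) (Dflat M Y (u 1) p) (Dflat M Z (u 2) p)
            + vol p (u 1 p) (u 2 p) (Dflat M Z (u 1) p) (Dflat M Y (u 2) p))"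

definition Delta ::
    "R4 set \<Rightarrow> (R4 \<Rightarrow> R4 \<Rightarrow> R4 \<Rightarrow> R4 \<Rightarrow> R4 \<Rightarrow> real) \<Rightarrow> (2 \<Rightarrow> R4 \<Rightarrow> R4) \<Rightarrow> R4 \<Rightarrow> real" where
  "Delta M vol u p =
     G_form M vol u (u 1) (u 1) p * G_form M vol u (u 2) (u 2) p - (G_form M vol u (u 1) (u 2) p)\<^sup>2"

definition nondegenerate ::
    "R4 set \<Rightarrow> (R4 \<Rightarrow> R4 \<Rightarrow> R4 \<Rightarrow> R4 \<Rightarrow> R4 \<Rightarrow> real) \<Rightarrow> bool" where
  "nondegenerate M vol \<longleftrightarrow> (\<forall>V u. local_frame M V u \<longrightarrow> (\<forall>p\<in>V. Delta M vol u p \<noteq> 0))"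

text \<open>The affine metric, computed in the frame \<open>u\<close>; its value does not depend on \<open>u\<close>. In the
  definitions below it is evaluated in the frame at hand. \<^term>\<open>root 3\<close> is the real cube root, also
  for negative arguments.\<close>

definition affine_metric ::
    "R4 set \<Rightarrow> (R4 \<Rightarrow> R4 \<Rightarrow> R4 \<Rightarrow> R4 \<Rightarrow> R4 \<Rightarrow> real) \<Rightarrow> (2 \<Rightarrow> R4 \<Rightarrow> R4)
      \<Rightarrow> (R4 \<Rightarrow> R4) \<Rightarrow> (R4 \<Rightarrow> R4) \<Rightarrow> R4 \<Rightarrow> real" where
  "affine_metric M vol u Y Z p = G_form M vol u Y Z p / root 3 (Delta M vol u p)"

definition metric_definite ::
    "R4 set \<Rightarrow> (R4 \<Rightarrow> R4 \<Rightarrow> R4 \<Rightarrow> R4 \<Rightarrow> R4 \<Rightarrow> real) \<Rightarrow> (2 \<Rightarrow> R4 \<Rightarrow> R4) \<Rightarrow> R4 \<Rightarrow> bool" where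
  "metric_definite M vol u p \<longleftrightarrow>
     (\<forall>v\<in>tangent_space M p - {0}. affine_metric M vol u (\<lambda>_. v) (\<lambda>_. v) p > 0) \<or>
     (\<forall>v\<in>tangent_space M p - {0}. affine_metric M vol u (\<lambda>_. v) (\<lambda>_. v) p < 0)"

definition metric_sign ::
    "R4 set \<Rightarrow> (R4 \<Rightarrow> R4 \<Rightarrow> R4 \<Rightarrow> R4 \<Rightarrow> R4 \<Rightarrow> real) \<Rightarrow> (2 \<Rightarrow> R4 \<Rightarrow> R4) \<Rightarrow> R4 \<Rightarrow> real" where
  "metric_sign M vol u p = (if metric_definite M vol u p then 1 else -1)"

definition orthonormal_frame ::
    "R4 set \<Rightarrow> (R4 \<Rightarrow> R4 \<Rightarrow> R4 \<Rightarrow> R4 \<Rightarrow> R4 \<Rightarrow> real) \<Rightarrow> R4 set \<Rightarrow> (2 \<Rightarrow> R4 \<Rightarrow> R4) \<Rightarrow> bool" where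
  "orthonormal_frame M vol V X \<longleftrightarrow>
     local_frame M V X \<and>
     (\<forall>p\<in>V. affine_metric M vol X (X 1) (X 1) p = metric_sign M vol X p \<and>
            affine_metric M vol X (X 1) (X 2) p = 0 \<and>
            affine_metric M vol X (X 2) (X 2) p = 1)"


section \<open>Induced connection, second fundamental forms, shape operators\<close>

definition nabla ::
    "R4 set \<Rightarrow> (R4 \<Rightarrow> R4 set) \<Rightarrow> (R4 \<Rightarrow> R4) \<Rightarrow> (R4 \<Rightarrow> R4) \<Rightarrow> R4 \<Rightarrow> R4" where
  "nabla M \<sigma> Y Z p = tangent_part M \<sigma> p (Dflat M Y Z p)"

definition hform ::
    "R4 set \<Rightarrow> (R4 \<Rightarrow> R4 set) \<Rightarrow> (2 \<Rightarrow> R4 \<Rightarrow> R4) \<Rightarrow> 2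
      \<Rightarrow> (R4 \<Rightarrow> R4) \<Rightarrow> (R4 \<Rightarrow> R4) \<Rightarrow> R4 \<Rightarrow> real" where
  "hform M \<sigma> \<xi> k Y Z p = component \<xi> k p (transversal_part M \<sigma> p (Dflat M Y Z p))"

text \<open>\<open>\<tau>\<^sub>i\<^sup>k(Y)\<close>\<close>

definition tau ::
    "R4 set \<Rightarrow> (R4 \<Rightarrow> R4 set) \<Rightarrow> (2 \<Rightarrow> R4 \<Rightarrow> R4) \<Rightarrow> 2 \<Rightarrow> 2 \<Rightarrow> (R4 \<Rightarrow> R4) \<Rightarrow> R4 \<Rightarrow> real" where
  "tau M \<sigma> \<xi> i k Y p = component \<xi> k p (transversal_part M \<sigma> p (Dflat M Y (\<xi> i) p))"

definition shape ::
    "R4 set \<Rightarrow> (R4 \<Rightarrow> R4 set) \<Rightarrow> (2 \<Rightarrow> R4 \<Rightarrow> R4) \<Rightarrow> 2 \<Rightarrow> (R4 \<Rightarrow> R4) \<Rightarrow> R4 \<Rightarrow> R4" where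
  "shape M \<sigma> \<xi> i Y p = - tangent_part M \<sigma> p (Dflat M Y (\<xi> i) p)"

text \<open>\<open>\<Gamma>\<^sub>i\<^sub>j\<^sup>k\<close> and \<open>\<lambda>\<^sub>i\<^sub>j\<^sup>k\<close>\<close>

definition Gam ::
    "R4 set \<Rightarrow> (R4 \<Rightarrow> R4 set) \<Rightarrow> (2 \<Rightarrow> R4 \<Rightarrow> R4) \<Rightarrow> 2 \<Rightarrow> 2 \<Rightarrow> 2 \<Rightarrow> R4 \<Rightarrow> real" where
  "Gam M \<sigma> X i j k p = component X k p (nabla M \<sigma> (X i) (X j) p)"

definition lam ::
    "R4 set \<Rightarrow> (R4 \<Rightarrow> R4 set) \<Rightarrow> (2 \<Rightarrow> R4 \<Rightarrow> R4) \<Rightarrow> (2 \<Rightarrow> R4 \<Rightarrow> R4) \<Rightarrow> 2 \<Rightarrow> 2 \<Rightarrow> 2 \<Rightarrow> R4 \<Rightarrow> real" where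
  "lam M \<sigma> X \<xi> i j k p = component X k p (shape M \<sigma> \<xi> i (X j) p)"

definition cubic ::
    "R4 set \<Rightarrow> (R4 \<Rightarrow> R4 set) \<Rightarrow> (2 \<Rightarrow> R4 \<Rightarrow> R4) \<Rightarrow> 2
      \<Rightarrow> (R4 \<Rightarrow> R4) \<Rightarrow> (R4 \<Rightarrow> R4) \<Rightarrow> (R4 \<Rightarrow> R4) \<Rightarrow> R4 \<Rightarrow> real" where
  "cubic M \<sigma> \<xi> i X Y Z p =
     (Dflat M X (hform M \<sigma> \<xi> i Y Z) p
       - hform M \<sigma> \<xi> i (nabla M \<sigma> X Y) Z p - hform M \<sigma> \<xi> i Y (nabla M \<sigma> X Z) p)
     + tau M \<sigma> \<xi> 1 i X p * hform M \<sigma> \<xi> 1 Y Z p + tau M \<sigma> \<xi> 2 i X p * hform M \<sigma> \<xi> 2 Y Z p"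


section \<open>The affine normal plane bundle\<close>

definition nabla_metric ::
    "R4 set \<Rightarrow> (R4 \<Rightarrow> R4 \<Rightarrow> R4 \<Rightarrow> R4 \<Rightarrow> R4 \<Rightarrow> real) \<Rightarrow> (R4 \<Rightarrow> R4 set) \<Rightarrow> (2 \<Rightarrow> R4 \<Rightarrow> R4)
      \<Rightarrow> (R4 \<Rightarrow> R4) \<Rightarrow> (R4 \<Rightarrow> R4) \<Rightarrow> (R4 \<Rightarrow> R4) \<Rightarrow> R4 \<Rightarrow> real" where
  "nabla_metric M vol \<sigma> u X Y Z p =
     Dflat M X (affine_metric M vol u Y Z) p
     - affine_metric M vol u (nabla M \<sigma> X Y) Z p - affine_metric M vol u Y (nabla M \<sigma> X Z) p"

text \<open>The second conjunct, that orthonormal frames exist around every point, keeps the third one from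
  holding vacuously. It fails only where the affine metric is negative definite; since reversing the
  sign of the volume form reverses the sign of the metric, it fixes the orientation for which a
  definite metric is positive definite.\<close>

definition affine_normal_bundle ::
    "R4 set \<Rightarrow> (R4 \<Rightarrow> R4 \<Rightarrow> R4 \<Rightarrow> R4 \<Rightarrow> R4 \<Rightarrow> real) \<Rightarrow> (R4 \<Rightarrow> R4 set) \<Rightarrow> bool" where
  "affine_normal_bundle M vol \<sigma> \<longleftrightarrow>
     transversal_bundle M \<sigma> \<and>
     (\<forall>p\<in>M. \<exists>V X. p \<in> V \<and> orthonormal_frame M vol V X) \<and>
     (\<forall>V X. orthonormal_frame M vol V X \<longrightarrow>
        (\<forall>p\<in>V. let \<epsilon> = metric_sign M vol X p;
                   ng = (\<lambda>i j k. nabla_metric M vol \<sigma> X (X i) (X j) (X k) p)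
               in \<epsilon> * ng 1 1 1 + ng 1 2 2 = 0 \<and>
                  \<epsilon> * ng 2 1 1 + ng 2 2 2 = 0 \<and>
                  ng 2 1 1 + ng 1 2 1 = 0 \<and>
                  ng 1 2 2 + ng 2 1 2 = 0))"

definition adapted_frame ::
    "R4 set \<Rightarrow> (R4 \<Rightarrow> R4 \<Rightarrow> R4 \<Rightarrow> R4 \<Rightarrow> R4 \<Rightarrow> real) \<Rightarrow> (R4 \<Rightarrow> R4 set)
      \<Rightarrow> R4 set \<Rightarrow> (2 \<Rightarrow> R4 \<Rightarrow> R4) \<Rightarrow> (2 \<Rightarrow> R4 \<Rightarrow> R4) \<Rightarrow> bool" where
  "adapted_frame M vol \<sigma> V X \<xi> \<longleftrightarrow>
     orthonormal_frame M vol V X \<and> local_basis M \<sigma> V \<xi> \<and>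
     (\<forall>p\<in>V. vol p (X 1 p) (X 2 p) (\<xi> 1 p) (\<xi> 2 p) = 1 \<and>
        hform M \<sigma> \<xi> 1 (X 1) (X 1) p = 1 \<and> hform M \<sigma> \<xi> 1 (X 1) (X 2) p = 0 \<and>
        hform M \<sigma> \<xi> 1 (X 2) (X 2) p = - metric_sign M vol X p \<and>
        hform M \<sigma> \<xi> 2 (X 1) (X 1) p = 0 \<and> hform M \<sigma> \<xi> 2 (X 1) (X 2) p = 1 \<and>
        hform M \<sigma> \<xi> 2 (X 2) (X 2) p = 0)"


section \<open>The matrix \<open>H\<close> and the equations for \<open>\<eta>\<close>\<close>

definition L_row ::
    "R4 set \<Rightarrow> (R4 \<Rightarrow> R4 \<Rightarrow> R4 \<Rightarrow> R4 \<Rightarrow> R4 \<Rightarrow> real) \<Rightarrow> (R4 \<Rightarrow> R4 set)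
      \<Rightarrow> (2 \<Rightarrow> R4 \<Rightarrow> R4) \<Rightarrow> (2 \<Rightarrow> R4 \<Rightarrow> R4) \<Rightarrow> 2 \<Rightarrow> R4 \<Rightarrow> real^2" where
  "L_row M vol \<sigma> X \<xi> j p =
     vector [lam M \<sigma> X \<xi> 1 j 1 p - lam M \<sigma> X \<xi> 2 j 2 p,
             - metric_sign M vol X p * lam M \<sigma> X \<xi> 1 j 2 p - lam M \<sigma> X \<xi> 2 j 1 p]"

definition F_row ::
    "R4 set \<Rightarrow> (R4 \<Rightarrow> R4 \<Rightarrow> R4 \<Rightarrow> R4 \<Rightarrow> R4 \<Rightarrow> real) \<Rightarrow> (R4 \<Rightarrow> R4 set)
      \<Rightarrow> (2 \<Rightarrow> R4 \<Rightarrow> R4) \<Rightarrow> (2 \<Rightarrow> R4 \<Rightarrow> R4) \<Rightarrow> 2 \<Rightarrow> R4 \<Rightarrow> real^2" where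
  "F_row M vol \<sigma> X \<xi> i p =
     vector [3 * cubic M \<sigma> \<xi> i (X 1) (X 1) (X 2) p
               - metric_sign M vol X p * cubic M \<sigma> \<xi> i (X 2) (X 2) (X 2) p,
             metric_sign M vol X p * cubic M \<sigma> \<xi> i (X 1) (X 1) (X 1) p
               - 3 * cubic M \<sigma> \<xi> i (X 1) (X 2) (X 2) p]"

definition H_matrix ::
    "R4 set \<Rightarrow> (R4 \<Rightarrow> R4 \<Rightarrow> R4 \<Rightarrow> R4 \<Rightarrow> R4 \<Rightarrow> real) \<Rightarrow> (R4 \<Rightarrow> R4 set)
      \<Rightarrow> (2 \<Rightarrow> R4 \<Rightarrow> R4) \<Rightarrow> (2 \<Rightarrow> R4 \<Rightarrow> R4) \<Rightarrow> R4 \<Rightarrow> real^2^4" where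
  "H_matrix M vol \<sigma> X \<xi> p =
     vector [L_row M vol \<sigma> X \<xi> 1 p, L_row M vol \<sigma> X \<xi> 2 p,
             F_row M vol \<sigma> X \<xi> 1 p, F_row M vol \<sigma> X \<xi> 2 p]"

definition G1 ::
    "R4 set \<Rightarrow> (R4 \<Rightarrow> R4 \<Rightarrow> R4 \<Rightarrow> R4 \<Rightarrow> R4 \<Rightarrow> real) \<Rightarrow> (R4 \<Rightarrow> R4 set)
      \<Rightarrow> (2 \<Rightarrow> R4 \<Rightarrow> R4) \<Rightarrow> (2 \<Rightarrow> R4 \<Rightarrow> R4) \<Rightarrow> R4 \<Rightarrow> real" where
  "G1 M vol \<sigma> X \<xi> p =
     Gam M \<sigma> X 2 2 2 p - metric_sign M vol X p * Gam M \<sigma> X 1 1 2 p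
     + tau M \<sigma> \<xi> 1 1 (X 2) p - metric_sign M vol X p * tau M \<sigma> \<xi> 1 2 (X 1) p"

definition G2 ::
    "R4 set \<Rightarrow> (R4 \<Rightarrow> R4 \<Rightarrow> R4 \<Rightarrow> R4 \<Rightarrow> R4 \<Rightarrow> real) \<Rightarrow> (R4 \<Rightarrow> R4 set)
      \<Rightarrow> (2 \<Rightarrow> R4 \<Rightarrow> R4) \<Rightarrow> (2 \<Rightarrow> R4 \<Rightarrow> R4) \<Rightarrow> R4 \<Rightarrow> real" where
  "G2 M vol \<sigma> X \<xi> p =
     Gam M \<sigma> X 1 1 1 p - metric_sign M vol X p * Gam M \<sigma> X 2 2 1 p
     - tau M \<sigma> \<xi> 2 2 (X 1) p + tau M \<sigma> \<xi> 1 2 (X 2) p"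

text \<open>For \<open>\<epsilon> = -1\<close> note that the library's \<^term>\<open>artanh (x::real)\<close> equals
  \<open>(1/2) ln \<bar>(1+x)/(1-x)\<bar>\<close> for all \<open>x \<noteq> \<plusminus>1\<close>, which for \<open>\<bar>x\<bar> > 1\<close> is the real part of the complex inverse
  hyperbolic tangent, i.e. \<open>artanh (1/x)\<close>. Thus \<open>\<eta>\<close> also makes sense when \<open>\<bar>B\<bar> > \<bar>A\<bar>\<close>; this case
  occurs when \<open>\<Omega> \<and> \<Omega>\<close> is a negative multiple of the volume form.\<close>

definition eta ::
    "R4 set \<Rightarrow> (R4 \<Rightarrow> R4 \<Rightarrow> R4 \<Rightarrow> R4 \<Rightarrow> R4 \<Rightarrow> real) \<Rightarrow> (2 \<Rightarrow> R4 \<Rightarrow> R4)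
      \<Rightarrow> (R4 \<Rightarrow> real) \<Rightarrow> (R4 \<Rightarrow> real) \<Rightarrow> R4 \<Rightarrow> real" where
  "eta M vol X A B p =
     (if metric_sign M vol X p = 1 then arctan (B p / A p) else artanh (B p / A p))"

definition eta_defined ::
    "R4 set \<Rightarrow> (R4 \<Rightarrow> R4 \<Rightarrow> R4 \<Rightarrow> R4 \<Rightarrow> R4 \<Rightarrow> real) \<Rightarrow> (2 \<Rightarrow> R4 \<Rightarrow> R4)
      \<Rightarrow> (R4 \<Rightarrow> real) \<Rightarrow> (R4 \<Rightarrow> real) \<Rightarrow> R4 \<Rightarrow> bool" where
  "eta_defined M vol X A B p \<longleftrightarrow>
     A p \<noteq> 0 \<and> (metric_sign M vol X p = -1 \<longrightarrow> \<bar>B p\<bar> \<noteq> \<bar>A p\<bar>)"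

definition star_equations ::
    "R4 set \<Rightarrow> (R4 \<Rightarrow> R4 \<Rightarrow> R4 \<Rightarrow> R4 \<Rightarrow> R4 \<Rightarrow> real) \<Rightarrow> (R4 \<Rightarrow> R4 set)
      \<Rightarrow> (2 \<Rightarrow> R4 \<Rightarrow> R4) \<Rightarrow> (2 \<Rightarrow> R4 \<Rightarrow> R4) \<Rightarrow> (R4 \<Rightarrow> real) \<Rightarrow> R4 \<Rightarrow> bool" where
  "star_equations M vol \<sigma> X \<xi> \<eta> p \<longleftrightarrow>
     \<eta> differentiable (at p within M) \<and>
     Dflat M (X 1) \<eta> p + metric_sign M vol X p * G1 M vol \<sigma> X \<xi> p = 0 \<and>
     Dflat M (X 2) \<eta> p - G2 M vol \<sigma> X \<xi> p = 0"

end

theory Submission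
  imports Defs
begin

text \<open>With respect to an adapted frame \<open>E = (X\<^sub>1, X\<^sub>2, \<xi>\<^sub>1, \<xi>\<^sub>2)\<close> all quantities are read off from the connection
  matrices \<open>\<omega>\<^sub>k\<close> of \<open>D\<^bsub>X\<^sub>k\<^esub> E\<close>. The normalizations, the constancy of the volume form, the Codazzi
  equations and the equations of the affine normal bundle leave, apart from the \<open>\<lambda>\<close>, the relations
  \<open>P\<^sub>2 = -Q\<^sub>1\<close>, \<open>Q\<^sub>2 = \<epsilon>P\<^sub>1\<close>, \<open>U\<^sub>1 = T\<^sub>2\<close>, \<open>U\<^sub>2 = -\<epsilon>T\<^sub>1\<close> between the combinations of \<open>\<Gamma>\<close> and \<open>\<tau>\<close> that matter.

  Differentiating \<open>\<Omega>(X\<^sub>1,X\<^sub>2) = 0\<close> gives the shape of a Lagrangian form in terms of \<open>A\<close>, \<open>B\<close> and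
  \<open>c = \<Omega>(\<xi>\<^sub>1,\<xi>\<^sub>2)\<close>. Differentiating once more, the relations above force \<open>c = 0\<close>; the remaining equations are
  \<open>F[A,B]\<^sup>t = 0\<close> and formulas for the derivatives of \<open>A\<close> and \<open>B\<close>, and \<open>dc = 0\<close> is \<open>L[A,B]\<^sup>t = 0\<close>. Modulo the
  kernel equations, the derivative formulas amount to the constancy of \<open>A\<^sup>2 + \<epsilon>B\<^sup>2\<close> together with the
  equations for \<open>\<eta>\<close>.

  Conversely, a section of \<open>ker H\<close> with \<open>A\<^sup>2 + \<epsilon>B\<^sup>2 = \<plusminus>1\<close> whose \<open>\<eta>\<close> satisfies these equations defines a form
  that is locally constant along \<open>M\<close>. By the first part applied locally and by \<open>rank H = 1\<close>, local
  solutions are unique up to a factor, hence extend over the connected surface.\<close>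

section \<open>Differentiation along a surface\<close>

text \<open>In an adapted frame the second fundamental forms have entries 0, 1 and a locally
  constant sign. Their derivatives vanish, so the Codazzi equations are linear relations between
  entries of the connection matrices. The scalar A^2 + \<epsilon> B^2 is the Pfaffian of \<Omega>,
  half the value of \<Omega> \<and> \<Omega> on the frame. On the kernel of H the pair (A, B) turns
  by a circular or hyperbolic rotation with speed d\<eta>, which is why a single angle carries all
  the information. Regularity shapes the rest. That the normal bundle is Lagrangian is claimed at
  every point, where no adapted basis \<xi> is given: one is built from derivatives of the X_i, is
  only known to be differentiable, and is therefore differentiated only once. In the converse the
  section (A, B) is given point by point without continuity; only its ratio is determined by H, and
  the differentiability of that ratio is read off a row of H. The sign \<epsilon> is decided point
  by point too, and its local constancy has to be derived.\<close>

lemma has_derivative_linear_arg: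
  fixes T :: "'x::real_normed_vector \<Rightarrow> 'a::euclidean_space \<Rightarrow> 'b::real_normed_vector"
  assumes N: "open N" "p \<in> N" and lin: "\<And>x. x \<in> N \<Longrightarrow> linear (T x)"
    and lin': "\<And>h. linear (T' h)"
    and T: "\<And>c. ((\<lambda>x. T x c) has_derivative (\<lambda>h. T' h c)) (at p within S)"
    and f: "(f has_derivative f') (at p within S)"
  shows "((\<lambda>x. T x (f x)) has_derivative (\<lambda>h. T' h (f p) + T p (f' h))) (at p within S)"
proof -
  \<comment> \<open>Only the derivatives of \<open>T\<close> on fixed vectors are known. Expanding
    the argument in the finite basis turns the claim into a product rule for finite sums, with no
    norm on linear maps.\<close>
  have expand: "L v = (\<Sum>b\<in>Basis. (v \<bullet> b) *\<^sub>R L b)" if "linear L" for L :: "'a \<Rightarrow> 'b" and v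
  proof -
    have "L v = L (\<Sum>b\<in>Basis. (v \<bullet> b) *\<^sub>R b)"
      by (simp add: euclidean_representation)
    also have "\<dots> = (\<Sum>b\<in>Basis. (v \<bullet> b) *\<^sub>R L b)"
      using that by (simp add: linear_sum linear_scale)
    finally show ?thesis .
  qed
  have sumD: "((\<lambda>x. \<Sum>b\<in>Basis. (f x \<bullet> b) *\<^sub>R T x b) has_derivative
      (\<lambda>h. \<Sum>b\<in>Basis. (f p \<bullet> b) *\<^sub>R T' h b + (f' h \<bullet> b) *\<^sub>R T p b)) (at p within S)"
    by (intro has_derivative_sum has_derivative_scaleR has_derivative_inner_left T f)
  have D: "(\<Sum>b\<in>Basis. (f p \<bullet> b) *\<^sub>R T' h b + (f' h \<bullet> b) *\<^sub>R T p b) = T' h (f p) + T p (f' h)" for h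
    using expand[OF lin', of h "f p"] expand[OF lin[OF N(2)], of "f' h"] by (simp add: sum.distrib)
  show ?thesis
    by (rule has_derivative_transform_within_open[OF sumD[unfolded D] N])
      (use expand[OF lin] in metis)
qed

section \<open>Derivatives within the surface\<close>

lemma tangent_space_curve:
  assumes "(f has_derivative f') (at p within M)" "\<gamma> 0 = p" "\<And>t. \<gamma> t \<in> M"
    "(\<gamma> has_vector_derivative v) (at 0)"
  shows "((\<lambda>t. f (\<gamma> t)) has_vector_derivative f' v) (at (0::real))"
proof -
  have "(f has_derivative f') (at (\<gamma> 0) within range \<gamma>)"
    using assms by (auto intro: has_derivative_subset)
  then have "((f \<circ> \<gamma>) has_vector_derivative f' v) (at 0 within UNIV)"
    by (intro vector_derivative_diff_chain_within) (use assms in auto)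
  then show ?thesis by (simp add: o_def)
qed

text \<open>A derivative within \<open>M\<close> is not unique as a linear map. Composed with a
  curve of velocity \<open>v\<close> it becomes an ordinary derivative in one real variable, which
  is unique.\<close>

lemma tangent_derivative_unique:
  assumes "(f has_derivative f') (at p within M)" "(f has_derivative f'') (at p within M)"
    and "v \<in> tangent_space M p"
  shows "f' v = f'' v"
proof -
  obtain \<gamma> :: "real \<Rightarrow> R4" where \<gamma>: "\<gamma> 0 = p" "\<And>t. \<gamma> t \<in> M" "(\<gamma> has_vector_derivative v) (at 0)"
    using assms(3) by (auto simp: tangent_space_def)
  show ?thesis
    using tangent_space_curve[OF assms(1) \<gamma>] tangent_space_curve[OF assms(2) \<gamma>]
    by (rule vector_derivative_unique_at)
qed

lemma Dflat_eq:
  assumes "(f has_derivative f') (at p within M)" "Y p \<in> tangent_space M p"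
  shows "Dflat M Y f p = f' (Y p)"
proof -
  have "f differentiable (at p within M)" using assms(1) by (auto simp: differentiable_def)
  then have "(f has_derivative frechet_derivative f (at p within M)) (at p within M)"
    by (simp add: frechet_derivative_works)
  from tangent_derivative_unique[OF this assms(1) assms(2)] show ?thesis
    by (simp add: Dflat_def)
qed

lemma openin_subset_at_within:
  assumes "openin (top_of_set M) V" "p \<in> V"
  shows "at p within V = at p within M"
proof -
  obtain T where "open T" "V = M \<inter> T" using assms(1) by (auto simp: openin_open)
  then show ?thesis using assms(2) by (intro at_within_nhd[of p T]) auto
qed

lemma has_derivative_cong_openin:
  assumes "openin (top_of_set M) V" "p \<in> V" "\<And>q. q \<in> V \<Longrightarrow> f q = g q"
  shows "(f has_derivative f') (at p within M) \<longleftrightarrow> (g has_derivative f') (at p within M)"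
  unfolding openin_subset_at_within[OF assms(1,2), symmetric]
  by (rule iffI; rule has_derivative_transform[OF assms(2)]) (use assms(3) in auto)

lemma differentiable_cong_openin:
  assumes "openin (top_of_set M) V" "p \<in> V" "\<And>q. q \<in> V \<Longrightarrow> f q = g q"
  shows "f differentiable (at p within M) \<longleftrightarrow> g differentiable (at p within M)"
  using has_derivative_cong_openin[OF assms] by (auto simp: differentiable_def)

text \<open>Agreement near \<open>p\<close> makes the two \<open>has_derivative\<close> predicates
  identical, so \<open>frechet_derivative\<close> chooses the same map for both, differentiable or
  not.\<close>

lemma Dflat_cong_openin:
  assumes "openin (top_of_set M) V" "p \<in> V" "\<And>q. q \<in> V \<Longrightarrow> f q = g q"
  shows "Dflat M Y f p = Dflat M Y g p"
  using has_derivative_cong_openin[OF assms] by (simp add: Dflat_def frechet_derivative_def)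

section \<open>Symmetry of second derivatives\<close>

lemma second_difference:
  fixes f :: "'a::real_normed_vector \<Rightarrow> real"
  assumes h: "0 < h" and ball: "\<And>s t. 0 \<le> s \<Longrightarrow> s \<le> h \<Longrightarrow> 0 \<le> t \<Longrightarrow> t \<le> h \<Longrightarrow> p + s *\<^sub>R v + t *\<^sub>R w \<in> W"
    and f: "\<And>x. x \<in> W \<Longrightarrow> (f has_derivative f' x) (at x)"
    and f': "\<And>x. x \<in> W \<Longrightarrow> ((\<lambda>x. f' x v) has_derivative f'' x) (at x)"
  shows "\<exists>s\<in>{0..h}. \<exists>t\<in>{0..h}.
    f (p + h *\<^sub>R v + h *\<^sub>R w) - f (p + h *\<^sub>R v) - f (p + h *\<^sub>R w) + f p
      = h * h * f'' (p + s *\<^sub>R v + t *\<^sub>R w) w"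
proof -
  let ?\<phi> = "\<lambda>s. f (p + s *\<^sub>R v + h *\<^sub>R w) - f (p + s *\<^sub>R v + 0 *\<^sub>R w)"
  have line: "((\<lambda>s. f (p + s *\<^sub>R v + t *\<^sub>R w)) has_real_derivative f' (p + s *\<^sub>R v + t *\<^sub>R w) v) (at s)"
    if "0 \<le> s" "s \<le> h" "0 \<le> t" "t \<le> h" for s t
  proof -
    have "((\<lambda>s. f (p + s *\<^sub>R v + t *\<^sub>R w)) has_derivative (\<lambda>r. f' (p + s *\<^sub>R v + t *\<^sub>R w) (r *\<^sub>R v))) (at s)"
      by (rule has_derivative_compose[where f = "\<lambda>s. p + s *\<^sub>R v + t *\<^sub>R w" and g = f, OF _ f[OF ball[OF that]]]) (auto intro!: derivative_eq_intros)
    moreover have "f' (p + s *\<^sub>R v + t *\<^sub>R w) (r *\<^sub>R v) = f' (p + s *\<^sub>R v + t *\<^sub>R w) v * r" for r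
      using has_derivative_linear[OF f[OF ball[OF that]]] by (simp add: linear_scale)
    ultimately show ?thesis by (simp add: has_field_derivative_def)
  qed
  have "\<exists>s>0. s < h \<and> ?\<phi> h - ?\<phi> 0 = (h - 0) * (f' (p + s *\<^sub>R v + h *\<^sub>R w) v - f' (p + s *\<^sub>R v + 0 *\<^sub>R w) v)"
    by (intro MVT2 h DERIV_diff line) (use h in auto)
  then obtain s where s: "0 < s" "s < h"
    "?\<phi> h - ?\<phi> 0 = h * (f' (p + s *\<^sub>R v + h *\<^sub>R w) v - f' (p + s *\<^sub>R v + 0 *\<^sub>R w) v)" by auto
  have line2: "((\<lambda>t. f' (p + s *\<^sub>R v + t *\<^sub>R w) v) has_real_derivative f'' (p + s *\<^sub>R v + t *\<^sub>R w) w) (at t)"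
    if "0 \<le> t" "t \<le> h" for t
  proof -
    have W: "p + s *\<^sub>R v + t *\<^sub>R w \<in> W" using that s by (intro ball) auto
    have "((\<lambda>t. f' (p + s *\<^sub>R v + t *\<^sub>R w) v) has_derivative (\<lambda>r. f'' (p + s *\<^sub>R v + t *\<^sub>R w) (r *\<^sub>R w))) (at t)"
      by (rule has_derivative_compose[where f = "\<lambda>t. p + s *\<^sub>R v + t *\<^sub>R w" and g = "\<lambda>x. f' x v", OF _ f'[OF W]]) (auto intro!: derivative_eq_intros)
    moreover have "f'' (p + s *\<^sub>R v + t *\<^sub>R w) (r *\<^sub>R w) = f'' (p + s *\<^sub>R v + t *\<^sub>R w) w * r" for r
      using has_derivative_linear[OF f'[OF W]] by (simp add: linear_scale)
    ultimately show ?thesis by (simp add: has_field_derivative_def)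
  qed
  have "\<exists>t>0. t < h \<and> f' (p + s *\<^sub>R v + h *\<^sub>R w) v - f' (p + s *\<^sub>R v + 0 *\<^sub>R w) v
      = (h - 0) * f'' (p + s *\<^sub>R v + t *\<^sub>R w) w"
    by (intro MVT2 h line2) auto
  then obtain t where t: "0 < t" "t < h" "f' (p + s *\<^sub>R v + h *\<^sub>R w) v - f' (p + s *\<^sub>R v + 0 *\<^sub>R w) v
      = h * f'' (p + s *\<^sub>R v + t *\<^sub>R w) w" by auto
  show ?thesis
    using s t by (intro bexI[of _ s] bexI[of _ t]) (auto simp: algebra_simps)
qed

text \<open>The second difference over a small parallelogram does not see the order of
  \<open>v\<close> and \<open>w\<close>, and by \<open>second_difference\<close> it is h^2 times a
  nearby value of either mixed derivative. Only derivatives in the two directions enter, which is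
  the form in which \<open>Ck_on\<close> supplies them.\<close>

lemma mixed_derivatives_real:
  fixes f :: "'a::real_normed_vector \<Rightarrow> real"
  assumes W: "open W" "p \<in> W"
    and f: "\<And>x. x \<in> W \<Longrightarrow> (f has_derivative f' x) (at x)"
    and fv: "\<And>x. x \<in> W \<Longrightarrow> ((\<lambda>x. f' x v) has_derivative fv x) (at x)"
    and fw: "\<And>x. x \<in> W \<Longrightarrow> ((\<lambda>x. f' x w) has_derivative fw x) (at x)"
    and cont: "continuous_on W (\<lambda>x. fv x w)" "continuous_on W (\<lambda>x. fw x v)"
  shows "fv p w = fw p v"
proof (rule ccontr)
  assume ne: "fv p w \<noteq> fw p v"
  define e where "e = \<bar>fv p w - fw p v\<bar> / 2"
  have e: "e > 0" using ne by (simp add: e_def)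
  obtain d0 where d0: "d0 > 0" "ball p d0 \<subseteq> W" using W open_contains_ball by blast
  obtain d1 where d1: "d1 > 0" "\<And>x. x \<in> W \<Longrightarrow> dist x p < d1 \<Longrightarrow> \<bar>fv x w - fv p w\<bar> < e"
    using cont(1) W e unfolding continuous_on_iff dist_real_def by metis
  obtain d2 where d2: "d2 > 0" "\<And>x. x \<in> W \<Longrightarrow> dist x p < d2 \<Longrightarrow> \<bar>fw x v - fw p v\<bar> < e"
    using cont(2) W e unfolding continuous_on_iff dist_real_def by metis
  define d where "d = min d0 (min d1 d2)"
  have d: "d > 0" "d \<le> d0" "d \<le> d1" "d \<le> d2" using d0 d1 d2 by (auto simp: d_def)
  \<comment> \<open>Keeps the whole parallelogram within distance \<open>d\<close> of
    \<open>p\<close>; the summand 1 covers \<open>v = w = 0\<close>.\<close>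
  define h where "h = d / (norm v + norm w + 1)"
  have pos: "norm v + norm w + 1 > 0" by (simp add: add_nonneg_pos)
  have h: "h > 0" using d pos by (simp add: h_def)
  have near: "dist (p + s *\<^sub>R v + t *\<^sub>R w) p < d" if "0 \<le> s" "s \<le> h" "0 \<le> t" "t \<le> h" for s t
  proof -
    have "dist (p + s *\<^sub>R v + t *\<^sub>R w) p = norm (s *\<^sub>R v + t *\<^sub>R w)" by (simp add: dist_norm add.assoc)
    also have "\<dots> \<le> s * norm v + t * norm w" using that by (intro norm_triangle_le) simp
    also have "\<dots> \<le> h * norm v + h * norm w" using that by (intro add_mono mult_right_mono) auto
    also have "\<dots> < h * (norm v + norm w + 1)" using h by (simp add: algebra_simps)
    also have "\<dots> = d" using pos by (simp add: h_def)
    finally show ?thesis .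
  qed
  have inW: "p + s *\<^sub>R v + t *\<^sub>R w \<in> W" if "0 \<le> s" "s \<le> h" "0 \<le> t" "t \<le> h" for s t
    using near[OF that] d d0 by (auto simp: dist_commute)
  have inW': "p + s *\<^sub>R w + t *\<^sub>R v \<in> W" if "0 \<le> s" "s \<le> h" "0 \<le> t" "t \<le> h" for s t
    using inW[OF that(3,4,1,2)] by (simp add: add.commute add.left_commute)
  obtain s t where st: "s \<in> {0..h}" "t \<in> {0..h}"
    "f (p + h *\<^sub>R v + h *\<^sub>R w) - f (p + h *\<^sub>R v) - f (p + h *\<^sub>R w) + f p
      = h * h * fv (p + s *\<^sub>R v + t *\<^sub>R w) w"
    using second_difference[OF h inW f fv] by auto
  obtain t' s' where st': "s' \<in> {0..h}" "t' \<in> {0..h}"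
    "f (p + h *\<^sub>R w + h *\<^sub>R v) - f (p + h *\<^sub>R w) - f (p + h *\<^sub>R v) + f p
      = h * h * fw (p + t' *\<^sub>R w + s' *\<^sub>R v) v"
    using second_difference[OF h inW' f fw] by blast
  have "h * h * fv (p + s *\<^sub>R v + t *\<^sub>R w) w = h * h * fw (p + s' *\<^sub>R v + t' *\<^sub>R w) v"
    using st(3) st'(3) by (simp add: algebra_simps)
  then have "fv (p + s *\<^sub>R v + t *\<^sub>R w) w = fw (p + s' *\<^sub>R v + t' *\<^sub>R w) v" using h by simp
  moreover have "\<bar>fv (p + s *\<^sub>R v + t *\<^sub>R w) w - fv p w\<bar> < e"
    using near[of s t] inW[of s t] st d by (intro d1) auto
  moreover have "\<bar>fw (p + s' *\<^sub>R v + t' *\<^sub>R w) v - fw p v\<bar> < e"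
    using near[of s' t'] inW[of s' t'] st' d by (intro d2) auto
  ultimately show False unfolding e_def by argo
qed

lemma mixed_derivatives:
  fixes F :: "'a::euclidean_space \<Rightarrow> 'b::euclidean_space"
  assumes W: "open W" "p \<in> W" and F: "Ck_on 2 W F"
  shows "frechet_derivative (\<lambda>x. frechet_derivative F (at x) v) (at p) w
       = frechet_derivative (\<lambda>x. frechet_derivative F (at x) w) (at p) v"
proof (rule euclidean_eqI)
  fix b :: 'b assume "b \<in> Basis"
  have D1: "(F has_derivative frechet_derivative F (at x)) (at x)" if "x \<in> W" for x
    using F that by (simp add: numeral_2_eq_2 frechet_derivative_works)
  have D2: "((\<lambda>x. frechet_derivative F (at x) v) has_derivative
      frechet_derivative (\<lambda>x. frechet_derivative F (at x) v) (at x)) (at x)" if "x \<in> W" for x v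
    using F that by (simp add: numeral_2_eq_2 frechet_derivative_works)
  have C: "continuous_on W (\<lambda>x. frechet_derivative (\<lambda>x. frechet_derivative F (at x) v) (at x) w)" for v w
    using F by (simp add: numeral_2_eq_2)
  show "frechet_derivative (\<lambda>x. frechet_derivative F (at x) v) (at p) w \<bullet> b =
        frechet_derivative (\<lambda>x. frechet_derivative F (at x) w) (at p) v \<bullet> b"
    by (rule mixed_derivatives_real[OF W, where f = "\<lambda>x. F x \<bullet> b"
          and f' = "\<lambda>x h. frechet_derivative F (at x) h \<bullet> b"])
      (auto intro!: has_derivative_inner_left D1 D2 continuous_intros C)
qed

text \<open>Linearity in the differentiating direction \<open>w\<close> is automatic; symmetry
  carries it over to \<open>v\<close>.\<close>

lemma linear_second_derivative:
  fixes F :: "'a::euclidean_space \<Rightarrow> 'b::euclidean_space"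
  assumes W: "open W" "p \<in> W" and F: "Ck_on 2 W F"
  shows "linear (\<lambda>v. frechet_derivative (\<lambda>x. frechet_derivative F (at x) v) (at p) w)"
proof -
  have "(\<lambda>x. frechet_derivative F (at x) w) differentiable (at p)"
    using F W by (simp add: numeral_2_eq_2)
  then show ?thesis
    by (subst mixed_derivatives[OF W F]) (rule linear_frechet_derivative)
qed

lemma has_derivative_frechet_arg:
  fixes F :: "'a::euclidean_space \<Rightarrow> 'b::euclidean_space" and g :: "'x::real_normed_vector \<Rightarrow> 'a"
  assumes W: "open W" and F: "Ck_on 2 W F"
    and g: "(g has_derivative g') (at p within S)" and N: "open N" "p \<in> N" "g ` N \<subseteq> W"
    and Y: "(Y has_derivative Y') (at p within S)"
  shows "((\<lambda>q. frechet_derivative F (at (g q)) (Y q)) has_derivative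
    (\<lambda>h. frechet_derivative (\<lambda>x. frechet_derivative F (at x) (Y p)) (at (g p)) (g' h)
        + frechet_derivative F (at (g p)) (Y' h))) (at p within S)"
proof (rule has_derivative_linear_arg[OF N(1,2), where f = Y])
  have gp: "g p \<in> W" using N by auto
  show "linear (frechet_derivative F (at (g q)))" if "q \<in> N" for q
    by (rule linear_frechet_derivative) (use F N that in \<open>auto simp: numeral_2_eq_2\<close>)
  show "linear (\<lambda>v. frechet_derivative (\<lambda>x. frechet_derivative F (at x) v) (at (g p)) (g' h))" for h
    by (rule linear_second_derivative[OF W gp F])
  have "((\<lambda>x. frechet_derivative F (at x) c) has_derivative
      frechet_derivative (\<lambda>x. frechet_derivative F (at x) c) (at (g p))) (at (g p))" for c
    using F gp by (simp add: numeral_2_eq_2 frechet_derivative_works)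
  then show "((\<lambda>q. frechet_derivative F (at (g q)) c) has_derivative
      (\<lambda>h. frechet_derivative (\<lambda>x. frechet_derivative F (at x) c) (at (g p)) (g' h))) (at p within S)" for c
    by (rule has_derivative_compose[OF g])
qed (rule Y)

section \<open>Fields with smooth extensions\<close>

lemma Ck_on_subset: "Ck_on k U f \<Longrightarrow> V \<subseteq> U \<Longrightarrow> Ck_on k V f"
  by (induction k arbitrary: f) (auto intro: continuous_on_subset)

lemma smooth_along_extension:
  assumes "smooth_along V f" "openin (top_of_set M) V" "p \<in> V"
  obtains W F where "open W" "p \<in> W" "Ck_on 2 W F" "\<And>q. q \<in> M \<Longrightarrow> q \<in> W \<Longrightarrow> q \<in> V \<and> F q = f q"
proof -
  obtain W F where W: "open W" "p \<in> W" "smooth_on W F" "\<forall>q\<in>V \<inter> W. F q = f q"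
    using assms(1,3) by (auto simp: smooth_along_def)
  obtain T where T: "open T" "V = M \<inter> T" using assms(2) by (auto simp: openin_open)
  have "Ck_on 2 (W \<inter> T) F" using W(3) by (auto simp: smooth_on_def intro: Ck_on_subset)
  then show thesis using W T assms(3) by (intro that[of "W \<inter> T" F]) auto
qed

lemma smooth_along_differentiable:
  assumes "smooth_along V f" "openin (top_of_set M) V" "p \<in> V"
  shows "f differentiable (at p within M)"
proof -
  obtain W F where W: "open W" "p \<in> W" "Ck_on 2 W F"
    "\<And>q. q \<in> M \<Longrightarrow> q \<in> W \<Longrightarrow> q \<in> V \<and> F q = f q"
    using smooth_along_extension[OF assms] by blast
  have "p \<in> M" using assms openin_imp_subset by blast
  moreover have "F differentiable (at p within M)"
    using W by (auto simp: numeral_2_eq_2 intro: differentiable_at_withinI)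
  moreover have "openin (top_of_set M) (M \<inter> W)" using W by auto
  ultimately show ?thesis
    using differentiable_cong_openin[of M "M \<inter> W" p F f] W by auto
qed

lemma smooth_along_continuous_on:
  assumes "smooth_along V f" "openin (top_of_set M) V"
  shows "continuous_on V f"
  unfolding continuous_on_eq_continuous_within
  using smooth_along_differentiable[OF assms] openin_subset_at_within[OF assms(2)]
  by (metis differentiable_imp_continuous_within)

text \<open>\<open>B\<close> is the Hessian of an ambient extension of \<open>Z\<close>. It depends
  on the extension, but being symmetric it cancels from every commutator of derivatives.\<close>

lemma Dflat_field_has_derivative:
  fixes Z :: "R4 \<Rightarrow> 'b::euclidean_space"
  assumes Z: "smooth_along V Z" and V: "openin (top_of_set M) V" "p \<in> V"
  obtains G B where "(Z has_derivative G) (at p within M)" "\<And>v w. B v w = B w v"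
    "\<And>Y Y'. \<lbrakk>\<And>q. q \<in> V \<Longrightarrow> Y q \<in> tangent_space M q; (Y has_derivative Y') (at p within M)\<rbrakk>
      \<Longrightarrow> (Dflat M Y Z has_derivative (\<lambda>w. B w (Y p) + G (Y' w))) (at p within M)"
proof -
  obtain W F where W: "open W" "p \<in> W" "Ck_on 2 W F"
    "\<And>q. q \<in> M \<Longrightarrow> q \<in> W \<Longrightarrow> q \<in> V \<and> F q = Z q"
    using smooth_along_extension[OF assms] by blast
  have M: "p \<in> M" using V openin_imp_subset by blast
  have op: "openin (top_of_set M) (M \<inter> W)" using W by auto
  have D: "(Z has_derivative frechet_derivative F (at q)) (at q within M)" if "q \<in> M \<inter> W" for q
  proof -
    have "F differentiable (at q)" using W that by (auto simp: numeral_2_eq_2)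
    then have "(F has_derivative frechet_derivative F (at q)) (at q within M)"
      by (simp add: frechet_derivative_works has_derivative_at_withinI)
    then show ?thesis using has_derivative_cong_openin[OF op that, of F Z] W by auto
  qed
  define B where "B = (\<lambda>w v. frechet_derivative (\<lambda>x. frechet_derivative F (at x) v) (at p) w)"
  show thesis
  proof (rule that[of "frechet_derivative F (at p)" B])
    show "(Z has_derivative frechet_derivative F (at p)) (at p within M)" using D M W by auto
    show "B v w = B w v" for v w
      unfolding B_def by (rule mixed_derivatives[OF W(1-3)])
    show "(Dflat M Y Z has_derivative (\<lambda>w. B w (Y p) + frechet_derivative F (at p) (Y' w))) (at p within M)"
      if Y: "\<And>q. q \<in> V \<Longrightarrow> Y q \<in> tangent_space M q" "(Y has_derivative Y') (at p within M)" for Y Y'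
    proof -
      have "((\<lambda>q. frechet_derivative F (at q) (Y q)) has_derivative
          (\<lambda>w. B w (Y p) + frechet_derivative F (at p) (Y' w))) (at p within M)"
        unfolding B_def
        using has_derivative_frechet_arg[where g = "\<lambda>q. q", OF W(1,3) has_derivative_ident W(1,2) _ Y(2)]
        by simp
      then show ?thesis
        using has_derivative_cong_openin[OF op, of p "\<lambda>q. frechet_derivative F (at q) (Y q)" "Dflat M Y Z"]
          Dflat_eq[where Y = Y, OF D Y(1)] W M by auto
    qed
  qed
qed

section \<open>Charts, brackets and local constancy\<close>

lemma chart_derivative_tangent:
  fixes \<phi> :: "'a::real_normed_vector \<Rightarrow> R4"
  assumes "open U" "\<phi> ` U \<subseteq> M" "u \<in> U" "(\<phi> has_derivative \<phi>') (at u)"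
  shows "\<phi>' w \<in> tangent_space M (\<phi> u)"
proof -
  \<comment> \<open>\<open>tangent_space\<close> asks for a curve that stays in \<open>M\<close> for
    all times, so the image of the line is frozen at \<open>\<phi> u\<close> wherever the line
    leaves \<open>U\<close>.\<close>
  let ?\<gamma> = "\<lambda>t::real. if u + t *\<^sub>R w \<in> U then \<phi> (u + t *\<^sub>R w) else \<phi> u"
  have line: "((\<lambda>t. u + t *\<^sub>R w) has_derivative (\<lambda>t. t *\<^sub>R w)) (at 0)"
    by (auto intro!: derivative_eq_intros)
  have "((\<lambda>t. \<phi> (u + t *\<^sub>R w)) has_derivative (\<lambda>t. \<phi>' (t *\<^sub>R w))) (at 0)"
    by (rule has_derivative_compose[OF line]) (use assms in simp)
  then have "((\<lambda>t. \<phi> (u + t *\<^sub>R w)) has_vector_derivative \<phi>' w) (at 0)"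
    using has_derivative_linear[OF assms(4)] by (simp add: has_vector_derivative_def linear_scale)
  moreover have "open ((\<lambda>t. u + t *\<^sub>R w) -` U)"
    by (rule open_vimage[OF assms(1)]) (intro continuous_intros)
  ultimately have "(?\<gamma> has_vector_derivative \<phi>' w) (at 0)"
    by (rule has_vector_derivative_transform_within_open) (use assms in auto)
  then show ?thesis
    unfolding tangent_space_def mem_Collect_eq
    by (intro exI[of _ ?\<gamma>]) (use assms in auto)
qed

text \<open>Pulled back to a chart \<phi>, the fields are images under d\<phi> of fields in the
  plane. The second derivative of \<phi> contributes a symmetric term that cancels in the bracket,
  and the rest lies in the image of d\<phi>.\<close>

lemma bracket_tangent:
  assumes M: "smooth_surface M" and V: "openin (top_of_set M) V" "p \<in> V"
    and X: "smooth_along V X" "\<And>q. q \<in> V \<Longrightarrow> X q \<in> tangent_space M q"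
    and Y: "smooth_along V Y" "\<And>q. q \<in> V \<Longrightarrow> Y q \<in> tangent_space M q"
  shows "Dflat M X Y p - Dflat M Y X p \<in> tangent_space M p"
proof -
  have pM: "p \<in> M" using V openin_imp_subset by blast
  obtain V0 and U :: "(real^2) set" and \<phi> \<psi> where ch: "openin (top_of_set M) V0" "p \<in> V0" "open U"
    "smooth_on U \<phi>" "smooth_along V0 \<psi>" "\<phi> ` U = V0" "\<forall>u\<in>U. \<psi> (\<phi> u) = u"
    using M pM unfolding smooth_surface_def by metis
  obtain W \<Psi> where W: "open W" "p \<in> W" "Ck_on 2 W \<Psi>"
    "\<And>q. q \<in> M \<Longrightarrow> q \<in> W \<Longrightarrow> q \<in> V0 \<and> \<Psi> q = \<psi> q"
    using smooth_along_extension[OF ch(5,1,2)] by blast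
  obtain T where T: "open T" "V = M \<inter> T" using V by (auto simp: openin_open)
  obtain u0 where u0: "u0 \<in> U" "\<phi> u0 = p" using ch by auto
  have \<phi>2: "Ck_on 2 U \<phi>" using ch by (simp add: smooth_on_def)
  have D\<phi>: "(\<phi> has_derivative frechet_derivative \<phi> (at u)) (at u)" if "u \<in> U" for u
    using \<phi>2 that by (simp add: numeral_2_eq_2 frechet_derivative_works)
  have D\<Psi>: "(\<Psi> has_derivative frechet_derivative \<Psi> (at q)) (at q)" if "q \<in> W" for q
    using W that by (simp add: numeral_2_eq_2 frechet_derivative_works)
  have VM: "\<phi> ` U \<subseteq> M" using ch openin_imp_subset by blast
  define U0 where "U0 = U \<inter> \<phi> -` (W \<inter> T)"
  have "continuous_on U \<phi>"
    using D\<phi> by (meson continuous_at_imp_continuous_on has_derivative_continuous)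
  then have U0: "open U0" unfolding U0_def using ch W T by (intro continuous_open_preimage) auto
  have u0U0: "u0 \<in> U0" using u0 V W T by (auto simp: U0_def)
  \<comment> \<open>On \<open>M\<close> near the point, \<phi> after \<Psi> is the identity;
    differentiating it along a curve with velocity Z gives the vector back.\<close>
  have lift: "frechet_derivative \<phi> (at u) (frechet_derivative \<Psi> (at (\<phi> u)) (Z (\<phi> u))) = Z (\<phi> u)"
    if u: "u \<in> U0" and Z: "\<And>q. q \<in> V \<Longrightarrow> Z q \<in> tangent_space M q" for u Z
  proof -
    have uU: "u \<in> U" "\<phi> u \<in> W" "\<phi> u \<in> V" "\<phi> u \<in> M" using u T VM by (auto simp: U0_def)
    obtain \<gamma> :: "real \<Rightarrow> R4" where \<gamma>: "\<gamma> 0 = \<phi> u" "\<And>t. \<gamma> t \<in> M"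
      "(\<gamma> has_vector_derivative Z (\<phi> u)) (at 0)"
      using Z[OF uU(3)] by (auto simp: tangent_space_def)
    have 1: "((\<lambda>t. \<Psi> (\<gamma> t)) has_vector_derivative frechet_derivative \<Psi> (at (\<phi> u)) (Z (\<phi> u))) (at 0)"
      using tangent_space_curve[OF has_derivative_at_withinI[OF D\<Psi>[OF uU(2)]] \<gamma>] .
    have "\<Psi> (\<gamma> 0) = u" using W(4)[OF uU(4,2)] \<gamma>(1) ch uU by auto
    then have "((\<phi> \<circ> (\<lambda>t. \<Psi> (\<gamma> t))) has_vector_derivative
        frechet_derivative \<phi> (at u) (frechet_derivative \<Psi> (at (\<phi> u)) (Z (\<phi> u)))) (at 0)"
      using vector_derivative_diff_chain_within[OF 1, of \<phi> "frechet_derivative \<phi> (at u)"] D\<phi>[OF uU(1)]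
      by (auto intro: has_derivative_at_withinI)
    moreover have "\<forall>\<^sub>F t in at 0. \<gamma> t \<in> W"
    proof -
      have "(\<gamma> \<longlongrightarrow> \<gamma> 0) (at 0)"
        using has_vector_derivative_continuous[OF \<gamma>(3)] by (simp add: continuous_within)
      then show ?thesis using W(1) uU(2) \<gamma>(1) by (auto dest: topological_tendstoD)
    qed
    then have "\<forall>\<^sub>F t in at 0. (\<phi> \<circ> (\<lambda>t. \<Psi> (\<gamma> t))) t = \<gamma> t"
    proof eventually_elim
      case (elim t)
      then have "\<gamma> t \<in> V0" "\<Psi> (\<gamma> t) = \<psi> (\<gamma> t)" using W(4)[OF \<gamma>(2)] by auto
      then show ?case using ch by auto
    qed
    ultimately have "(\<gamma> has_vector_derivative
        frechet_derivative \<phi> (at u) (frechet_derivative \<Psi> (at (\<phi> u)) (Z (\<phi> u)))) (at 0)"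
      unfolding has_vector_derivative_def
      by (rule has_derivative_transform_eventually) (use \<open>\<Psi> (\<gamma> 0) = u\<close> \<gamma> in auto)
    then show ?thesis using \<gamma>(3) vector_derivative_unique_at by blast
  qed
  define x where "x Z u = frechet_derivative \<Psi> (at (\<phi> u)) (Z (\<phi> u))" for Z u
  define B where "B w v = frechet_derivative (\<lambda>u. frechet_derivative \<phi> (at u) v) (at u0) w" for v w
  have key: "\<exists>x'. Dflat M Y Z p = B (x Y u0) (x Z u0) + frechet_derivative \<phi> (at u0) x'"
    if Z: "smooth_along V Z" "\<And>q. q \<in> V \<Longrightarrow> Z q \<in> tangent_space M q"
      and Y: "\<And>q. q \<in> V \<Longrightarrow> Y q \<in> tangent_space M q" for Y Z
  proof -
    obtain G where G: "(Z has_derivative G) (at p within M)"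
      using smooth_along_differentiable[OF Z(1) V] by (auto simp: differentiable_def)
    have "(Z has_derivative G) (at (\<phi> u0) within \<phi> ` U)"
      using G VM u0 by (auto intro: has_derivative_subset)
    then have "((\<lambda>u. Z (\<phi> u)) has_derivative (\<lambda>h. G (frechet_derivative \<phi> (at u0) h))) (at u0 within U)"
      by (rule has_derivative_in_compose[OF has_derivative_at_withinI[OF D\<phi>[OF u0(1)]]])
    then have DZ: "((\<lambda>u. Z (\<phi> u)) has_derivative (\<lambda>h. G (frechet_derivative \<phi> (at u0) h))) (at u0)"
      using at_within_open[OF u0(1) ch(3)] by simp
    obtain x' where x': "(x Z has_derivative x') (at u0)"
      unfolding x_def[abs_def]
      using has_derivative_frechet_arg[OF W(1,3) D\<phi>[OF u0(1)] U0 u0U0 _ DZ] by (force simp: U0_def)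
    have "((\<lambda>u. frechet_derivative \<phi> (at u) (x Z u)) has_derivative
        (\<lambda>h. B h (x Z u0) + frechet_derivative \<phi> (at u0) (x' h))) (at u0)"
      unfolding B_def
      using has_derivative_frechet_arg[where g = "\<lambda>u. u", OF ch(3) \<phi>2 has_derivative_ident ch(3) u0(1) _ x']
      by simp
    then have "((\<lambda>u. Z (\<phi> u)) has_derivative
        (\<lambda>h. B h (x Z u0) + frechet_derivative \<phi> (at u0) (x' h))) (at u0)"
      by (rule has_derivative_transform_within_open[OF _ U0 u0U0]) (use lift[OF _ Z(2)] in \<open>simp add: x_def\<close>)
    \<comment> \<open>Two derivatives of the same map: one computed along \<open>M\<close>, the
      other through the lift of \<open>Z\<close> to the chart.\<close>
    from has_derivative_unique[OF DZ this]
    have "G (frechet_derivative \<phi> (at u0) (x Y u0)) = B (x Y u0) (x Z u0) + frechet_derivative \<phi> (at u0) (x' (x Y u0))"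
      by metis
    moreover have "frechet_derivative \<phi> (at u0) (x Y u0) = Y p"
      using lift[OF u0U0 Y] u0 by (simp add: x_def)
    moreover have "Dflat M Y Z p = G (Y p)" using G Y V by (intro Dflat_eq) auto
    ultimately show ?thesis by metis
  qed
  obtain y' where y': "Dflat M X Y p = B (x X u0) (x Y u0) + frechet_derivative \<phi> (at u0) y'"
    using key[OF Y X(2)] by blast
  obtain x' where x': "Dflat M Y X p = B (x Y u0) (x X u0) + frechet_derivative \<phi> (at u0) x'"
    using key[OF X Y(2)] by blast
  have "B (x X u0) (x Y u0) = B (x Y u0) (x X u0)"
    unfolding B_def by (rule mixed_derivatives[OF ch(3) u0(1) \<phi>2])
  then have "Dflat M X Y p - Dflat M Y X p = frechet_derivative \<phi> (at u0) (y' - x')"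
    using x' y' has_derivative_linear[OF D\<phi>[OF u0(1)]] by (simp add: linear_diff)
  then show ?thesis
    using chart_derivative_tangent[OF ch(3) VM u0(1) D\<phi>[OF u0(1)]] u0 by simp
qed

text \<open>A whole family is treated at once so that \<open>N\<close> is the same for all members;
  the family will be that of all values \<Omega>(v, w) on fixed vectors. \<open>N\<close> is the
  image of a ball in a chart, where a zero derivative forces constancy.\<close>

lemma locally_constant_on_surface:
  fixes F :: "(R4 \<Rightarrow> real) set"
  assumes M: "smooth_surface M" and V: "openin (top_of_set M) V" "p \<in> V"
    and F: "\<And>f q. f \<in> F \<Longrightarrow> q \<in> V \<Longrightarrow>
      \<exists>f'. (f has_derivative f') (at q within M) \<and> (\<forall>v\<in>tangent_space M q. f' v = 0)"
  obtains N where "openin (top_of_set M) N" "p \<in> N" "N \<subseteq> V" "\<And>f q. f \<in> F \<Longrightarrow> q \<in> N \<Longrightarrow> f q = f p"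
proof -
  have pM: "p \<in> M" using V openin_imp_subset by blast
  obtain V0 and U :: "(real^2) set" and \<phi> \<psi> where ch: "openin (top_of_set M) V0" "p \<in> V0" "open U"
    "smooth_on U \<phi>" "smooth_along V0 \<psi>" "\<phi> ` U = V0" "\<forall>u\<in>U. \<psi> (\<phi> u) = u"
    using M pM unfolding smooth_surface_def by metis
  obtain T where T: "open T" "V = M \<inter> T" using V by (auto simp: openin_open)
  obtain u0 where u0: "u0 \<in> U" "\<phi> u0 = p" using ch by auto
  have "Ck_on 1 U \<phi>" using ch unfolding smooth_on_def by blast
  then have D\<phi>: "(\<phi> has_derivative frechet_derivative \<phi> (at u)) (at u)" if "u \<in> U" for u
    using that by (simp add: frechet_derivative_works)
  have VM: "\<phi> ` U \<subseteq> M" using ch openin_imp_subset by blast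
  have "continuous_on U \<phi>"
    using D\<phi> by (meson continuous_at_imp_continuous_on has_derivative_continuous)
  then have "open (U \<inter> \<phi> -` T)" using ch T by (intro continuous_open_preimage) auto
  then obtain r where r: "r > 0" "ball u0 r \<subseteq> U \<inter> \<phi> -` T"
    using u0 T V open_contains_ball by blast
  define N where "N = V0 \<inter> \<psi> -` ball u0 r"
  have N: "N = \<phi> ` ball u0 r" using ch r unfolding N_def by force
  show thesis
  proof (rule that[of N])
    have "openin (top_of_set V0) N"
      unfolding N_def by (intro continuous_openin_preimage_gen smooth_along_continuous_on[OF ch(5,1)]) auto
    then show "openin (top_of_set M) N" using ch openin_trans by blast
    show "p \<in> N" using N u0 r by auto
    show "N \<subseteq> V" using N r VM T by blast
    show "f q = f p" if f: "f \<in> F" and q: "q \<in> N" for f q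
    proof -
      obtain u where u: "u \<in> ball u0 r" "q = \<phi> u" using q N by auto
      have "((\<lambda>u. f (\<phi> u)) has_derivative (\<lambda>h. 0)) (at u within ball u0 r)" if u: "u \<in> ball u0 r" for u
      proof -
        have uU: "u \<in> U" "\<phi> u \<in> V" using u r VM T by blast+
        obtain f' where f': "(f has_derivative f') (at (\<phi> u) within M)" "\<forall>v\<in>tangent_space M (\<phi> u). f' v = 0"
          using F[OF f uU(2)] by blast
        have "(f has_derivative f') (at (\<phi> u) within \<phi> ` ball u0 r)"
          using f'(1) VM r by (auto intro!: has_derivative_subset[OF f'(1)])
        then have "((\<lambda>u. f (\<phi> u)) has_derivative (\<lambda>h. f' (frechet_derivative \<phi> (at u) h))) (at u within ball u0 r)"
          by (rule has_derivative_in_compose[OF has_derivative_at_withinI[OF D\<phi>[OF uU(1)]]])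
        moreover have "f' (frechet_derivative \<phi> (at u) h) = 0" for h
          using f'(2) chart_derivative_tangent[OF ch(3) VM uU(1) D\<phi>[OF uU(1)]] by blast
        ultimately show ?thesis by simp
      qed
      from has_derivative_zero_unique[OF convex_ball this u(1), of u0] show ?thesis using u u0 r by simp
    qed
  qed
qed

lemma in_span_pair_iff: "v \<in> span {a, b} \<longleftrightarrow> (\<exists>x y. v = x *\<^sub>R a + y *\<^sub>R b)"
proof -
  have "v \<in> span {a, b} \<longleftrightarrow> (\<exists>x y. v - x *\<^sub>R a = y *\<^sub>R b)"
    by (auto simp: span_breakdown_eq span_singleton)
  then show ?thesis by (simp add: algebra_simps diff_eq_eq)
qed

lemma component_eq:
  assumes "independent {E 1 p, E 2 p}" "E 1 p \<noteq> E 2 p"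
  shows "component E 1 p (x *\<^sub>R E 1 p + y *\<^sub>R E 2 p) = x"
    and "component E 2 p (x *\<^sub>R E 1 p + y *\<^sub>R E 2 p) = y"
proof -
  have "E 1 p \<in> {E 1 p, E 2 p}" "E 2 p \<in> {E 1 p, E 2 p}" by auto
  then show "component E 1 p (x *\<^sub>R E 1 p + y *\<^sub>R E 2 p) = x"
    and "component E 2 p (x *\<^sub>R E 1 p + y *\<^sub>R E 2 p) = y"
    using assms unfolding component_def
    by (simp_all add: representation_add representation_scale representation_basis span_add span_scale span_base)
qed

section \<open>Volume forms and coordinates\<close>

locale volume_form =
  fixes \<mu> :: "R4 \<Rightarrow> R4 \<Rightarrow> R4 \<Rightarrow> R4 \<Rightarrow> real"
  assumes lin1: "linear (\<lambda>x. \<mu> x a b c)" and lin2: "linear (\<lambda>x. \<mu> a x b c)"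
    and lin3: "linear (\<lambda>x. \<mu> a b x c)" and lin4: "linear (\<lambda>x. \<mu> a b c x)"
    and alt12: "\<mu> x x a b = 0" and alt23: "\<mu> a x x b = 0" and alt34: "\<mu> a b x x = 0"
begin

lemmas mu_add = lin1[THEN linear_add] lin2[THEN linear_add] lin3[THEN linear_add] lin4[THEN linear_add]
lemmas mu_scale = lin1[THEN linear_scale] lin2[THEN linear_scale] lin3[THEN linear_scale] lin4[THEN linear_scale]

lemma swap12: "\<mu> b a c d = - \<mu> a b c d"
  using alt12[of "a + b" c d] alt12[of a c d] alt12[of b c d] unfolding mu_add by linarith
lemma swap23: "\<mu> a c b d = - \<mu> a b c d"
  using alt23[of a "b + c" d] alt23[of a b d] alt23[of a c d] unfolding mu_add by linarith
lemma swap34: "\<mu> a b d c = - \<mu> a b c d"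
  using alt34[of a b "c + d"] alt34[of a b c] alt34[of a b d] unfolding mu_add by linarith

lemma alt13: "\<mu> x a x b = 0" using swap23[of x x a b] by (simp add: alt12)
lemma alt24: "\<mu> a x b x = 0" using swap34[of a x b x] by (simp add: alt23)
lemma alt14: "\<mu> x a b x = 0" using swap34[of x a b x] by (simp add: alt13)

lemmas alt = alt12 alt13 alt14 alt23 alt24 alt34

lemma has_derivative:
  assumes "(f has_derivative f') (at p within S)" "(g has_derivative g') (at p within S)"
    "(h has_derivative h') (at p within S)" "(k has_derivative k') (at p within S)"
  shows "((\<lambda>q. \<mu> (f q) (g q) (h q) (k q)) has_derivative
    (\<lambda>v. \<mu> (f' v) (g p) (h p) (k p) + \<mu> (f p) (g' v) (h p) (k p)
      + \<mu> (f p) (g p) (h' v) (k p) + \<mu> (f p) (g p) (h p) (k' v))) (at p within S)"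
proof -
  have 4: "((\<lambda>q. \<mu> a b c (k q)) has_derivative (\<lambda>v. \<mu> a b c (k' v))) (at p within S)" for a b c
    using has_derivative_linear_arg[where T = "\<lambda>q. \<mu> a b c" and T' = "\<lambda>h v. 0" and N = UNIV, OF _ _ lin4 _ _ assms(4)]
    by (simp add: linear_zero)
  have 3: "((\<lambda>q. \<mu> a b (h q) (k q)) has_derivative (\<lambda>v. \<mu> a b (h p) (k' v) + \<mu> a b (h' v) (k p))) (at p within S)" for a b
    using has_derivative_linear_arg[where T = "\<lambda>q c. \<mu> a b c (k q)" and T' = "\<lambda>v c. \<mu> a b c (k' v)" and N = UNIV,
        OF _ _ lin3 lin3 4 assms(3)] by simp
  have 2: "((\<lambda>q. \<mu> a (g q) (h q) (k q)) has_derivative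
      (\<lambda>v. (\<mu> a (g p) (h p) (k' v) + \<mu> a (g p) (h' v) (k p)) + \<mu> a (g' v) (h p) (k p))) (at p within S)" for a
    using has_derivative_linear_arg[where T = "\<lambda>q c. \<mu> a c (h q) (k q)"
        and T' = "\<lambda>v c. \<mu> a c (h p) (k' v) + \<mu> a c (h' v) (k p)" and N = UNIV,
        OF _ _ lin2 linear_compose_add[OF lin2 lin2] 3 assms(2)] by simp
  have "((\<lambda>q. \<mu> (f q) (g q) (h q) (k q)) has_derivative
      (\<lambda>v. ((\<mu> (f p) (g p) (h p) (k' v) + \<mu> (f p) (g p) (h' v) (k p)) + \<mu> (f p) (g' v) (h p) (k p))
        + \<mu> (f' v) (g p) (h p) (k p))) (at p within S)"
    using has_derivative_linear_arg[where T = "\<lambda>q c. \<mu> c (g q) (h q) (k q)"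
        and T' = "\<lambda>v c. (\<mu> c (g p) (h p) (k' v) + \<mu> c (g p) (h' v) (k p)) + \<mu> c (g' v) (h p) (k p)" and N = UNIV,
        OF _ _ lin1 linear_compose_add[OF linear_compose_add[OF lin1 lin1] lin1] 2 assms(1)] by simp
  then show ?thesis by (simp add: algebra_simps)
qed

text \<open>Transpositions sort the basis vectors, which leaves a repeated argument or the given
  value; linearity then extends the vanishing one slot at a time.\<close>

lemma eq_zero_of_basis:
  fixes e :: "4 \<Rightarrow> R4"
  assumes e: "span (range e) = UNIV" and z: "\<mu> (e 1) (e 2) (e 3) (e 4) = 0"
  shows "\<mu> a b c d = 0"
proof -
  have basis: "\<mu> (e i) (e j) (e k) (e l) = 0" for i j k l
  proof -
    note sort =
      swap12[of "e 2" "e 1"] swap23[of _ "e 2" "e 1"] swap34[of _ _ "e 2" "e 1"]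
      swap12[of "e 3" "e 1"] swap23[of _ "e 3" "e 1"] swap34[of _ _ "e 3" "e 1"]
      swap12[of "e 3" "e 2"] swap23[of _ "e 3" "e 2"] swap34[of _ _ "e 3" "e 2"]
      swap12[of "e 4" "e 1"] swap23[of _ "e 4" "e 1"] swap34[of _ _ "e 4" "e 1"]
      swap12[of "e 4" "e 2"] swap23[of _ "e 4" "e 2"] swap34[of _ _ "e 4" "e 2"]
      swap12[of "e 4" "e 3"] swap23[of _ "e 4" "e 3"] swap34[of _ _ "e 4" "e 3"]
    show ?thesis
      using exhaust_4[of i] exhaust_4[of j] exhaust_4[of k] exhaust_4[of l]
      by (elim disjE) (simp_all add: alt sort z)
  qed
  have span: "v \<in> span (range e)" for v using e by simp
  have 1: "\<mu> x (e j) (e k) (e l) = 0" for x j k l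
    by (rule linear_eq_0_on_span[OF lin1 _ span]) (auto simp: basis)
  have 2: "\<mu> x y (e k) (e l) = 0" for x y k l
    by (rule linear_eq_0_on_span[OF lin2 _ span]) (auto simp: 1)
  have 3: "\<mu> x y z (e l) = 0" for x y z l
    by (rule linear_eq_0_on_span[OF lin3 _ span]) (auto simp: 2)
  show ?thesis
    by (rule linear_eq_0_on_span[OF lin4 _ span]) (auto simp: 3)
qed

section \<open>Coordinates with respect to a frame\<close>

definition vol4 :: "(4 \<Rightarrow> R4) \<Rightarrow> real" where
  "vol4 e = \<mu> (e 1) (e 2) (e 3) (e 4)"

text \<open>Cramer's rule.\<close>

definition coord :: "(4 \<Rightarrow> R4) \<Rightarrow> 4 \<Rightarrow> R4 \<Rightarrow> real" where
  "coord e a v = vol4 (e(a := v)) / vol4 e"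

lemma linear_coord: "linear (coord e a)"
proof (rule linearI)
  show "coord e a (v + w) = coord e a v + coord e a w" for v w
    using exhaust_4[of a] by (auto simp: coord_def vol4_def mu_add add_divide_distrib)
  show "coord e a (r *\<^sub>R v) = r *\<^sub>R coord e a v" for r v
    using exhaust_4[of a] by (auto simp: coord_def vol4_def mu_scale)
qed

lemma coord_basis:
  assumes "vol4 e \<noteq> 0"
  shows "coord e a (e b) = (if a = b then 1 else 0)"
  using assms exhaust_4[of a] exhaust_4[of b] by (auto simp: coord_def vol4_def alt)

lemma coord_sum:
  assumes "vol4 e \<noteq> 0"
  shows "coord e a (\<Sum>b\<in>UNIV. c b *\<^sub>R e b) = c a"
  by (simp add: linear_sum[OF linear_coord] linear_scale[OF linear_coord] coord_basis[OF assms] if_distrib cong: if_cong)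

text \<open>Cramer's coordinates are a left inverse of the combination map, which is therefore
  injective, hence onto by dimension.\<close>

lemma coord_expansion:
  assumes "vol4 e \<noteq> 0"
  shows "v = (\<Sum>a\<in>UNIV. coord e a v *\<^sub>R e a)"
proof -
  let ?F = "\<lambda>c::real^4. \<Sum>a\<in>UNIV. (c $ a) *\<^sub>R e a"
  have lin: "linear ?F"
    by (rule linearI) (simp_all add: sum.distrib scaleR_add_left scaleR_sum_right)
  have "inj ?F"
  proof (rule injI)
    fix c d :: "real^4" assume "?F c = ?F d"
    then have "coord e a (?F c) = coord e a (?F d)" for a by simp
    then show "c = d" by (simp add: coord_sum[OF assms] vec_eq_iff)
  qed
  then have "surj ?F" by (intro linear_injective_imp_surjective[OF lin]) simp_all
  then obtain c where "v = ?F c" by blast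
  then show ?thesis by (simp add: coord_sum[OF assms])
qed

text \<open>The benefit of Cramer's rule: coordinates in a moving frame are quotients of
  determinants, and no family of matrices has to be inverted.\<close>

lemma coord_differentiable:
  fixes E :: "4 \<Rightarrow> 'x::real_normed_vector \<Rightarrow> R4"
  assumes E: "\<And>c. E c differentiable (at p within S)" and f: "f differentiable (at p within S)"
    and "vol4 (\<lambda>c. E c p) \<noteq> 0"
  shows "(\<lambda>q. coord (\<lambda>c. E c q) a (f q)) differentiable (at p within S)"
proof -
  have vol: "(\<lambda>q. vol4 (\<lambda>c. F c q)) differentiable (at p within S)"
    if "\<And>c. F c differentiable (at p within S)" for F :: "4 \<Rightarrow> 'x \<Rightarrow> R4"
    proof -
    have "\<forall>c. \<exists>F'. (F c has_derivative F') (at p within S)"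
      using that by (auto simp: differentiable_def)
    then obtain F' where "\<And>c. (F c has_derivative F' c) (at p within S)" by metis
    then show ?thesis
      unfolding vol4_def differentiable_def using has_derivative[of "F 1" _ p S "F 2" _ "F 3" _ "F 4"] by blast
  qed
  have "(\<lambda>q. vol4 (\<lambda>c. (E(a := f)) c q)) differentiable (at p within S)"
    by (rule vol) (use E f in auto)
  moreover have "(\<lambda>c. (E(a := f)) c q) = (\<lambda>c. E c q)(a := f q)" for q by auto
  ultimately show ?thesis
    unfolding coord_def using vol[of E] E assms(3) by (intro differentiable_divide) auto
qed

lemma span_range_basis:
  assumes "vol4 e \<noteq> 0"
  shows "span (range e) = UNIV"
proof -
  have "v \<in> span (range e)" for v
  proof -
    have "v = (\<Sum>a\<in>UNIV. coord e a v *\<^sub>R e a)" by (rule coord_expansion[OF assms])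
    then show ?thesis by (metis (no_types, lifting) rangeI span_base span_mul span_sum)
  qed
  then show ?thesis by blast
qed

lemma proportional:
  assumes F: "volume_form F" and e: "vol4 e \<noteq> 0"
  shows "F a b c d = F (e 1) (e 2) (e 3) (e 4) / vol4 e * \<mu> a b c d"
proof -
  interpret F: volume_form F by fact
  define r where "r = F (e 1) (e 2) (e 3) (e 4) / vol4 e"
  have "volume_form (\<lambda>a b c d. F a b c d - r *\<^sub>R \<mu> a b c d)"
  proof (rule volume_form.intro)
    show "linear (\<lambda>x. F x a b c - r *\<^sub>R \<mu> x a b c)" for a b c
      by (rule linear_compose_sub[OF F.lin1 linear_compose_scale_right[OF lin1]])
    show "linear (\<lambda>x. F a x b c - r *\<^sub>R \<mu> a x b c)" for a b c
      by (rule linear_compose_sub[OF F.lin2 linear_compose_scale_right[OF lin2]])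
    show "linear (\<lambda>x. F a b x c - r *\<^sub>R \<mu> a b x c)" for a b c
      by (rule linear_compose_sub[OF F.lin3 linear_compose_scale_right[OF lin3]])
    show "linear (\<lambda>x. F a b c x - r *\<^sub>R \<mu> a b c x)" for a b c
      by (rule linear_compose_sub[OF F.lin4 linear_compose_scale_right[OF lin4]])
  qed (simp_all add: F.alt alt)
  moreover have "F (e 1) (e 2) (e 3) (e 4) - r *\<^sub>R \<mu> (e 1) (e 2) (e 3) (e 4) = 0"
    using e by (simp add: r_def vol4_def)
  ultimately have "F a b c d - r *\<^sub>R \<mu> a b c d = 0" by (rule volume_form.eq_zero_of_basis[OF _ span_range_basis[OF e]])
  then show ?thesis by (simp add: r_def)
qed

end

section \<open>Frames adapted to a surface\<close>

text \<open>A parallel volume form is constant, hence \<open>\<mu>\<close> has no base point. One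
  derivative of the \<open>\<xi> i\<close> suffices to define \<open>\<omega>\<close>, and it is all
  that is known of the basis constructed in \<open>normal_frame_exists\<close>.\<close>

locale moving_frame = volume_form \<mu> for \<mu> +
  fixes M V :: "R4 set" and X \<xi> :: "2 \<Rightarrow> R4 \<Rightarrow> R4"
  assumes openin_V: "openin (top_of_set M) V"
    and X_smooth: "smooth_along V (X i)"
    and \<xi>_differentiable: "q \<in> V \<Longrightarrow> \<xi> i differentiable (at q within M)"
    and tangent_span: "q \<in> V \<Longrightarrow> tangent_space M q = span {X 1 q, X 2 q}"
    and volume_one: "q \<in> V \<Longrightarrow> \<mu> (X 1 q) (X 2 q) (\<xi> 1 q) (\<xi> 2 q) = 1"
begin

section \<open>The connection matrices\<close>

definition E :: "4 \<Rightarrow> R4 \<Rightarrow> R4" where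
  "E a = (if a = 1 then X 1 else if a = 2 then X 2 else if a = 3 then \<xi> 1 else \<xi> 2)"

text \<open>The blocks of \<open>\<omega> k\<close> are the \<open>\<Gamma>\<close>, \<open>h\<close>, \<open>-\<lambda>\<close> and \<open>\<tau>\<close> of the paper.\<close>

definition \<omega> :: "2 \<Rightarrow> 4 \<Rightarrow> 4 \<Rightarrow> R4 \<Rightarrow> real" where
  "\<omega> k a b q = coord (\<lambda>c. E c q) b (Dflat M (X k) (E a) q)"

lemma E_simps: "E 1 = X 1" "E 2 = X 2" "E 3 = \<xi> 1" "E 4 = \<xi> 2"
  by (simp_all add: E_def)

lemma vol4_E: "q \<in> V \<Longrightarrow> vol4 (\<lambda>c. E c q) = 1"
  using volume_one by (simp add: vol4_def E_simps)

lemma E_differentiable: "q \<in> V \<Longrightarrow> E a differentiable (at q within M)"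
  using smooth_along_differentiable[OF X_smooth openin_V] \<xi>_differentiable by (simp add: E_def)

lemma X_tangent: "q \<in> V \<Longrightarrow> X i q \<in> tangent_space M q"
  using exhaust_2[of i] by (auto simp: tangent_span intro: span_base)

lemma coord_E: "q \<in> V \<Longrightarrow> coord (\<lambda>c. E c q) a (E b q) = (if a = b then 1 else 0)"
  using coord_basis[of "\<lambda>c. E c q" a b] by (simp add: vol4_E)

lemma coord_expansion_E:
  "q \<in> V \<Longrightarrow> v = coord (\<lambda>c. E c q) 1 v *\<^sub>R X 1 q + coord (\<lambda>c. E c q) 2 v *\<^sub>R X 2 q
    + coord (\<lambda>c. E c q) 3 v *\<^sub>R \<xi> 1 q + coord (\<lambda>c. E c q) 4 v *\<^sub>R \<xi> 2 q"
  using coord_expansion[of "\<lambda>c. E c q" v] by (simp add: vol4_E sum_4 E_simps)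

lemma coord_tangent:
  assumes "q \<in> V" "v \<in> tangent_space M q"
  shows "coord (\<lambda>c. E c q) 3 v = 0" "coord (\<lambda>c. E c q) 4 v = 0"
proof -
  obtain x y where "v = x *\<^sub>R E 1 q + y *\<^sub>R E 2 q"
    using assms by (auto simp: tangent_span in_span_pair_iff E_simps)
  then show "coord (\<lambda>c. E c q) 3 v = 0" "coord (\<lambda>c. E c q) 4 v = 0"
    using assms(1) by (simp_all add: linear_add[OF linear_coord] linear_scale[OF linear_coord] coord_E)
qed

lemma Dflat_E: "q \<in> V \<Longrightarrow> Dflat M (X k) (E a) q = (\<Sum>b\<in>UNIV. \<omega> k a b q *\<^sub>R E b q)"
  using coord_expansion[of "\<lambda>c. E c q"] by (simp add: \<omega>_def vol4_E)

text \<open>Leibniz rule for the expansion of \<open>f\<close>, solved for the derivative of one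
  coefficient. It is applied to derivatives of the frame, to fields with vanishing transversal
  coordinates, and to constant vectors.\<close>

lemma Dflat_coord:
  assumes q: "q \<in> V" and f: "f differentiable (at q within M)"
  shows "Dflat M (X k) (\<lambda>q. coord (\<lambda>c. E c q) a (f q)) q
    = coord (\<lambda>c. E c q) a (Dflat M (X k) f q) - (\<Sum>b\<in>UNIV. coord (\<lambda>c. E c q) b (f q) * \<omega> k b a q)"
proof -
  let ?c = "\<lambda>b q. coord (\<lambda>c. E c q) b (f q)"
  have "?c b differentiable (at q within M)" for b
    by (rule coord_differentiable) (use q f in \<open>auto simp: E_differentiable vol4_E\<close>)
  then have "\<forall>b. \<exists>c'. (?c b has_derivative c') (at q within M)" by (simp add: differentiable_def)
  then obtain c' where c': "\<And>b. (?c b has_derivative c' b) (at q within M)" by metis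
  have "\<forall>b. \<exists>E'. (E b has_derivative E') (at q within M)"
    using E_differentiable[OF q] by (simp add: differentiable_def)
  then obtain E' where E': "\<And>b. (E b has_derivative E' b) (at q within M)" by metis
  have Dsum: "((\<lambda>q. \<Sum>b\<in>UNIV. ?c b q *\<^sub>R E b q) has_derivative
      (\<lambda>h. \<Sum>b\<in>UNIV. ?c b q *\<^sub>R E' b h + c' b h *\<^sub>R E b q)) (at q within M)"
    by (intro has_derivative_sum has_derivative_scaleR c' E')
  have Df: "(f has_derivative (\<lambda>h. \<Sum>b\<in>UNIV. ?c b q *\<^sub>R E' b h + c' b h *\<^sub>R E b q)) (at q within M)"
  proof (subst has_derivative_cong_openin[OF openin_V q])
    show "f q' = (\<Sum>b\<in>UNIV. ?c b q' *\<^sub>R E b q')" if "q' \<in> V" for q'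
      by (rule coord_expansion) (simp add: that vol4_E)
  qed (rule Dsum)
  have "Dflat M (X k) f q = (\<Sum>b\<in>UNIV. ?c b q *\<^sub>R E' b (X k q) + c' b (X k q) *\<^sub>R E b q)"
    by (rule Dflat_eq[where Y = "X k", OF Df X_tangent[OF q]])
  then have "coord (\<lambda>c. E c q) a (Dflat M (X k) f q)
      = (\<Sum>b\<in>UNIV. ?c b q * coord (\<lambda>c. E c q) a (E' b (X k q)) + c' b (X k q) * coord (\<lambda>c. E c q) a (E b q))"
    by (simp add: linear_sum[OF linear_coord] linear_add[OF linear_coord] linear_scale[OF linear_coord])
  also have "\<dots> = (\<Sum>b\<in>UNIV. ?c b q * \<omega> k b a q) + c' a (X k q)"
    using Dflat_eq[where Y = "X k", OF E' X_tangent[OF q]]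
    by (simp only: \<omega>_def coord_E[OF q] sum.distrib) (simp add: if_distrib[of "(*) _"] cong: if_cong)
  also have "c' a (X k q) = Dflat M (X k) (?c a) q"
    using Dflat_eq[where Y = "X k", OF c' X_tangent[OF q]] by simp
  finally show ?thesis by simp
qed

lemma Dflat_X_differentiable: "q \<in> V \<Longrightarrow> Dflat M (X k) (X j) differentiable (at q within M)"
  using Dflat_field_has_derivative[OF X_smooth openin_V] smooth_along_differentiable[OF X_smooth openin_V] X_tangent
  unfolding differentiable_def by (metis (no_types, lifting))

lemma \<omega>_X_differentiable:
  assumes "q \<in> V" "a = 1 \<or> a = 2"
  shows "\<omega> k a b differentiable (at q within M)"
  unfolding \<omega>_def[abs_def]
  by (rule coord_differentiable)
    (use assms in \<open>auto simp: E_differentiable vol4_E E_simps Dflat_X_differentiable\<close>)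

text \<open>This is the derivative of the constant volume of the frame: replacing one frame vector
  by its derivative gives the Cramer numerator of a diagonal entry.\<close>

lemma trace_zero:
  assumes q: "q \<in> V"
  shows "\<omega> k 1 1 q + \<omega> k 2 2 q + \<omega> k 3 3 q + \<omega> k 4 4 q = 0"
proof -
  have "\<forall>b. \<exists>E'. (E b has_derivative E') (at q within M)"
    using E_differentiable[OF q] by (simp add: differentiable_def)
  then obtain E' where E': "\<And>b. (E b has_derivative E' b) (at q within M)" by metis
  have "((\<lambda>q. \<mu> (E 1 q) (E 2 q) (E 3 q) (E 4 q)) has_derivative (\<lambda>_. 0)) (at q within M)"
    by (subst has_derivative_cong_openin[OF openin_V q, of _ "\<lambda>_. 1"]) (auto simp: E_simps volume_one)
  from tangent_derivative_unique[OF this has_derivative[OF E' E' E' E'] X_tangent[OF q, of k]]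
  show ?thesis
    using vol4_E[OF q] Dflat_eq[where Y = "X k", OF E' X_tangent[OF q]]
    by (simp add: \<omega>_def coord_def vol4_def)
qed

lemma independent_E:
  assumes q: "q \<in> V" and "a \<noteq> b"
  shows "independent {E a q, E b q}" "E a q \<noteq> E b q"
proof -
  have ab: "E a q \<noteq> r *\<^sub>R E b q" for r
  proof
    assume "E a q = r *\<^sub>R E b q"
    then have "coord (\<lambda>c. E c q) a (E a q) = r * coord (\<lambda>c. E c q) a (E b q)"
      by (simp add: linear_scale[OF linear_coord])
    then show False using assms by (simp add: coord_E)
  qed
  have "E b q \<noteq> 0"
  proof
    assume "E b q = 0"
    then have "coord (\<lambda>c. E c q) b (E b q) = 0" by (simp add: linear_0[OF linear_coord])
    then show False using q by (simp add: coord_E)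
  qed
  then show "independent {E a q, E b q}" "E a q \<noteq> E b q"
    using ab ab[of 1] by (auto simp: independent_insert span_singleton)
qed

lemma mu_frame:
  assumes q: "q \<in> V"
  shows "\<mu> (X 1 q) (X 2 q) v w = coord (\<lambda>c. E c q) 3 v * coord (\<lambda>c. E c q) 4 w
    - coord (\<lambda>c. E c q) 4 v * coord (\<lambda>c. E c q) 3 w"
proof -
  have "\<mu> (X 1 q) (X 2 q) v w = \<mu> (X 1 q) (X 2 q)
      (coord (\<lambda>c. E c q) 1 v *\<^sub>R X 1 q + coord (\<lambda>c. E c q) 2 v *\<^sub>R X 2 q
        + coord (\<lambda>c. E c q) 3 v *\<^sub>R \<xi> 1 q + coord (\<lambda>c. E c q) 4 v *\<^sub>R \<xi> 2 q)
      (coord (\<lambda>c. E c q) 1 w *\<^sub>R X 1 q + coord (\<lambda>c. E c q) 2 w *\<^sub>R X 2 q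
        + coord (\<lambda>c. E c q) 3 w *\<^sub>R \<xi> 1 q + coord (\<lambda>c. E c q) 4 w *\<^sub>R \<xi> 2 q)"
    using coord_expansion_E[OF q] by metis
  then show ?thesis
    by (simp add: mu_add mu_scale alt swap34[of _ _ "\<xi> 2 q" "\<xi> 1 q"] volume_one[OF q] algebra_simps)
qed

lemma tangent_iff_coord:
  assumes q: "q \<in> V"
  shows "v \<in> tangent_space M q \<longleftrightarrow> coord (\<lambda>c. E c q) 3 v = 0 \<and> coord (\<lambda>c. E c q) 4 v = 0"
proof
  assume "coord (\<lambda>c. E c q) 3 v = 0 \<and> coord (\<lambda>c. E c q) 4 v = 0"
  then have "v = coord (\<lambda>c. E c q) 1 v *\<^sub>R X 1 q + coord (\<lambda>c. E c q) 2 v *\<^sub>R X 2 q"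
    using coord_expansion_E[OF q, of v] by simp
  then show "v \<in> tangent_space M q" unfolding tangent_span[OF q] in_span_pair_iff by blast
qed (use coord_tangent[OF q] in auto)

lemma Dflat_combination:
  assumes "f differentiable (at q within M)" "Y q = r *\<^sub>R X 1 q + s *\<^sub>R X 2 q"
  shows "Dflat M Y f q = r *\<^sub>R Dflat M (X 1) f q + s *\<^sub>R Dflat M (X 2) f q"
  unfolding Dflat_def assms(2)
  by (simp add: linear_add[OF linear_frechet_derivative[OF assms(1)]] linear_scale[OF linear_frechet_derivative[OF assms(1)]])

section \<open>The induced geometry in terms of the connection matrices\<close>

definition tng :: "2 \<Rightarrow> 4" where "tng j = (if j = 1 then 1 else 2)"
definition nor :: "2 \<Rightarrow> 4" where "nor j = (if j = 1 then 3 else 4)"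

lemma E_tng: "E (tng j) = X j" and E_nor: "E (nor j) = \<xi> j"
  using exhaust_2[of j] by (auto simp: tng_def nor_def E_simps)

context
  fixes \<sigma> assumes \<sigma>: "\<And>q. q \<in> V \<Longrightarrow> \<sigma> q = span {\<xi> 1 q, \<xi> 2 q}"
begin

lemma tangent_part_frame:
  assumes q: "q \<in> V"
  shows "tangent_part M \<sigma> q w = coord (\<lambda>c. E c q) 1 w *\<^sub>R X 1 q + coord (\<lambda>c. E c q) 2 w *\<^sub>R X 2 q"
    (is "_ = ?t")
  unfolding tangent_part_def
proof (rule the_equality)
  have "w - ?t = coord (\<lambda>c. E c q) 3 w *\<^sub>R \<xi> 1 q + coord (\<lambda>c. E c q) 4 w *\<^sub>R \<xi> 2 q"
    using coord_expansion_E[OF q, of w] by (simp add: algebra_simps)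
  then show "?t \<in> tangent_space M q \<and> w - ?t \<in> \<sigma> q"
    unfolding tangent_span[OF q] \<sigma>[OF q] in_span_pair_iff by blast
next
  fix t assume t: "t \<in> tangent_space M q \<and> w - t \<in> \<sigma> q"
  obtain x y where xy: "w - t = x *\<^sub>R E 3 q + y *\<^sub>R E 4 q"
    using t unfolding \<sigma>[OF q] in_span_pair_iff E_simps by blast
  have "coord (\<lambda>c. E c q) a (w - t) = 0" if "a = 1 \<or> a = 2" for a
    unfolding xy using that q by (auto simp: linear_add[OF linear_coord] linear_scale[OF linear_coord] coord_E)
  then have "coord (\<lambda>c. E c q) 1 t = coord (\<lambda>c. E c q) 1 w" "coord (\<lambda>c. E c q) 2 t = coord (\<lambda>c. E c q) 2 w"
    by (simp_all add: linear_diff[OF linear_coord])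
  then show "t = ?t" using coord_expansion_E[OF q, of t] coord_tangent[OF q, of t] t by simp
qed

lemma transversal_part_frame:
  assumes q: "q \<in> V"
  shows "transversal_part M \<sigma> q w = coord (\<lambda>c. E c q) 3 w *\<^sub>R \<xi> 1 q + coord (\<lambda>c. E c q) 4 w *\<^sub>R \<xi> 2 q"
  using coord_expansion_E[OF q, of w]
  by (simp add: transversal_part_def tangent_part_frame[OF q] algebra_simps)

lemma component_tangent_part:
  assumes q: "q \<in> V"
  shows "component X j q (tangent_part M \<sigma> q w) = coord (\<lambda>c. E c q) (tng j) w"
  using component_eq[of X q] independent_E[OF q, of 1 2] exhaust_2[of j]
  by (auto simp: tangent_part_frame[OF q] tng_def E_simps)

lemma component_transversal_part:
  assumes q: "q \<in> V"
  shows "component \<xi> j q (transversal_part M \<sigma> q w) = coord (\<lambda>c. E c q) (nor j) w"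
  using component_eq[of \<xi> q] independent_E[OF q, of 3 4] exhaust_2[of j]
  by (auto simp: transversal_part_frame[OF q] nor_def E_simps)

lemma nabla_frame:
  "q \<in> V \<Longrightarrow> nabla M \<sigma> (X k) (X j) q = \<omega> k (tng j) 1 q *\<^sub>R X 1 q + \<omega> k (tng j) 2 q *\<^sub>R X 2 q"
  by (simp add: nabla_def tangent_part_frame \<omega>_def E_tng)

lemma Gam_frame: "q \<in> V \<Longrightarrow> Gam M \<sigma> X i j k q = \<omega> i (tng j) (tng k) q"
  by (simp add: Gam_def nabla_def component_tangent_part \<omega>_def E_tng)

lemma hform_coord: "q \<in> V \<Longrightarrow> hform M \<sigma> \<xi> k Y Z q = coord (\<lambda>c. E c q) (nor k) (Dflat M Y Z q)"
  by (simp add: hform_def component_transversal_part)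

lemma hform_frame: "q \<in> V \<Longrightarrow> hform M \<sigma> \<xi> k (X i) (X j) q = \<omega> i (tng j) (nor k) q"
  by (simp add: hform_coord \<omega>_def E_tng)

lemma tau_frame: "q \<in> V \<Longrightarrow> tau M \<sigma> \<xi> i k (X j) q = \<omega> j (nor i) (nor k) q"
  by (simp add: tau_def component_transversal_part \<omega>_def E_nor)

lemma lam_frame:
  assumes q: "q \<in> V" shows "lam M \<sigma> X \<xi> i j k q = - \<omega> j (nor i) (tng k) q"
proof -
  have "- tangent_part M \<sigma> q w = tangent_part M \<sigma> q (- w)" for w
    by (simp add: tangent_part_frame[OF q] linear_neg[OF linear_coord])
  then show ?thesis
    by (simp add: lam_def shape_def component_tangent_part[OF q] \<omega>_def E_nor linear_neg[OF linear_coord])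
qed

lemma hform_nabla_left:
  assumes q: "q \<in> V"
  shows "hform M \<sigma> \<xi> i (nabla M \<sigma> (X k) (X l)) (X m) q
    = \<omega> k (tng l) 1 q * \<omega> 1 (tng m) (nor i) q + \<omega> k (tng l) 2 q * \<omega> 2 (tng m) (nor i) q"
  using Dflat_combination[where Y = "nabla M \<sigma> (X k) (X l)", OF smooth_along_differentiable[OF X_smooth openin_V q] nabla_frame[OF q]]
  by (simp add: hform_coord[OF q] linear_add[OF linear_coord] linear_scale[OF linear_coord] \<omega>_def E_tng)

text \<open>The second field is the one that gets differentiated, so tensoriality in it takes an
  argument: the transversal coordinates of a tangent field vanish on \<open>V\<close>, and
  differentiating this identity leaves only connection terms.\<close>

lemma hform_nabla_right:
  assumes q: "q \<in> V"
  shows "hform M \<sigma> \<xi> i (X l) (nabla M \<sigma> (X k) (X m)) q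
    = \<omega> k (tng m) 1 q * \<omega> l 1 (nor i) q + \<omega> k (tng m) 2 q * \<omega> l 2 (nor i) q"
proof -
  let ?Z = "nabla M \<sigma> (X k) (X m)"
  have "(\<lambda>q. \<omega> k (tng m) 1 q *\<^sub>R X 1 q + \<omega> k (tng m) 2 q *\<^sub>R X 2 q) differentiable (at q within M)"
    by (intro differentiable_add differentiable_scaleR \<omega>_X_differentiable q
        smooth_along_differentiable[OF X_smooth openin_V]) (auto simp: tng_def)
  then have Z: "?Z differentiable (at q within M)"
    by (subst differentiable_cong_openin[OF openin_V q]) (simp_all add: nabla_frame)
  have c: "coord (\<lambda>c. E c q) a (?Z q) = (if a = 1 then \<omega> k (tng m) 1 q else if a = 2 then \<omega> k (tng m) 2 q else 0)"
    if "q \<in> V" for a q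
    using coord_E[OF that, of a 1] coord_E[OF that, of a 2]
    by (simp add: nabla_frame[OF that] linear_add[OF linear_coord] linear_scale[OF linear_coord] E_simps)
  have "Dflat M (X l) (\<lambda>q. coord (\<lambda>c. E c q) (nor i) (?Z q)) q = 0"
    using Dflat_cong_openin[OF openin_V q, of "\<lambda>q. coord (\<lambda>c. E c q) (nor i) (?Z q)" "\<lambda>_. 0"]
      Dflat_eq[where Y = "X l", OF has_derivative_const X_tangent[OF q]]
    by (simp add: c nor_def)
  then show ?thesis
    using Dflat_coord[OF q Z, of l "nor i"] by (simp add: hform_coord[OF q] c[OF q] sum_4)
qed

end

end

text \<open>\<open>\<epsilon>\<close> is a function because \<open>metric_sign\<close> is decided
  point by point; that it is locally constant is a consequence. The counterpart of
  \<open>gauss12\<close> with the indices exchanged follows from tangency of the bracket.\<close>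

locale surface_frame = moving_frame +
  fixes \<epsilon> :: "R4 \<Rightarrow> real"
  assumes surface: "smooth_surface M"
    and \<epsilon>_square: "q \<in> V \<Longrightarrow> (\<epsilon> q)\<^sup>2 = 1"
    and gauss11: "q \<in> V \<Longrightarrow> Dflat M (X 1) (X 1) q - \<xi> 1 q \<in> tangent_space M q"
    and gauss12: "q \<in> V \<Longrightarrow> Dflat M (X 1) (X 2) q - \<xi> 2 q \<in> tangent_space M q"
    and gauss22: "q \<in> V \<Longrightarrow> Dflat M (X 2) (X 2) q + \<epsilon> q *\<^sub>R \<xi> 1 q \<in> tangent_space M q"
begin

lemma second_form:
  assumes q: "q \<in> V"
  shows "\<omega> 1 1 3 q = 1" "\<omega> 1 1 4 q = 0" "\<omega> 1 2 3 q = 0" "\<omega> 1 2 4 q = 1"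
    "\<omega> 2 1 3 q = 0" "\<omega> 2 1 4 q = 1" "\<omega> 2 2 3 q = - \<epsilon> q" "\<omega> 2 2 4 q = 0"
proof -
  have 12: "\<omega> 1 2 3 q = 0" "\<omega> 1 2 4 q = 1"
    using coord_tangent[OF q gauss12[OF q]] coord_E[OF q, of _ 4]
    by (simp_all add: \<omega>_def E_simps linear_diff[OF linear_coord])
  have "Dflat M (X 1) (X 2) q - Dflat M (X 2) (X 1) q \<in> tangent_space M q"
    by (rule bracket_tangent[OF surface openin_V q X_smooth X_tangent X_smooth X_tangent])
  from coord_tangent[OF q this] 12 show "\<omega> 2 1 3 q = 0" "\<omega> 2 1 4 q = 1"
    by (simp_all add: \<omega>_def E_simps linear_diff[OF linear_coord])
  show "\<omega> 1 2 3 q = 0" "\<omega> 1 2 4 q = 1" by (rule 12)+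
  show "\<omega> 1 1 3 q = 1" "\<omega> 1 1 4 q = 0"
    using coord_tangent[OF q gauss11[OF q]] coord_E[OF q, of _ 3]
    by (simp_all add: \<omega>_def E_simps linear_diff[OF linear_coord])
  show "\<omega> 2 2 3 q = - \<epsilon> q" "\<omega> 2 2 4 q = 0"
    using coord_tangent[OF q gauss22[OF q]] coord_E[OF q, of _ 3]
    by (simp_all add: \<omega>_def E_simps linear_add[OF linear_coord] linear_scale[OF linear_coord])
qed

text \<open>Up to sign \<open>\<epsilon>\<close> is the entry \<open>\<omega> 2 2 3\<close>. Being
  continuous with values \<plusminus>1, it is then locally constant.\<close>

lemma \<epsilon>_differentiable: "q \<in> V \<Longrightarrow> \<epsilon> differentiable (at q within M)"
proof -
  assume q: "q \<in> V"
  have "(\<lambda>q. - \<omega> 2 2 3 q) differentiable (at q within M)"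
    by (intro differentiable_minus \<omega>_X_differentiable q) simp
  then show ?thesis
    by (subst differentiable_cong_openin[OF openin_V q]) (simp_all add: second_form)
qed

lemma \<epsilon>_locally_constant:
  assumes q: "q \<in> V" shows "\<forall>\<^sub>F x in at q within M. \<epsilon> q = \<epsilon> x"
proof -
  have "\<forall>\<^sub>F x in at q within M. dist (\<epsilon> x) (\<epsilon> q) < 1"
    using differentiable_imp_continuous_within[OF \<epsilon>_differentiable[OF q]]
    by (auto simp: continuous_within tendsto_iff)
  then have "\<forall>\<^sub>F x in at q within V. dist (\<epsilon> x) (\<epsilon> q) < 1 \<and> x \<in> V"
    unfolding openin_subset_at_within[OF openin_V q, symmetric]
    by (simp add: eventually_at_filter)
  then show ?thesis
    unfolding openin_subset_at_within[OF openin_V q]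
  proof eventually_elim
    case (elim x)
    then have "\<epsilon> x = 1 \<or> \<epsilon> x = -1" "\<epsilon> q = 1 \<or> \<epsilon> q = -1"
      using \<epsilon>_square[of x] \<epsilon>_square[OF q] by (simp_all add: power2_eq_1_iff)
    then show ?case using elim by (auto simp: dist_real_def)
  qed
qed

lemma \<epsilon>_has_derivative:
  assumes q: "q \<in> V" shows "(\<epsilon> has_derivative (\<lambda>_. 0)) (at q within M)"
proof -
  have "q \<in> M" using q openin_V openin_imp_subset by blast
  then show ?thesis
    by (rule has_derivative_transform_eventually[OF has_derivative_const \<epsilon>_locally_constant[OF q] refl])
qed

section \<open>Codazzi equations and cubic forms\<close>

lemma second_form_has_derivative_zero:
  assumes q: "q \<in> V" and "a = 1 \<or> a = 2" "b = 3 \<or> b = 4"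
  shows "(\<omega> i a b has_derivative (\<lambda>_. 0)) (at q within M)"
proof -
  obtain r s where "\<And>q. q \<in> V \<Longrightarrow> \<omega> i a b q = r * \<epsilon> q + s"
    using exhaust_2[of i] assms second_form by (auto intro: that[of 0 0] that[of 0 1] that[of "-1" 0])
  then show ?thesis
    by (subst has_derivative_cong_openin[OF openin_V q, of _ "\<lambda>q. r * \<epsilon> q + s"])
      (auto intro!: derivative_eq_intros \<epsilon>_has_derivative[OF q])
qed

text \<open>The transversal components of the flatness identity, in which the commutator of the
  derivatives along X_1 and X_2 is the derivative along their bracket. The symmetric Hessian
  \<open>B\<close> drops out, and so do the derivatives of the second fundamental forms, so the
  result is algebraic in \<open>\<omega>\<close>.\<close>

lemma codazzi:
  assumes q: "q \<in> V" and j: "j = 1 \<or> j = 2" and m: "m = 3 \<or> m = 4"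
  shows "(\<Sum>a\<in>UNIV. \<omega> 2 j a q * \<omega> 1 a m q) - (\<Sum>a\<in>UNIV. \<omega> 1 j a q * \<omega> 2 a m q)
    = (\<omega> 1 2 1 q - \<omega> 2 1 1 q) * \<omega> 1 j m q + (\<omega> 1 2 2 q - \<omega> 2 1 2 q) * \<omega> 2 j m q"
proof -
  let ?c = "\<lambda>a v. coord (\<lambda>c. E c q) a v"
  have smooth: "smooth_along V (E j)" using j X_smooth by (auto simp: E_simps)
  obtain G B where GB: "(E j has_derivative G) (at q within M)" "\<And>v w. B v w = B w v"
    "\<And>Y Y'. \<lbrakk>\<And>q. q \<in> V \<Longrightarrow> Y q \<in> tangent_space M q; (Y has_derivative Y') (at q within M)\<rbrakk>
      \<Longrightarrow> (Dflat M Y (E j) has_derivative (\<lambda>w. B w (Y q) + G (Y' w))) (at q within M)"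
    using Dflat_field_has_derivative[OF smooth openin_V q] by blast
  have "\<forall>i. \<exists>X'. (X i has_derivative X') (at q within M)"
    using smooth_along_differentiable[OF X_smooth openin_V q] by (simp add: differentiable_def)
  then obtain X' where X': "\<And>i. (X i has_derivative X' i) (at q within M)" by metis
  note DX = GB(3)[OF X_tangent X']
  have lin: "linear G" using GB(1) by (rule has_derivative_linear)
  have D2: "Dflat M (X k) (Dflat M (X i) (E j)) q = B (X k q) (X i q) + G (Dflat M (X k) (X i) q)" for i k
    using Dflat_eq[where Y = "X k", OF DX X_tangent[OF q]] Dflat_eq[where Y = "X k", OF X' X_tangent[OF q]] by simp
  have trans: "?c m (Dflat M (X k) (Dflat M (X i) (E j)) q) = (\<Sum>a\<in>UNIV. \<omega> i j a q * \<omega> k a m q)" for i k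
  proof -
    have "Dflat M (X k) (\<omega> i j m) q = 0"
      using Dflat_eq[where Y = "X k", OF second_form_has_derivative_zero[OF q j m] X_tangent[OF q]] by simp
    moreover have "Dflat M (X k) (\<omega> i j m) q = ?c m (Dflat M (X k) (Dflat M (X i) (E j)) q)
        - (\<Sum>b\<in>UNIV. \<omega> i j b q * \<omega> k b m q)"
      using Dflat_coord[OF q, of "Dflat M (X i) (E j)" k m] DX
      by (auto simp: \<omega>_def[abs_def] differentiable_def)
    ultimately show ?thesis by simp
  qed
  have "Dflat M (X 1) (E 2) q - Dflat M (X 2) (E 1) q
      = (\<omega> 1 2 1 q - \<omega> 2 1 1 q) *\<^sub>R X 1 q + (\<omega> 1 2 2 q - \<omega> 2 1 2 q) *\<^sub>R X 2 q"
    unfolding Dflat_E[OF q] sum_4 second_form[OF q] by (simp add: E_simps algebra_simps)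
  then have br: "G (Dflat M (X 1) (X 2) q) - G (Dflat M (X 2) (X 1) q)
      = (\<omega> 1 2 1 q - \<omega> 2 1 1 q) *\<^sub>R Dflat M (X 1) (E j) q + (\<omega> 1 2 2 q - \<omega> 2 1 2 q) *\<^sub>R Dflat M (X 2) (E j) q"
    using lin Dflat_eq[where Y = "X _", OF GB(1) X_tangent[OF q]]
    by (simp add: E_simps linear_diff[OF lin, symmetric] linear_add linear_scale)
  have "Dflat M (X 1) (Dflat M (X 2) (E j)) q - Dflat M (X 2) (Dflat M (X 1) (E j)) q
      = (\<omega> 1 2 1 q - \<omega> 2 1 1 q) *\<^sub>R Dflat M (X 1) (E j) q + (\<omega> 1 2 2 q - \<omega> 2 1 2 q) *\<^sub>R Dflat M (X 2) (E j) q"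
    using GB(2)[of "X 1 q" "X 2 q"] br by (simp add: D2)
  then have "?c m (Dflat M (X 1) (Dflat M (X 2) (E j)) q) - ?c m (Dflat M (X 2) (Dflat M (X 1) (E j)) q)
      = (\<omega> 1 2 1 q - \<omega> 2 1 1 q) * \<omega> 1 j m q + (\<omega> 1 2 2 q - \<omega> 2 1 2 q) * \<omega> 2 j m q"
    by (simp add: linear_diff[OF linear_coord, symmetric] linear_add[OF linear_coord] linear_scale[OF linear_coord] \<omega>_def)
  then show ?thesis by (simp add: trans)
qed

lemma cubic_frame:
  assumes \<sigma>: "\<And>q. q \<in> V \<Longrightarrow> \<sigma> q = span {\<xi> 1 q, \<xi> 2 q}" and q: "q \<in> V"
  shows "cubic M \<sigma> \<xi> i (X k) (X l) (X m) q
    = \<omega> k 3 (nor i) q * \<omega> l (tng m) 3 q + \<omega> k 4 (nor i) q * \<omega> l (tng m) 4 q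
      - \<omega> k (tng l) 1 q * \<omega> 1 (tng m) (nor i) q - \<omega> k (tng l) 2 q * \<omega> 2 (tng m) (nor i) q
      - \<omega> k (tng m) 1 q * \<omega> l 1 (nor i) q - \<omega> k (tng m) 2 q * \<omega> l 2 (nor i) q"
proof -
  have "Dflat M (X k) (hform M \<sigma> \<xi> i (X l) (X m)) q = Dflat M (X k) (\<omega> l (tng m) (nor i)) q"
    by (rule Dflat_cong_openin[OF openin_V q hform_frame[OF \<sigma>]])
  also have "\<dots> = 0"
    using Dflat_eq[where Y = "X k", OF second_form_has_derivative_zero[OF q] X_tangent[OF q]]
    by (simp add: tng_def nor_def)
  finally show ?thesis
    by (simp add: cubic_def hform_nabla_left[OF \<sigma> q] hform_nabla_right[OF \<sigma> q] hform_frame[OF \<sigma> q]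
        tau_frame[OF \<sigma> q]) (simp add: nor_def)
qed

end

section \<open>The affine normal plane bundle\<close>

lemma alternating_swap:
  fixes \<Omega> :: "R4 \<Rightarrow> R4 \<Rightarrow> real"
  assumes bil: "bilinear \<Omega>" and alt: "\<And>v. \<Omega> v v = 0"
  shows "\<Omega> w v = - \<Omega> v w"
proof -
  have "\<Omega> (v + w) (v + w) = \<Omega> v v + \<Omega> v w + (\<Omega> w v + \<Omega> w w)"
    by (simp only: bilinear_ladd[OF bil] bilinear_radd[OF bil])
  with alt[of v] alt[of w] alt[of "v + w"] show ?thesis by linarith
qed

definition isotropic :: "R4 set \<Rightarrow> (R4 \<Rightarrow> R4 \<Rightarrow> real) \<Rightarrow> R4 set \<Rightarrow> bool" where
  "isotropic M \<Omega> N \<longleftrightarrow> (\<forall>q\<in>N. \<forall>v\<in>tangent_space M q. \<forall>w\<in>tangent_space M q. \<Omega> v w = 0)"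

text \<open>The defining equations of the affine normal plane bundle, divided by -2 or -1: the
  entries of g in the frame have derivative zero, so \<nabla>g consists of connection terms only.
  The first two equations say that the induced connection preserves the area form of g.\<close>

locale normal_frame = surface_frame +
  assumes normal1: "q \<in> V \<Longrightarrow> \<omega> 1 1 1 q + \<omega> 1 2 2 q = 0"
    and normal2: "q \<in> V \<Longrightarrow> \<omega> 2 1 1 q + \<omega> 2 2 2 q = 0"
    and normal3: "q \<in> V \<Longrightarrow> 2 * \<epsilon> q * \<omega> 2 1 1 q + \<epsilon> q * \<omega> 1 2 1 q + \<omega> 1 1 2 q = 0"
    and normal4: "q \<in> V \<Longrightarrow> 2 * \<omega> 1 2 2 q + \<epsilon> q * \<omega> 2 2 1 q + \<omega> 2 1 2 q = 0"
begin

text \<open>On (X_1, X_1), (X_1, X_2), (X_2, X_2) the derivative of g in direction X_k has the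
  values -\<epsilon> P_k, -\<epsilon> Q_k, P_k. \<open>T\<close> and \<open>U\<close> are the same
  combinations of the \<tau> block, with \<xi>_1, \<xi>_2 in place of X_1, X_2.\<close>

definition P :: "2 \<Rightarrow> R4 \<Rightarrow> real" where "P k q = \<omega> k 1 1 q - \<omega> k 2 2 q"
definition Q :: "2 \<Rightarrow> R4 \<Rightarrow> real" where "Q k q = \<epsilon> q * \<omega> k 1 2 q + \<omega> k 2 1 q"
definition T :: "2 \<Rightarrow> R4 \<Rightarrow> real" where "T k q = \<omega> k 3 3 q - \<omega> k 4 4 q"
definition U :: "2 \<Rightarrow> R4 \<Rightarrow> real" where "U k q = \<omega> k 4 3 q + \<epsilon> q * \<omega> k 3 4 q"

lemma \<epsilon>_cases: "q \<in> V \<Longrightarrow> \<epsilon> q = 1 \<or> \<epsilon> q = -1"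
  using \<epsilon>_square power2_eq_1_iff by blast

lemma codazzi_expanded:
  assumes q: "q \<in> V"
  shows "2 * \<omega> 2 1 1 q + \<omega> 1 4 3 q + \<epsilon> q * \<omega> 1 1 2 q - \<omega> 2 3 3 q - \<omega> 1 2 1 q = 0"
    and "2 * \<omega> 2 1 2 q + \<omega> 1 4 4 q - \<omega> 1 1 1 q - \<omega> 2 3 4 q - \<omega> 1 2 2 q = 0"
    and "\<omega> 2 2 1 q - \<epsilon> q * \<omega> 1 3 3 q + 2 * \<epsilon> q * \<omega> 1 2 2 q - \<omega> 2 4 3 q - \<epsilon> q * \<omega> 2 1 2 q = 0"
    and "\<omega> 2 2 2 q - \<epsilon> q * \<omega> 1 3 4 q - 2 * \<omega> 1 2 1 q - \<omega> 2 4 4 q + \<omega> 2 1 1 q = 0"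
  using codazzi[OF q, of 1 3] codazzi[OF q, of 1 4] codazzi[OF q, of 2 3] codazzi[OF q, of 2 4]
  by (simp_all add: sum_4 second_form[OF q] algebra_simps)

lemma diagonal:
  assumes q: "q \<in> V"
  shows "\<omega> k 1 1 q = P k q / 2" "\<omega> k 2 2 q = - (P k q / 2)" "\<omega> k 3 3 q = T k q / 2" "\<omega> k 4 4 q = - (T k q / 2)"
  using normal1[OF q] normal2[OF q] trace_zero[OF q, of k] exhaust_2[of k]
  by (auto simp: P_def T_def field_simps)

text \<open>The relations between \<open>P\<close> and \<open>Q\<close> restate
  \<open>normal3\<close> and \<open>normal4\<close>. Inserting them into sums of two Codazzi
  equations, with the vanishing traces, gives those between \<open>T\<close> and
  \<open>U\<close>.\<close>

lemma structure_equations: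
  assumes q: "q \<in> V"
  shows "P 2 q = - Q 1 q" "Q 2 q = \<epsilon> q * P 1 q" "U 1 q = T 2 q" "U 2 q = - \<epsilon> q * T 1 q"
  using normal3[OF q] normal4[OF q] codazzi_expanded[OF q] diagonal[OF q, of 1] diagonal[OF q, of 2]
    \<epsilon>_cases[OF q] by (auto simp: Q_def U_def)

section \<open>Kernel equations and forms with the required components\<close>

definition in_kernel :: "real \<Rightarrow> real \<Rightarrow> R4 \<Rightarrow> bool" where
  "in_kernel A B q \<longleftrightarrow>
    (\<forall>k. (\<omega> k 4 2 q - \<omega> k 3 1 q) * A + (\<epsilon> q * \<omega> k 3 2 q + \<omega> k 4 1 q) * B = 0) \<and>
    (Q 1 q + T 2 q) * A + \<epsilon> q * (P 1 q + T 1 q) * B = 0 \<and>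
    (P 1 q - T 1 q) * A + (T 2 q - Q 1 q) * B = 0"

text \<open>The derivatives in the directions \<open>X\<^sub>k\<close> that a parallel form imposes on its components
  \<open>A\<close> and \<open>B\<close>.\<close>

definition DA :: "2 \<Rightarrow> real \<Rightarrow> real \<Rightarrow> R4 \<Rightarrow> real" where
  "DA k A B q = (\<omega> k 1 1 q + \<omega> k 4 4 q) * A + (\<omega> k 4 3 q - \<epsilon> q * \<omega> k 1 2 q) * B"
definition DB :: "2 \<Rightarrow> real \<Rightarrow> real \<Rightarrow> R4 \<Rightarrow> real" where
  "DB k A B q = (\<omega> k 1 2 q + \<omega> k 3 4 q) * A + (\<omega> k 1 1 q + \<omega> k 3 3 q) * B"

text \<open>The values -\<epsilon> G_1 and G_2 that the equations for \<eta> prescribe for its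
  derivatives.\<close>

definition D\<eta> :: "2 \<Rightarrow> R4 \<Rightarrow> real" where
  "D\<eta> k q = (if k = 1
     then - \<epsilon> q * (\<omega> 2 2 2 q - \<epsilon> q * \<omega> 1 1 2 q + \<omega> 2 3 3 q - \<epsilon> q * \<omega> 1 3 4 q)
     else \<omega> 1 1 1 q - \<epsilon> q * \<omega> 2 2 1 q - \<omega> 1 4 4 q + \<omega> 2 3 4 q)"

lemma DA_DB_kernel:
  assumes q: "q \<in> V" and ker: "in_kernel A B q"
  shows "A * DA k A B q + \<epsilon> q * B * DB k A B q = 0"
    and "A * DB k A B q - B * DA k A B q = D\<eta> k q * (A\<^sup>2 + \<epsilon> q * B\<^sup>2)"
proof -
  have k1: "(Q 1 q + T 2 q) * A + \<epsilon> q * (P 1 q + T 1 q) * B = 0"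
    and k2: "(P 1 q - T 1 q) * A + (T 2 q - Q 1 q) * B = 0"
    using ker by (auto simp: in_kernel_def)
  \<comment> \<open>The quadratic identities hold modulo the kernel equations multiplied by
    \<open>A\<close> and \<open>B\<close>; with these multiples at hand the rest is linear in the
    monomials.\<close>
  have kk: "(Q 1 q + T 2 q) * A * A + \<epsilon> q * (P 1 q + T 1 q) * B * A = 0"
    "(Q 1 q + T 2 q) * A * B + \<epsilon> q * (P 1 q + T 1 q) * B * B = 0"
    "(P 1 q - T 1 q) * A * A + (T 2 q - Q 1 q) * B * A = 0"
    "(P 1 q - T 1 q) * A * B + (T 2 q - Q 1 q) * B * B = 0"
    using k1 k2 by algebra+
  note d = diagonal[OF q] and st = structure_equations[OF q]
  have U: "\<omega> k 4 3 q = U k q - \<epsilon> q * \<omega> k 3 4 q" for k by (simp add: U_def)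
  have c: "\<omega> 2 1 2 q = P 1 q - \<epsilon> q * \<omega> 2 2 1 q"
    using st(2) \<epsilon>_cases[OF q] by (auto simp: Q_def)
  have k: "k = 1 \<or> k = 2" using exhaust_2[of k] .
  from \<epsilon>_cases[OF q] k show "A * DA k A B q + \<epsilon> q * B * DB k A B q = 0"
    using kk by (auto simp: DA_def DB_def d U st algebra_simps)
  from \<epsilon>_cases[OF q] k show "A * DB k A B q - B * DA k A B q = D\<eta> k q * (A\<^sup>2 + \<epsilon> q * B\<^sup>2)"
    using kk by (auto simp: DA_def DB_def D\<eta>_def d U st c algebra_simps power2_eq_square)
qed

text \<open>The components \<open>J a b\<close> of the form with \<open>\<Omega>(X\<^sub>1,\<xi>\<^sub>2) = \<Omega>(X\<^sub>2,\<xi>\<^sub>1) = A\<close> and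
  \<open>\<Omega>(X\<^sub>1,\<xi>\<^sub>1) = -\<epsilon> \<Omega>(X\<^sub>2,\<xi>\<^sub>2) = B\<close> for which the tangent planes and the planes of the bundle are
  Lagrangian.\<close>

definition J :: "real \<Rightarrow> real \<Rightarrow> real \<Rightarrow> 4 \<Rightarrow> 4 \<Rightarrow> real" where
  "J e A B a b = (if (a, b) = (1, 4) \<or> (a, b) = (2, 3) then A
    else if (a, b) = (4, 1) \<or> (a, b) = (3, 2) then - A
    else if (a, b) = (1, 3) then B else if (a, b) = (3, 1) then - B
    else if (a, b) = (2, 4) then - e * B else if (a, b) = (4, 2) then e * B else 0)"

definition form :: "real \<Rightarrow> real \<Rightarrow> R4 \<Rightarrow> R4 \<Rightarrow> R4 \<Rightarrow> real" where
  "form A B q v w = (\<Sum>a\<in>UNIV. \<Sum>b\<in>UNIV.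
     J (\<epsilon> q) A B a b * coord (\<lambda>c. E c q) a v * coord (\<lambda>c. E c q) b w)"

text \<open>The Leibniz rule for \<Omega>(E_a, E_b) with constant \<Omega>. The pairs (1,3) and
  (1,4) define \<open>DB\<close> and \<open>DA\<close>; (2,3) and (2,4) hold by the structure
  equations and the F part of the kernel equations; (3,4) is the L part.\<close>

lemma J_parallel:
  assumes q: "q \<in> V" and ker: "in_kernel A B q"
  shows "J (\<epsilon> q) (DA k A B q) (DB k A B q) a b
    = (\<Sum>c\<in>UNIV. \<omega> k a c q * J (\<epsilon> q) A B c b) + (\<Sum>c\<in>UNIV. \<omega> k b c q * J (\<epsilon> q) A B a c)"
proof -
  have k1: "(Q 1 q + T 2 q) * A + \<epsilon> q * (P 1 q + T 1 q) * B = 0"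
    and k2: "(P 1 q - T 1 q) * A + (T 2 q - Q 1 q) * B = 0"
    and k3: "(\<omega> k 4 2 q - \<omega> k 3 1 q) * A + (\<epsilon> q * \<omega> k 3 2 q + \<omega> k 4 1 q) * B = 0"
    using ker by (auto simp: in_kernel_def)
  note d = diagonal[OF q] and st = structure_equations[OF q]
  have U: "\<omega> k 4 3 q = U k q - \<epsilon> q * \<omega> k 3 4 q" for k by (simp add: U_def)
  have Q: "\<omega> k 2 1 q = Q k q - \<epsilon> q * \<omega> k 1 2 q" for k by (simp add: Q_def)
  from \<epsilon>_cases[OF q] exhaust_2[of k] show ?thesis
    using exhaust_4[of a] exhaust_4[of b] k1 k2 k3
    by (elim disjE)
      (simp_all add: J_def DA_def DB_def sum_4 second_form[OF q] d U Q st algebra_simps)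
qed


lemma J_has_derivative:
  assumes q: "q \<in> V" and A: "(A has_derivative A') (at q within M)" and B: "(B has_derivative B') (at q within M)"
  shows "((\<lambda>q. J (\<epsilon> q) (A q) (B q) a b) has_derivative (\<lambda>h. J (\<epsilon> q) (A' h) (B' h) a b)) (at q within M)"
proof -
  have 1: "((\<lambda>q. \<epsilon> q * B q) has_derivative (\<lambda>h. \<epsilon> q * B' h)) (at q within M)"
    using has_derivative_mult[OF \<epsilon>_has_derivative[OF q] B] by simp
  have 2: "((\<lambda>q. - \<epsilon> q * B q) has_derivative (\<lambda>h. - \<epsilon> q * B' h)) (at q within M)"
    using has_derivative_minus[OF 1] by simp
  show ?thesis
    using exhaust_4[of a] exhaust_4[of b] 1 2 A B by (elim disjE) (simp_all add: J_def has_derivative_minus)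
qed

text \<open>The coordinates of fixed vectors change by the negative of \<open>\<omega>\<close>,
  which cancels the change of the coefficients given by \<open>J_parallel\<close>.\<close>

lemma form_parallel:
  assumes q: "q \<in> V" and ker: "in_kernel (A q) (B q) q"
    and A: "A differentiable (at q within M)" "\<And>k. Dflat M (X k) A q = DA k (A q) (B q) q"
    and B: "B differentiable (at q within M)" "\<And>k. Dflat M (X k) B q = DB k (A q) (B q) q"
  shows "\<exists>f'. ((\<lambda>q. form (A q) (B q) q v w) has_derivative f') (at q within M)
    \<and> (\<forall>x\<in>tangent_space M q. f' x = 0)"
proof -
  let ?c = "\<lambda>a v q. coord (\<lambda>c. E c q) a v"
  have "?c a v differentiable (at q within M)" for a v
    by (rule coord_differentiable) (use q in \<open>auto simp: E_differentiable vol4_E\<close>)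
  then have "\<forall>a v. \<exists>c'. (?c a v has_derivative c') (at q within M)" by (simp add: differentiable_def)
  then obtain c' where c': "\<And>a v. (?c a v has_derivative c' a v) (at q within M)" by metis
  have c'X: "c' a v (X k q) = - (\<Sum>b\<in>UNIV. ?c b v q * \<omega> k b a q)" for a v k
  proof -
    have "Dflat M (X k) (\<lambda>_. v) q = 0"
      using Dflat_eq[where Y = "X k", OF has_derivative_const X_tangent[OF q]] .
    then show ?thesis
      using Dflat_coord[OF q, of "\<lambda>_. v" k a] Dflat_eq[where Y = "X k", OF c' X_tangent[OF q], of a v]
      by (simp add: linear_0[OF linear_coord])
  qed
  obtain A' where A': "(A has_derivative A') (at q within M)" using A by (auto simp: differentiable_def)
  obtain B' where B': "(B has_derivative B') (at q within M)" using B by (auto simp: differentiable_def)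
  let ?J = "\<lambda>a b q. J (\<epsilon> q) (A q) (B q) a b"
  let ?D = "\<lambda>h. \<Sum>a\<in>UNIV. \<Sum>b\<in>UNIV. ?J a b q * ?c a v q * c' b w h
     + (?J a b q * c' a v h + J (\<epsilon> q) (A' h) (B' h) a b * ?c a v q) * ?c b w q"
  have D: "((\<lambda>q. form (A q) (B q) q v w) has_derivative ?D) (at q within M)"
    unfolding form_def
    by (intro has_derivative_sum has_derivative_mult J_has_derivative q A' B' c')
  have A'X: "A' (X k q) = DA k (A q) (B q) q" and B'X: "B' (X k q) = DB k (A q) (B q) q" for k
    using Dflat_eq[where Y = "X k", OF A' X_tangent[OF q]] Dflat_eq[where Y = "X k", OF B' X_tangent[OF q]]
      A(2) B(2) by auto
  have 0: "?D (X k q) = 0" for k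
  proof -
    have "?D (X k q) = (\<Sum>a\<in>UNIV. \<Sum>b\<in>UNIV.
        - (?J a b q * ?c a v q * (\<Sum>c\<in>UNIV. ?c c w q * \<omega> k c b q))
        - ?J a b q * (\<Sum>c\<in>UNIV. ?c c v q * \<omega> k c a q) * ?c b w q
        + ((\<Sum>c\<in>UNIV. \<omega> k a c q * ?J c b q) + (\<Sum>c\<in>UNIV. \<omega> k b c q * ?J a c q)) * ?c a v q * ?c b w q)"
      by (intro sum.cong refl) (simp add: c'X A'X B'X J_parallel[OF q ker, symmetric] algebra_simps)
    also have "\<dots> = 0"
      unfolding sum_4 by algebra
    finally show ?thesis .
  qed
  define F' where "F' = ?D"
  have F'0: "F' (X k q) = 0" for k unfolding F'_def by (rule 0)
  have "F' x = 0" if x: "x \<in> tangent_space M q" for x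
  proof -
    obtain r s where "x = r *\<^sub>R X 1 q + s *\<^sub>R X 2 q"
      using x unfolding tangent_span[OF q] in_span_pair_iff by blast
    moreover have "linear F'" using D unfolding F'_def by (rule has_derivative_linear)
    ultimately have "F' x = r *\<^sub>R F' (X 1 q) + s *\<^sub>R F' (X 2 q)"
      by (simp add: linear_add linear_scale)
    then show ?thesis by (simp add: F'0)
  qed
  then show ?thesis using D unfolding F'_def by blast
qed

section \<open>Components of a Lagrangian form\<close>

lemma lagrangian_components:
  assumes bil: "bilinear \<Omega>" and alt: "\<And>v. \<Omega> v v = 0"
    and lag: "isotropic M \<Omega> V"
    and q: "q \<in> V"
  defines "A \<equiv> \<lambda>q. \<Omega> (X 1 q) (\<xi> 2 q)" and "B \<equiv> \<lambda>q. \<Omega> (X 1 q) (\<xi> 1 q)"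
  shows "\<Omega> (E a q) (E b q) = J (\<epsilon> q) (A q) (B q) a b"
    and "in_kernel (A q) (B q) q"
    and "A differentiable (at q within M)" "Dflat M (X k) A q = DA k (A q) (B q) q"
    and "B differentiable (at q within M)" "Dflat M (X k) B q = DB k (A q) (B q) q"
proof -
  define j where "j a b q = \<Omega> (E a q) (E b q)" for a b q
  have lin: "linear (\<Omega> x)" "linear (\<lambda>x. \<Omega> x y)" for x y using bil by (auto simp: bilinear_def)
  note anti = alternating_swap[OF bil alt]
  have j_anti: "j b a q = - j a b q" for a b q by (simp add: j_def anti[of "E b q"])
  have j_diag: "j a a q = 0" for a q by (simp add: j_def alt)
  have j_diff: "j a b differentiable (at q within M)"
    and Dj: "Dflat M (X k) (j a b) q = (\<Sum>c\<in>UNIV. \<omega> k a c q * j c b q) + (\<Sum>c\<in>UNIV. \<omega> k b c q * j a c q)"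
    if q: "q \<in> V" for a b k q
  proof -
    obtain Ea Eb where E': "(E a has_derivative Ea) (at q within M)" "(E b has_derivative Eb) (at q within M)"
      using E_differentiable[OF q, of a] E_differentiable[OF q, of b] unfolding differentiable_def by blast
    have D: "(j a b has_derivative (\<lambda>h. \<Omega> (E a q) (Eb h) + \<Omega> (Ea h) (E b q))) (at q within M)"
      unfolding j_def[abs_def] by (rule bounded_bilinear.FDERIV[OF bil[unfolded bilinear_conv_bounded_bilinear] E'])
    then show "j a b differentiable (at q within M)" by (auto simp: differentiable_def)
    have "Dflat M (X k) (j a b) q = \<Omega> (E a q) (Dflat M (X k) (E b) q) + \<Omega> (Dflat M (X k) (E a) q) (E b q)"
      using Dflat_eq[where Y = "X k", OF D X_tangent[OF q]] Dflat_eq[where Y = "X k", OF E'(1) X_tangent[OF q]]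
        Dflat_eq[where Y = "X k", OF E'(2) X_tangent[OF q]] by simp
    then show "Dflat M (X k) (j a b) q = (\<Sum>c\<in>UNIV. \<omega> k a c q * j c b q) + (\<Sum>c\<in>UNIV. \<omega> k b c q * j a c q)"
      by (simp add: Dflat_E[OF q] j_def linear_sum[OF lin(1)] linear_sum[OF lin(2)]
          linear_scale[OF lin(1)] linear_scale[OF lin(2)])
  qed
  have j12: "j 1 2 q = 0" if "q \<in> V" for q
    using lag X_tangent[OF that] that by (simp add: isotropic_def j_def E_simps)
  have Dj12: "Dflat M (X k) (j 1 2) q = 0" if "q \<in> V" for k q
    using Dflat_cong_openin[OF openin_V that, of "j 1 2" "\<lambda>_. 0"] j12
      Dflat_eq[where Y = "X k", OF has_derivative_const X_tangent[OF that]] by simp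
  note upper = j_anti[of 2 1] j_anti[of 3 1] j_anti[of 3 2] j_anti[of 4 1] j_anti[of 4 2] j_anti[of 4 3]
  have j23: "j 2 3 q = j 1 4 q" if "q \<in> V" for q
    using Dj[OF that, of 1 1 2] Dj12[OF that, of 1]
    by (simp add: sum_4 second_form[OF that] j12[OF that] j_diag upper)
  have j24: "j 2 4 q = - \<epsilon> q * j 1 3 q" if "q \<in> V" for q
    using Dj[OF that, of 2 1 2] Dj12[OF that, of 2]
    by (simp add: sum_4 second_form[OF that] j12[OF that] j_diag upper)
  have D23: "Dflat M (X k) (j 2 3) q = Dflat M (X k) (j 1 4) q" if "q \<in> V" for k q
    using Dflat_cong_openin[OF openin_V that] j23 by blast
  have D24: "Dflat M (X k) (j 2 4) q = - \<epsilon> q * Dflat M (X k) (j 1 3) q" if q: "q \<in> V" for k q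
  proof -
    obtain j' where j': "(j 1 3 has_derivative j') (at q within M)" using j_diff[OF q] by (auto simp: differentiable_def)
    have "((\<lambda>q. - \<epsilon> q * j 1 3 q) has_derivative (\<lambda>h. - \<epsilon> q * j' h)) (at q within M)"
      using has_derivative_mult[OF has_derivative_minus[OF \<epsilon>_has_derivative[OF q]] j'] by simp
    from Dflat_eq[where Y = "X k", OF this X_tangent[OF q]] Dflat_eq[where Y = "X k", OF j' X_tangent[OF q]]
    show ?thesis using Dflat_cong_openin[OF openin_V q, of "j 2 4" "\<lambda>q. - \<epsilon> q * j 1 3 q"] j24 by simp
  qed
  have main: "j 3 4 q = 0"
    "(Q 1 q + T 2 q) * j 1 4 q + \<epsilon> q * (P 1 q + T 1 q) * j 1 3 q = 0"
    "(P 1 q - T 1 q) * j 1 4 q + (T 2 q - Q 1 q) * j 1 3 q = 0" if q: "q \<in> V" for q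
  proof -
    note d = diagonal[OF q] and st = structure_equations[OF q]
    have U: "\<omega> k 4 3 q = U k q - \<epsilon> q * \<omega> k 3 4 q" for k by (simp add: U_def)
    have Q: "\<omega> k 2 1 q = Q k q - \<epsilon> q * \<omega> k 1 2 q" for k by (simp add: Q_def)
    note simps = sum_4 second_form[OF q] j12[OF q] j_diag upper j23[OF q] j24[OF q] d U Q st algebra_simps
    have 1: "Dflat M (X 1) (j 2 3) q = Dflat M (X 1) (j 1 4) q" "Dflat M (X 2) (j 2 3) q = Dflat M (X 2) (j 1 4) q"
      "Dflat M (X 1) (j 2 4) q = - \<epsilon> q * Dflat M (X 1) (j 1 3) q"
      "Dflat M (X 2) (j 2 4) q = - \<epsilon> q * Dflat M (X 2) (j 1 3) q"
      by (simp_all only: D23[OF q] D24[OF q])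
    note 1 = 1[unfolded Dj[OF q]]
    \<comment> \<open>Modulo the structure equations two of the four relations coincide and give the
      first kernel equation. The other two say that (P_1 - T_1) A + (T_2 - Q_1) B equals both 2 c
      and -2 c, where A, B, c are the components with indices (1,4), (1,3), (3,4). Hence c =
      0.\<close>
    have "j 3 4 q = 0 \<and> (Q 1 q + T 2 q) * j 1 4 q + \<epsilon> q * (P 1 q + T 1 q) * j 1 3 q = 0
        \<and> (P 1 q - T 1 q) * j 1 4 q + (T 2 q - Q 1 q) * j 1 3 q = 0"
      using \<epsilon>_cases[OF q] by (elim disjE; insert 1; simp add: simps)
    then show "j 3 4 q = 0"
      "(Q 1 q + T 2 q) * j 1 4 q + \<epsilon> q * (P 1 q + T 1 q) * j 1 3 q = 0"
      "(P 1 q - T 1 q) * j 1 4 q + (T 2 q - Q 1 q) * j 1 3 q = 0" by auto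
  qed
  have "Dflat M (X k) (j 3 4) q = 0" for k
    using Dflat_cong_openin[OF openin_V q, of "j 3 4" "\<lambda>_. 0"] main(1)
      Dflat_eq[where Y = "X k", OF has_derivative_const X_tangent[OF q]] by simp
  then have L: "(\<omega> k 4 2 q - \<omega> k 3 1 q) * j 1 4 q + (\<epsilon> q * \<omega> k 3 2 q + \<omega> k 4 1 q) * j 1 3 q = 0" for k
    using Dj[OF q, of k 3 4]
    by (simp add: sum_4 j12[OF q] j_diag upper j23[OF q] j24[OF q] main(1)[OF q] algebra_simps)
  have AB: "A = j 1 4" "B = j 1 3" by (simp_all add: A_def B_def j_def[abs_def] E_simps)
  show "in_kernel (A q) (B q) q" using L main(2,3)[OF q] by (simp add: in_kernel_def AB)
  show "A differentiable (at q within M)" "B differentiable (at q within M)"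
    using j_diff[OF q] by (simp_all add: AB)
  show "Dflat M (X k) A q = DA k (A q) (B q) q" "Dflat M (X k) B q = DB k (A q) (B q) q"
    using Dj[OF q, of k 1 4] Dj[OF q, of k 1 3]
    by (simp_all add: AB sum_4 j12[OF q] j_diag upper j23[OF q] j24[OF q] main(1)[OF q] DA_def DB_def algebra_simps)
  show "\<Omega> (E a q) (E b q) = J (\<epsilon> q) (A q) (B q) a b"
    using exhaust_4[of a] exhaust_4[of b]
    by (fold j_def, elim disjE)
      (simp_all add: AB J_def j12[OF q] j_diag upper j23[OF q] j24[OF q] main(1)[OF q])
qed

end

lemma vector_4:
  "(vector [w, x, y, z] :: 'a::zero^4) $ 1 = w" "(vector [w, x, y, z] :: 'a^4) $ 2 = x"
  "(vector [w, x, y, z] :: 'a^4) $ 3 = y" "(vector [w, x, y, z] :: 'a^4) $ 4 = z"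
  unfolding vector_def by simp_all

lemma smooth_along_subset:
  assumes "smooth_along V f" "V' \<subseteq> V"
  shows "smooth_along V' f"
  unfolding smooth_along_def
proof
  fix p assume "p \<in> V'"
  then obtain W F where "open W" "p \<in> W" "smooth_on W F" "\<forall>q\<in>V \<inter> W. F q = f q"
    using assms unfolding smooth_along_def by blast
  then show "\<exists>W F. open W \<and> p \<in> W \<and> smooth_on W F \<and> (\<forall>q\<in>V' \<inter> W. F q = f q)"
    using assms(2) by (intro exI[of _ W] exI[of _ F]) auto
qed

section \<open>The matrix H and the function eta in the frame\<close>

context normal_frame
begin

definition H :: "R4 \<Rightarrow> real^2^4" where
  "H q = vector [
     vector [\<omega> 1 4 2 q - \<omega> 1 3 1 q, \<epsilon> q * \<omega> 1 3 2 q + \<omega> 1 4 1 q],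
     vector [\<omega> 2 4 2 q - \<omega> 2 3 1 q, \<epsilon> q * \<omega> 2 3 2 q + \<omega> 2 4 1 q],
     vector [2 * (Q 1 q + T 2 q), 2 * \<epsilon> q * (P 1 q + T 1 q)],
     vector [2 * (P 1 q - T 1 q), 2 * (T 2 q - Q 1 q)]]"

lemma H_kernel: "H q *v vector [A, B] = 0 \<longleftrightarrow> in_kernel A B q"
proof -
  have "2 * x * A + 2 * e * y * B = 0 \<longleftrightarrow> x * A + e * y * B = 0"
    "2 * x * A + 2 * y * B = 0 \<longleftrightarrow> x * A + y * B = 0" for x y e :: real
    by algebra+
  then show ?thesis
    by (simp add: H_def in_kernel_def matrix_vector_mult_def vec_eq_iff forall_4 forall_2 sum_2 vector_4 conj_assoc
        del: distrib_left_numeral right_diff_distrib_numeral)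
qed

text \<open>The cubic forms have no derivative term in this frame, and the Codazzi equations
  collapse the combinations in F to \<open>P\<close>, \<open>Q\<close> and \<open>T\<close>.\<close>

lemma H_matrix_eq:
  assumes \<sigma>: "\<And>q. q \<in> V \<Longrightarrow> \<sigma> q = span {\<xi> 1 q, \<xi> 2 q}"
    and \<epsilon>: "\<epsilon> q = metric_sign M vol X q" and q: "q \<in> V"
  shows "H_matrix M vol \<sigma> X \<xi> q = H q"
proof -
  note d = diagonal[OF q] and st = structure_equations[OF q] and cod = codazzi_expanded[OF q]
  have Q: "\<omega> k 2 1 q = Q k q - \<epsilon> q * \<omega> k 1 2 q" for k by (simp add: Q_def)
  have U: "\<omega> k 4 3 q = U k q - \<epsilon> q * \<omega> k 3 4 q" for k by (simp add: U_def)
  have "L_row M vol \<sigma> X \<xi> j q = vector [\<omega> j 4 2 q - \<omega> j 3 1 q, \<epsilon> q * \<omega> j 3 2 q + \<omega> j 4 1 q]" for j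
    by (simp add: L_row_def lam_frame[OF \<sigma> q] \<epsilon>[symmetric] tng_def nor_def)
  moreover have "F_row M vol \<sigma> X \<xi> 1 q = vector [2 * (Q 1 q + T 2 q), 2 * \<epsilon> q * (P 1 q + T 1 q)]"
    using \<epsilon>_cases[OF q] cod
    by (auto simp: F_row_def cubic_frame[OF \<sigma> q] \<epsilon>[symmetric] tng_def nor_def second_form[OF q] d Q U st vec_eq_iff forall_2)
  moreover have "F_row M vol \<sigma> X \<xi> 2 q = vector [2 * (P 1 q - T 1 q), 2 * (T 2 q - Q 1 q)]"
    using \<epsilon>_cases[OF q] cod
    by (auto simp: F_row_def cubic_frame[OF \<sigma> q] \<epsilon>[symmetric] tng_def nor_def second_form[OF q] d Q U st vec_eq_iff forall_2)
  ultimately show ?thesis by (simp add: H_matrix_def H_def)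
qed

lemma \<omega>_differentiable:
  assumes \<xi>: "\<And>i. smooth_along V (\<xi> i)" and q: "q \<in> V"
  shows "\<omega> k a b differentiable (at q within M)"
proof -
  have smooth: "smooth_along V (E a)" using \<xi> X_smooth by (simp add: E_def)
  obtain X' where X': "(X k has_derivative X') (at q within M)"
    using smooth_along_differentiable[OF X_smooth openin_V q] by (auto simp: differentiable_def)
  have "Dflat M (X k) (E a) differentiable (at q within M)"
    using Dflat_field_has_derivative[OF smooth openin_V q] X_tangent X'
    unfolding differentiable_def by (metis (no_types, lifting))
  then show ?thesis
    unfolding \<omega>_def[abs_def] by (intro coord_differentiable) (use q in \<open>auto simp: E_differentiable vol4_E\<close>)
qed

text \<open>For a section of the kernel that is given only pointwise: its slope is a quotient of
  entries of \<open>H\<close>. These entries contain derivatives of the \<open>\<xi> i\<close>,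
  hence the smoothness assumption.\<close>

lemma H_differentiable:
  assumes "\<And>i. smooth_along V (\<xi> i)" and q: "q \<in> V"
  shows "(\<lambda>q. H q $ i $ j) differentiable (at q within M)"
proof -
  note \<omega> = \<omega>_differentiable[OF assms] and \<epsilon> = \<epsilon>_differentiable[OF q]
  have PQT: "P k differentiable (at q within M)" "Q k differentiable (at q within M)"
    "T k differentiable (at q within M)" for k
    unfolding P_def[abs_def] Q_def[abs_def] T_def[abs_def]
    by (intro differentiable_add differentiable_diff differentiable_mult \<omega> \<epsilon>)+
  show ?thesis
    unfolding H_def using exhaust_4[of i] exhaust_2[of j]
    by (elim disjE; simp only: vector_4 vector_2;
      intro differentiable_add differentiable_diff differentiable_mult differentiable_const PQT \<omega> \<epsilon>)
qed

lemma star_equations_iff: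
  assumes \<sigma>: "\<And>q. q \<in> V \<Longrightarrow> \<sigma> q = span {\<xi> 1 q, \<xi> 2 q}"
    and \<epsilon>: "\<epsilon> q = metric_sign M vol X q" and q: "q \<in> V"
  shows "star_equations M vol \<sigma> X \<xi> \<eta> q \<longleftrightarrow>
    \<eta> differentiable (at q within M) \<and> (\<forall>k. Dflat M (X k) \<eta> q = D\<eta> k q)"
proof -
  have "D\<eta> 1 q = - \<epsilon> q * G1 M vol \<sigma> X \<xi> q" "D\<eta> 2 q = G2 M vol \<sigma> X \<xi> q"
    by (simp_all add: D\<eta>_def G1_def G2_def \<epsilon>[symmetric] Gam_frame[OF \<sigma> q] tau_frame[OF \<sigma> q] tng_def nor_def)
  then show ?thesis
    by (auto simp: star_equations_def \<epsilon>[symmetric] forall_2)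
qed

lemma eta_has_derivative:
  assumes \<epsilon>: "\<And>q. q \<in> V \<Longrightarrow> \<epsilon> q = metric_sign M vol X q" and q: "q \<in> V"
    and A: "(A has_derivative A') (at q within M)" and B: "(B has_derivative B') (at q within M)"
    and def: "eta_defined M vol X A B q"
  shows "(eta M vol X A B has_derivative
    (\<lambda>h. (A q * B' h - B q * A' h) / ((A q)\<^sup>2 + \<epsilon> q * (B q)\<^sup>2))) (at q within M)"
proof -
  have A0: "A q \<noteq> 0" using def by (simp add: eta_defined_def)
  have quot: "((\<lambda>q. B q / A q) has_derivative (\<lambda>h. (A q * B' h - B q * A' h) / (A q)\<^sup>2)) (at q within M)"
    by (rule has_derivative_eq_rhs[OF has_derivative_divide'[OF B A A0]])
      (use A0 in \<open>auto simp: fun_eq_iff field_simps power2_eq_square\<close>)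
  have qM: "q \<in> M" using q openin_V openin_imp_subset by blast
  \<comment> \<open>\<open>eta\<close> chooses its branch at each point separately; constancy of the
    sign near \<open>q\<close> makes one branch valid on a neighbourhood.\<close>
  have "\<forall>\<^sub>F x in at q within M. x \<in> V"
    using q openin_subset_at_within[OF openin_V q, symmetric] by (simp add: eventually_at_filter)
  with \<epsilon>_locally_constant[OF q]
  have ev: "\<forall>\<^sub>F x in at q within M. metric_sign M vol X x = \<epsilon> q"
    by eventually_elim (use \<epsilon> in auto)
  consider "\<epsilon> q = 1" | "\<epsilon> q = -1" using \<epsilon>_cases[OF q] by blast
  then show ?thesis
  proof cases
    case 1
    have "((\<lambda>q. arctan (B q / A q)) has_derivative
        (\<lambda>h. (A q * B' h - B q * A' h) / (A q)\<^sup>2 * inverse (1 + (B q / A q)\<^sup>2))) (at q within M)"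
      by (rule DERIV_compose_FDERIV[OF DERIV_arctan quot])
    moreover have "x / (A q)\<^sup>2 * inverse (1 + (B q / A q)\<^sup>2) = x / ((A q)\<^sup>2 + \<epsilon> q * (B q)\<^sup>2)" for x
      using A0 1 by (simp add: field_simps)
    ultimately have "((\<lambda>q. arctan (B q / A q)) has_derivative
        (\<lambda>h. (A q * B' h - B q * A' h) / ((A q)\<^sup>2 + \<epsilon> q * (B q)\<^sup>2))) (at q within M)" by simp
    then show ?thesis
      by (rule has_derivative_transform_eventually)
        (use ev 1 \<epsilon>[OF q] qM in \<open>auto simp: eta_def elim: eventually_mono\<close>)
  next
    case 2
    have ne: "\<bar>B q / A q\<bar> \<noteq> 1" using def 2 \<epsilon>[OF q] A0 by (simp add: eta_defined_def)
    have artanh: "(artanh has_real_derivative (1 / (1 - x\<^sup>2))) (at x)" if "\<bar>x\<bar> \<noteq> 1" for x :: real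
    proof (cases "\<bar>x\<bar> < 1")
      case True
      then show ?thesis by (rule artanh_real_has_field_derivative)
    next
      case False
      with that have x: "\<bar>x\<bar> > 1" by simp
      \<comment> \<open>Inversion only changes the sign of (1 + y) / (1 - y), which the real
        logarithm ignores; so the derivative outside [-1, 1] comes from the one inside.\<close>
      have inv: "artanh (1 / y) = artanh y" if "\<bar>y\<bar> > 1" for y :: real
      proof -
        have "(1 + 1 / y) / (1 - 1 / y) = - ((1 + y) / (1 - y))"
        proof -
          have "y \<noteq> 0" "y - 1 \<noteq> 0" "1 - y \<noteq> 0" using that by auto
          then show ?thesis by (simp add: divide_simps) (simp add: algebra_simps)
        qed
        then show ?thesis by (simp add: artanh_def ln_minus)
      qed
      have "((\<lambda>y. artanh (1 / y)) has_real_derivative (1 / (1 - (1 / x)\<^sup>2)) * (- 1 / x\<^sup>2)) (at x)"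
        by (rule DERIV_chain2[where f = artanh and g = "\<lambda>y. 1 / y", OF artanh_real_has_field_derivative])
          (use x in \<open>auto intro!: derivative_eq_intros simp: power2_eq_square\<close>)
      moreover have "(1 / (1 - (1 / x)\<^sup>2)) * (- 1 / x\<^sup>2) = 1 / (1 - x\<^sup>2)"
      proof -
        have "x\<^sup>2 \<noteq> 1" "x \<noteq> 0" using that x by (auto simp: power2_eq_1_iff)
        then show ?thesis by (simp add: field_simps)
      qed
      ultimately have "((\<lambda>y. artanh (1 / y)) has_real_derivative 1 / (1 - x\<^sup>2)) (at x)" by simp
      moreover have "open {y::real. \<bar>y\<bar> > 1}" by (intro open_Collect_less continuous_intros)
      ultimately show ?thesis
        unfolding has_field_derivative_def
        by (rule has_derivative_transform_within_open) (use x inv in auto)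
    qed
    have "((\<lambda>q. artanh (B q / A q)) has_derivative
        (\<lambda>h. (A q * B' h - B q * A' h) / (A q)\<^sup>2 * (1 / (1 - (B q / A q)\<^sup>2)))) (at q within M)"
      by (rule DERIV_compose_FDERIV[OF artanh[OF ne] quot])
    moreover have "x / (A q)\<^sup>2 * (1 / (1 - (B q / A q)\<^sup>2)) = x / ((A q)\<^sup>2 + \<epsilon> q * (B q)\<^sup>2)" for x
    proof -
      have "(A q)\<^sup>2 * (1 - (B q / A q)\<^sup>2) = (A q)\<^sup>2 + \<epsilon> q * (B q)\<^sup>2"
        using A0 2 by (simp add: field_simps)
      then show ?thesis by (metis divide_divide_eq_left mult.right_neutral times_divide_eq_right)
    qed
    ultimately have "((\<lambda>q. artanh (B q / A q)) has_derivative
        (\<lambda>h. (A q * B' h - B q * A' h) / ((A q)\<^sup>2 + \<epsilon> q * (B q)\<^sup>2))) (at q within M)" by (simp only:)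
    then show ?thesis
      by (rule has_derivative_transform_eventually)
        (use ev 2 \<epsilon>[OF q] qM in \<open>auto simp: eta_def elim: eventually_mono\<close>)
  qed
qed

lemma discriminant_nonzero:
  assumes "\<And>q. q \<in> V \<Longrightarrow> \<epsilon> q = metric_sign M vol X q" "q \<in> V" "eta_defined M vol X A B q"
  shows "(A q)\<^sup>2 + \<epsilon> q * (B q)\<^sup>2 \<noteq> 0"
  using \<epsilon>_cases[OF assms(2)]
proof
  assume "\<epsilon> q = 1" then show ?thesis using assms(3) by (auto simp: eta_defined_def sum_power2_eq_zero_iff)
next
  assume e: "\<epsilon> q = -1"
  then have "\<bar>B q\<bar> \<noteq> \<bar>A q\<bar>" using assms by (auto simp: eta_defined_def)
  then have "(B q)\<^sup>2 \<noteq> (A q)\<^sup>2" by (simp add: abs_square_eq_1 power2_eq_iff abs_eq_iff)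
  then show ?thesis using e by simp
qed

text \<open>Uniqueness of a local form is claimed on every open part of its domain, where the
  analysis of Lagrangian forms has to be available.\<close>

lemma restrict:
  assumes "openin (top_of_set M) V'" "V' \<subseteq> V"
  shows "normal_frame \<mu> M V' X \<xi> \<epsilon>"
proof -
  have X: "smooth_along V' (X i)" for i
    by (rule smooth_along_subset[OF X_smooth assms(2)])
  have V: "q \<in> V" if "q \<in> V'" for q using that assms(2) by blast
  show ?thesis
    by unfold_locales
      (rule assms(1) X \<xi>_differentiable[OF V] tangent_span[OF V] volume_one[OF V] surface \<epsilon>_square[OF V]
        gauss11[OF V] gauss12[OF V] gauss22[OF V] normal1[OF V] normal2[OF V] normal3[OF V] normal4[OF V]
        | assumption)+
qed

end

section \<open>Orthonormal frames\<close>

lemma parallel_volume_form_const: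
  assumes "parallel_volume_form vol"
  shows "vol p = vol 0"
proof (intro ext)
  fix a b c d
  show "vol p a b c d = vol 0 a b c d"
    by (rule has_derivative_zero_unique[OF convex_UNIV]) (use assms in \<open>auto simp: parallel_volume_form_def\<close>)
qed

lemma parallel_volume_form_imp_volume_form:
  assumes "parallel_volume_form vol"
  shows "volume_form (vol p)"
  by (rule volume_form.intro) (use assms in \<open>auto simp: parallel_volume_form_def\<close>)

text \<open>If r is the cube root of \<Delta>, orthonormality says G = r diag(\<epsilon>, 1). Hence
  r^3 = \<Delta> = \<epsilon> r^2, so r = \<epsilon>: the normalising factor is just the
  sign.\<close>

lemma orthonormal_frame_values:
  assumes X: "orthonormal_frame M vol V X" and q: "q \<in> V"
  shows "G_form M vol X (X 1) (X 1) q = 1" "G_form M vol X (X 1) (X 2) q = 0"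
    "G_form M vol X (X 2) (X 2) q = metric_sign M vol X q"
    "root 3 (Delta M vol X q) = metric_sign M vol X q" "(metric_sign M vol X q)\<^sup>2 = 1"
proof -
  define r where "r = root 3 (Delta M vol X q)"
  define e where "e = metric_sign M vol X q"
  have e: "e\<^sup>2 = 1" by (simp add: e_def metric_sign_def)
  have g: "G_form M vol X (X 1) (X 1) q / r = e" "G_form M vol X (X 1) (X 2) q / r = 0"
    "G_form M vol X (X 2) (X 2) q / r = 1"
    using X q by (auto simp: orthonormal_frame_def affine_metric_def r_def e_def)
  have r: "r \<noteq> 0" using g(3) by auto
  have G: "G_form M vol X (X 1) (X 1) q = e * r" "G_form M vol X (X 1) (X 2) q = 0"
    "G_form M vol X (X 2) (X 2) q = r"
    using g r by (auto simp: field_simps)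
  have "r ^ 3 = Delta M vol X q" unfolding r_def by (rule odd_real_root_pow) simp
  also have "\<dots> = e * r\<^sup>2" using G by (simp add: Delta_def power2_eq_square)
  finally have "r\<^sup>2 * r = r\<^sup>2 * e" by (simp add: power3_eq_cube power2_eq_square mult.commute)
  then have "r = e" using r by simp
  then show "G_form M vol X (X 1) (X 1) q = 1" "G_form M vol X (X 1) (X 2) q = 0"
    "G_form M vol X (X 2) (X 2) q = metric_sign M vol X q"
    "root 3 (Delta M vol X q) = metric_sign M vol X q" "(metric_sign M vol X q)\<^sup>2 = 1"
    using G e by (auto simp: power2_eq_square e_def[symmetric] r_def[symmetric])
qed

lemma affine_metric_commute: "affine_metric M vol u Y Z p = affine_metric M vol u Z Y p"
  by (simp add: affine_metric_def G_form_def)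

lemma normal_frame_of_surface_frame:
  assumes vol: "\<And>p. vol p = \<mu>" and frame: "surface_frame \<mu> M V X \<xi> (metric_sign M vol X)"
    and X: "orthonormal_frame M vol V X" and \<sigma>: "\<And>q. q \<in> V \<Longrightarrow> \<sigma> q = span {\<xi> 1 q, \<xi> 2 q}"
    and normal: "affine_normal_bundle M vol \<sigma>"
  shows "normal_frame \<mu> M V X \<xi> (metric_sign M vol X)"
proof -
  interpret surface_frame \<mu> M V X \<xi> "metric_sign M vol X" by (rule frame)
  let ?g = "\<lambda>j k. affine_metric M vol X (X j) (X k)"
  have g: "?g 1 1 q = metric_sign M vol X q" "?g 1 2 q = 0" "?g 2 1 q = 0" "?g 2 2 q = 1" if "q \<in> V" for q
    using X that affine_metric_commute[of M vol X "X 2" "X 1"] by (auto simp: orthonormal_frame_def)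
  \<comment> \<open>The entries of g are 0, 1 and a locally constant sign, so \<nabla>g loses its
    derivative term.\<close>
  have D: "Dflat M (X i) (?g j k) q = 0" if q: "q \<in> V" for i j k q
  proof -
    have const: "Dflat M (X i) (\<lambda>_. c) q = 0" for c :: real
      using Dflat_eq[where Y = "X i", OF has_derivative_const X_tangent[OF q]] .
    have "Dflat M (X i) (metric_sign M vol X) q = 0"
      using Dflat_eq[where Y = "X i", OF \<epsilon>_has_derivative[OF q] X_tangent[OF q]] .
    then show ?thesis
      using exhaust_2[of j] exhaust_2[of k] const
        Dflat_cong_openin[OF openin_V q g(1)] Dflat_cong_openin[OF openin_V q g(2)]
        Dflat_cong_openin[OF openin_V q g(3)] Dflat_cong_openin[OF openin_V q g(4)]
      by auto
  qed
  have lin: "affine_metric M vol X (nabla M \<sigma> (X i) (X j)) (X k) q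
      = \<omega> i (tng j) 1 q * ?g 1 k q + \<omega> i (tng j) 2 q * ?g 2 k q" if q: "q \<in> V" for i j k q
    using Dflat_combination[where Y = "nabla M \<sigma> (X i) (X j)",
        OF smooth_along_differentiable[OF X_smooth openin_V q] nabla_frame[OF \<sigma> q]]
    by (simp add: affine_metric_def G_form_def vol mu_add mu_scale algebra_simps add_divide_distrib)
  have ng: "nabla_metric M vol \<sigma> X (X i) (X j) (X k) q
      = - \<omega> i (tng j) 1 q * ?g 1 k q - \<omega> i (tng j) 2 q * ?g 2 k q
        - \<omega> i (tng k) 1 q * ?g 1 j q - \<omega> i (tng k) 2 q * ?g 2 j q" if "q \<in> V" for i j k q
    using that affine_metric_commute[of M vol X "X j"] by (simp add: nabla_metric_def D lin)
  show ?thesis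
  proof unfold_locales
    fix q assume q: "q \<in> V"
    let ?ng = "\<lambda>i j k. nabla_metric M vol \<sigma> X (X i) (X j) (X k) q"
    let ?e = "metric_sign M vol X q"
    have "?e * ?ng 1 1 1 + ?ng 1 2 2 = 0 \<and> ?e * ?ng 2 1 1 + ?ng 2 2 2 = 0 \<and>
        ?ng 2 1 1 + ?ng 1 2 1 = 0 \<and> ?ng 1 2 2 + ?ng 2 1 2 = 0"
      using normal X q unfolding affine_normal_bundle_def Let_def by blast
    moreover have "?e = 1 \<or> ?e = -1" by (simp add: metric_sign_def)
    ultimately show "\<omega> 1 1 1 q + \<omega> 1 2 2 q = 0" "\<omega> 2 1 1 q + \<omega> 2 2 2 q = 0"
      "2 * ?e * \<omega> 2 1 1 q + ?e * \<omega> 1 2 1 q + \<omega> 1 1 2 q = 0"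
      "2 * \<omega> 1 2 2 q + ?e * \<omega> 2 2 1 q + \<omega> 2 1 2 q = 0"
      by (auto simp: ng[OF q] g[OF q] tng_def)
  qed
qed

lemma adapted_frame_normal_frame:
  assumes M: "smooth_surface M" and vol: "parallel_volume_form vol"
    and normal: "affine_normal_bundle M vol \<sigma>" and adapted: "adapted_frame M vol \<sigma> V X \<xi>"
  shows "normal_frame (vol 0) M V X \<xi> (metric_sign M vol X)"
    and "q \<in> V \<Longrightarrow> \<sigma> q = span {\<xi> 1 q, \<xi> 2 q}" and "smooth_along V (\<xi> i)"
proof -
  note const = parallel_volume_form_const[OF vol]
  have X: "orthonormal_frame M vol V X" using adapted by (simp add: adapted_frame_def)
  have \<sigma>: "\<sigma> q = span {\<xi> 1 q, \<xi> 2 q}" if "q \<in> V" for q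
    using adapted that by (auto simp: adapted_frame_def local_basis_def)
  have V: "openin (top_of_set M) V" using adapted by (simp add: adapted_frame_def local_basis_def)
  have \<xi>: "smooth_along V (\<xi> i)" for i using adapted by (simp add: adapted_frame_def local_basis_def)
  interpret volume_form "vol 0" by (rule parallel_volume_form_imp_volume_form[OF vol])
  interpret moving_frame "vol 0" M V X \<xi>
  proof
    show "smooth_along V (X i)" for i
      using X by (simp add: orthonormal_frame_def local_frame_def local_basis_def)
    show "\<xi> i differentiable (at q within M)" if "q \<in> V" for q i
      by (rule smooth_along_differentiable[OF \<xi> V that])
    show "tangent_space M q = span {X 1 q, X 2 q}" if "q \<in> V" for q
      using X that by (auto simp: orthonormal_frame_def local_frame_def local_basis_def)
    show "vol 0 (X 1 q) (X 2 q) (\<xi> 1 q) (\<xi> 2 q) = 1" if "q \<in> V" for q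
    proof -
      have "vol q (X 1 q) (X 2 q) (\<xi> 1 q) (\<xi> 2 q) = 1" using adapted that by (simp add: adapted_frame_def)
      then show ?thesis unfolding const[of q] .
    qed
  qed (rule V)
  have h: "coord (\<lambda>c. E c q) 3 (Dflat M (X 1) (X 1) q) = 1" "coord (\<lambda>c. E c q) 3 (Dflat M (X 1) (X 2) q) = 0"
    "coord (\<lambda>c. E c q) 3 (Dflat M (X 2) (X 2) q) = - metric_sign M vol X q"
    "coord (\<lambda>c. E c q) 4 (Dflat M (X 1) (X 1) q) = 0" "coord (\<lambda>c. E c q) 4 (Dflat M (X 1) (X 2) q) = 1"
    "coord (\<lambda>c. E c q) 4 (Dflat M (X 2) (X 2) q) = 0" if q: "q \<in> V" for q
  proof -
    have hc: "hform M \<sigma> \<xi> k Y Z q = coord (\<lambda>c. E c q) (nor k) (Dflat M Y Z q)" for k Y Z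
      by (rule hform_coord[OF \<sigma> q])
    have "hform M \<sigma> \<xi> 1 (X 1) (X 1) q = 1" "hform M \<sigma> \<xi> 1 (X 1) (X 2) q = 0"
      "hform M \<sigma> \<xi> 1 (X 2) (X 2) q = - metric_sign M vol X q"
      "hform M \<sigma> \<xi> 2 (X 1) (X 1) q = 0" "hform M \<sigma> \<xi> 2 (X 1) (X 2) q = 1" "hform M \<sigma> \<xi> 2 (X 2) (X 2) q = 0"
      using adapted q by (auto simp: adapted_frame_def)
    then show "coord (\<lambda>c. E c q) 3 (Dflat M (X 1) (X 1) q) = 1" "coord (\<lambda>c. E c q) 3 (Dflat M (X 1) (X 2) q) = 0"
      "coord (\<lambda>c. E c q) 3 (Dflat M (X 2) (X 2) q) = - metric_sign M vol X q"
      "coord (\<lambda>c. E c q) 4 (Dflat M (X 1) (X 1) q) = 0" "coord (\<lambda>c. E c q) 4 (Dflat M (X 1) (X 2) q) = 1"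
      "coord (\<lambda>c. E c q) 4 (Dflat M (X 2) (X 2) q) = 0"
      by (simp_all add: hc nor_def)
  qed
  have "surface_frame (vol 0) M V X \<xi> (metric_sign M vol X)"
  proof unfold_locales
    fix q assume q: "q \<in> V"
    note c = tangent_iff_coord[OF q] linear_diff[OF linear_coord] linear_add[OF linear_coord]
      linear_scale[OF linear_coord] h[OF q] coord_E[OF q, of _ 3, unfolded E_simps] coord_E[OF q, of _ 4, unfolded E_simps]
    show "(metric_sign M vol X q)\<^sup>2 = 1" by (simp add: metric_sign_def)
    show "Dflat M (X 1) (X 1) q - \<xi> 1 q \<in> tangent_space M q"
      "Dflat M (X 1) (X 2) q - \<xi> 2 q \<in> tangent_space M q"
      "Dflat M (X 2) (X 2) q + metric_sign M vol X q *\<^sub>R \<xi> 1 q \<in> tangent_space M q"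
      by (simp_all add: c)
  qed (rule M)
  then show "normal_frame (vol 0) M V X \<xi> (metric_sign M vol X)"
    by (rule normal_frame_of_surface_frame[OF const _ X \<sigma> normal])
  show "q \<in> V \<Longrightarrow> \<sigma> q = span {\<xi> 1 q, \<xi> 2 q}" by (rule \<sigma>)
  show "smooth_along V (\<xi> i)" by (rule \<xi>)
qed

lemma span_transversal_planes:
  assumes "independent {a, b :: R4}" "a \<noteq> b" "independent {c, d}" "c \<noteq> d"
    and "span {a, b} \<inter> span {c, d} = {0}"
  shows "span {a, b, c, d} = UNIV"
proof -
  have "dim (span {a, b}) = 2" "dim (span {c, d}) = 2"
    using assms by (simp_all add: dim_eq_card_independent)
  moreover have "{x + y |x y. x \<in> span {a, b} \<and> y \<in> span {c, d}} = span ({a, b} \<union> {c, d})"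
    by (rule span_Un[symmetric])
  ultimately have "dim (span {a, b, c, d}) = 4"
    using dim_sums_Int[OF subspace_span subspace_span, of "{a, b}" "{c, d}"] assms(5)
    by (simp add: insert_commute)
  then show ?thesis by (simp add: dim_eq_full[symmetric])
qed

text \<open>The \<open>\<xi>\<^sub>i\<close> are the transversal parts of \<open>D\<^bsub>X\<^sub>1\<^esub> X\<^sub>i\<close>. They need not be known to be smooth for
  the derivation of the structure equations.\<close>

lemma normal_frame_exists:
  assumes M: "smooth_surface M" and vol: "parallel_volume_form vol"
    and normal: "affine_normal_bundle M vol \<sigma>" and p: "p \<in> M"
  obtains V X \<xi> where "p \<in> V" "normal_frame (vol 0) M V X \<xi> (metric_sign M vol X)"
    "\<And>q. q \<in> V \<Longrightarrow> \<sigma> q = span {\<xi> 1 q, \<xi> 2 q}"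
proof -
  note const = parallel_volume_form_const[OF vol]
  obtain V1 X where X1: "p \<in> V1" "orthonormal_frame M vol V1 X"
    using normal p by (auto simp: affine_normal_bundle_def)
  have trans: "transversal_bundle M \<sigma>" using normal by (simp add: affine_normal_bundle_def)
  obtain V2 N where V2: "p \<in> V2" "local_basis M \<sigma> V2 N"
    using trans p unfolding transversal_bundle_def by blast
  define V where "V = V1 \<inter> V2"
  have opens: "openin (top_of_set M) V1" "openin (top_of_set M) V2"
    using X1 V2 by (auto simp: orthonormal_frame_def local_frame_def local_basis_def)
  then have V: "openin (top_of_set M) V" by (simp add: V_def openin_Int)
  have X: "orthonormal_frame M vol V X"
    using X1 V unfolding orthonormal_frame_def local_frame_def local_basis_def V_def
    by (auto intro: smooth_along_subset)
  have Xs: "smooth_along V (X i)" for i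
    using X by (simp add: orthonormal_frame_def local_frame_def local_basis_def)
  have Ns: "smooth_along V (N i)" for i
    using V2(2) by (auto simp: local_basis_def V_def intro: smooth_along_subset)
  have T: "tangent_space M q = span {X 1 q, X 2 q}" "X 1 q \<noteq> X 2 q" "independent {X 1 q, X 2 q}" if "q \<in> V" for q
    using X that by (auto simp: orthonormal_frame_def local_frame_def local_basis_def)
  have S: "\<sigma> q = span {N 1 q, N 2 q}" "N 1 q \<noteq> N 2 q" "independent {N 1 q, N 2 q}" if "q \<in> V" for q
    using V2(2) that by (auto simp: local_basis_def V_def)
  have VM: "q \<in> M" if "q \<in> V" for q using V that openin_imp_subset by blast
  interpret volume_form "vol 0" by (rule parallel_volume_form_imp_volume_form[OF vol])
  \<comment> \<open>Coordinates in this auxiliary frame, built on an arbitrary local basis of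
    \<sigma>, split off the transversal parts that become the \<open>\<xi> i\<close>.\<close>
  define F where "F a = (if a = 1 then X 1 else if a = 2 then X 2 else if a = 3 then N 1 else N 2)" for a :: 4
  have F: "F 1 = X 1" "F 2 = X 2" "F 3 = N 1" "F 4 = N 2" by (simp_all add: F_def)
  have vol4: "vol4 (\<lambda>c. F c q) \<noteq> 0" if q: "q \<in> V" for q
  proof
    assume 0: "vol4 (\<lambda>c. F c q) = 0"
    have "tangent_space M q \<inter> \<sigma> q = {0}" using trans VM[OF q] by (auto simp: transversal_bundle_def)
    then have "span {X 1 q, X 2 q, N 1 q, N 2 q} = UNIV"
      using T[OF q] S[OF q] by (intro span_transversal_planes) auto
    moreover have "range (\<lambda>c. F c q) = {X 1 q, X 2 q, N 1 q, N 2 q}" by (auto simp: UNIV_4 F)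
    ultimately have "vol 0 a b c d = 0" for a b c d
      using eq_zero_of_basis[of "\<lambda>c. F c q"] 0 by (simp add: vol4_def)
    moreover have "\<exists>a b c d. vol 0 a b c d \<noteq> 0" using vol unfolding parallel_volume_form_def by blast
    ultimately show False by simp
  qed
  let ?c = "\<lambda>a q. coord (\<lambda>c. F c q) a"
  have expand: "v = ?c 1 q v *\<^sub>R X 1 q + ?c 2 q v *\<^sub>R X 2 q + (?c 3 q v *\<^sub>R N 1 q + ?c 4 q v *\<^sub>R N 2 q)"
    if "q \<in> V" for q v
    using coord_expansion[OF vol4[OF that], of v] by (simp add: sum_4 F add.assoc)
  define \<xi> where "\<xi> i q = ?c 3 q (Dflat M (X 1) (X i) q) *\<^sub>R N 1 q + ?c 4 q (Dflat M (X 1) (X i) q) *\<^sub>R N 2 q" for i q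
  have Xt: "X i q \<in> tangent_space M q" if "q \<in> V" for i q
    using exhaust_2[of i] T(1)[OF that] by (auto intro: span_base)
  have gauss: "Dflat M (X 1) (X i) q - \<xi> i q \<in> tangent_space M q" if q: "q \<in> V" for i q
  proof -
    have "Dflat M (X 1) (X i) q - \<xi> i q = ?c 1 q (Dflat M (X 1) (X i) q) *\<^sub>R X 1 q + ?c 2 q (Dflat M (X 1) (X i) q) *\<^sub>R X 2 q"
      using expand[OF q, of "Dflat M (X 1) (X i) q"] by (simp add: \<xi>_def algebra_simps)
    then show ?thesis unfolding T(1)[OF q] in_span_pair_iff by blast
  qed
  \<comment> \<open>X_1 \<and> X_2 annihilates tangent vectors, so \<open>G_form\<close> sees only
    the transversal parts of the derivatives.\<close>
  have mod_tangent: "vol 0 (X 1 q) (X 2 q) v w = vol 0 (X 1 q) (X 2 q) v' w'"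
    if q: "q \<in> V" and v: "v - v' \<in> tangent_space M q" and w: "w - w' \<in> tangent_space M q" for q v w v' w'
  proof -
    have z: "vol 0 (X 1 q) (X 2 q) t u = 0" "vol 0 (X 1 q) (X 2 q) u t = 0" if t: "t \<in> tangent_space M q" for t u
      using t unfolding T(1)[OF q] in_span_pair_iff by (auto simp: mu_add mu_scale alt)
    have "vol 0 (X 1 q) (X 2 q) (v - v' + v') w = vol 0 (X 1 q) (X 2 q) v' w"
      unfolding mu_add(3) using z(1)[OF v] by simp
    moreover have "vol 0 (X 1 q) (X 2 q) v' (w - w' + w') = vol 0 (X 1 q) (X 2 q) v' w'"
      unfolding mu_add(4) using z(2)[OF w] by simp
    ultimately show ?thesis by simp
  qed
  have G: "(1/2) * (vol 0 (X 1 q) (X 2 q) (Dflat M (X i) (X 1) q) (Dflat M (X j) (X 2) q)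
      + vol 0 (X 1 q) (X 2 q) (Dflat M (X j) (X 1) q) (Dflat M (X i) (X 2) q)) = G_form M vol X (X i) (X j) q" for i j q
    unfolding G_form_def const[of q] ..
  have refl: "v - v \<in> tangent_space M q" if "q \<in> V" for v q
    unfolding T(1)[OF that] by (simp add: span_zero)
  have bracket: "Dflat M (X 2) (X 1) q - \<xi> 2 q \<in> tangent_space M q" if q: "q \<in> V" for q
  proof -
    have "Dflat M (X 2) (X 1) q - Dflat M (X 1) (X 2) q \<in> tangent_space M q"
      by (rule bracket_tangent[OF M V q Xs Xt Xs Xt])
    with gauss[OF q, of 2] have "(Dflat M (X 2) (X 1) q - Dflat M (X 1) (X 2) q) + (Dflat M (X 1) (X 2) q - \<xi> 2 q) \<in> tangent_space M q"
      unfolding T(1)[OF q] by (rule span_add[rotated])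
    then show ?thesis by simp
  qed
  \<comment> \<open>This volume is G(X_1, X_1), which orthonormality makes 1.\<close>
  have one: "vol 0 (X 1 q) (X 2 q) (\<xi> 1 q) (\<xi> 2 q) = 1" if q: "q \<in> V" for q
    using G[where i = 1 and j = 1 and q = q] orthonormal_frame_values(1)[OF X q]
      mod_tangent[OF q gauss[OF q, of 1] gauss[OF q, of 2]] by simp
  interpret moving_frame "vol 0" M V X \<xi>
  proof
    show "\<xi> i differentiable (at q within M)" if q: "q \<in> V" for i q
    proof -
      have Fd: "F c differentiable (at q within M)" for c
        using smooth_along_differentiable[OF Xs V q] smooth_along_differentiable[OF Ns V q] by (simp add: F_def)
      obtain X' where X': "(X 1 has_derivative X') (at q within M)"
        using smooth_along_differentiable[OF Xs V q] by (auto simp: differentiable_def)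
      have "Dflat M (X 1) (X i) differentiable (at q within M)"
        using Dflat_field_has_derivative[OF Xs V q] Xt X'
        unfolding differentiable_def by (metis (no_types, lifting))
      then have c: "(\<lambda>q. ?c a q (Dflat M (X 1) (X i) q)) differentiable (at q within M)" for a
        by (intro coord_differentiable Fd vol4 q)
      show ?thesis
        unfolding \<xi>_def[abs_def]
        by (intro differentiable_add differentiable_scaleR c smooth_along_differentiable[OF Ns V q])
    qed
  qed (use V Xs T one in auto)
  have \<sigma>\<xi>: "\<sigma> q = span {\<xi> 1 q, \<xi> 2 q}" if q: "q \<in> V" for q
  proof -
    have "\<xi> i q \<in> span {N 1 q, N 2 q}" for i unfolding \<xi>_def in_span_pair_iff by blast
    then have sub: "span {\<xi> 1 q, \<xi> 2 q} \<subseteq> span {N 1 q, N 2 q}" by (intro span_minimal) auto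
    have "dim (span {\<xi> 1 q, \<xi> 2 q}) = 2" "dim (span {N 1 q, N 2 q}) = 2"
      using independent_E[OF q, of 3 4] S[OF q] by (simp_all add: E_simps dim_eq_card_independent)
    then have "span {\<xi> 1 q, \<xi> 2 q} = span {N 1 q, N 2 q}"
      by (intro subspace_dim_equal sub subspace_span) simp
    then show ?thesis using S[OF q] by simp
  qed
  have "surface_frame (vol 0) M V X \<xi> (metric_sign M vol X)"
  proof unfold_locales
    fix q assume q: "q \<in> V"
    show "(metric_sign M vol X q)\<^sup>2 = 1" by (simp add: metric_sign_def)
    show "Dflat M (X 1) (X 1) q - \<xi> 1 q \<in> tangent_space M q" "Dflat M (X 1) (X 2) q - \<xi> 2 q \<in> tangent_space M q"
      by (rule gauss[OF q])+
    let ?d = "\<lambda>a v. coord (\<lambda>c. E c q) a v"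
    let ?w = "Dflat M (X 2) (X 2) q"
    have c: "?d 3 (\<xi> 1 q) = 1" "?d 4 (\<xi> 1 q) = 0" "?d 3 (\<xi> 2 q) = 0" "?d 4 (\<xi> 2 q) = 1"
      using coord_E[OF q, of _ 3] coord_E[OF q, of _ 4] by (simp_all add: E_simps)
    \<comment> \<open>G(X_1, X_2) = 0 and G(X_2, X_2) = \<epsilon> are, up to the factors 1/2 and
      -1, the two transversal coordinates of the derivative of X_2 along itself.\<close>
    have "vol 0 (X 1 q) (X 2 q) (Dflat M (X 2) (X 1) q) ?w = vol 0 (X 1 q) (X 2 q) (\<xi> 2 q) ?w"
      "vol 0 (X 1 q) (X 2 q) (Dflat M (X 1) (X 1) q) ?w = vol 0 (X 1 q) (X 2 q) (\<xi> 1 q) ?w"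
      "vol 0 (X 1 q) (X 2 q) (Dflat M (X 2) (X 1) q) (Dflat M (X 1) (X 2) q) = vol 0 (X 1 q) (X 2 q) (\<xi> 2 q) (\<xi> 2 q)"
      by (rule mod_tangent[OF q bracket[OF q] refl[OF q]], rule mod_tangent[OF q gauss[OF q] refl[OF q]],
        rule mod_tangent[OF q bracket[OF q] gauss[OF q]])
    then have "?d 4 ?w = 0" "?d 3 ?w = - metric_sign M vol X q"
      using G[where i = 1 and j = 2 and q = q] G[where i = 2 and j = 2 and q = q]
        orthonormal_frame_values(2,3)[OF X q] by (simp_all add: mu_frame[OF q] c)
    then show "?w + metric_sign M vol X q *\<^sub>R \<xi> 1 q \<in> tangent_space M q"
      by (simp add: tangent_iff_coord[OF q] linear_add[OF linear_coord] linear_scale[OF linear_coord] c)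
  qed (rule M)
  then have "normal_frame (vol 0) M V X \<xi> (metric_sign M vol X)"
    by (rule normal_frame_of_surface_frame[OF const _ X \<sigma>\<xi> normal])
  then show thesis using that[of V X \<xi>] \<sigma>\<xi> X1(1) V2(1) by (simp add: V_def)
qed

section \<open>Parallel forms\<close>

lemma parallel_symplectic_form_const:
  assumes "parallel_symplectic_form \<Omega>"
  shows "\<Omega> p = \<Omega> 0"
proof (intro ext)
  fix v w
  show "\<Omega> p v w = \<Omega> 0 v w"
    by (rule has_derivative_zero_unique[OF convex_UNIV]) (use assms in \<open>auto simp: parallel_symplectic_form_def\<close>)
qed

lemma wedge_square_volume_form:
  assumes bil: "bilinear (\<Omega> p)" and alt: "\<And>v. \<Omega> p v v = 0"
  shows "volume_form (wedge_square \<Omega> p)"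
proof -
  note b = bilinear_ladd[OF bil] bilinear_radd[OF bil] bilinear_lmul[OF bil] bilinear_rmul[OF bil]
  show ?thesis
  proof (rule volume_form.intro)
    show "wedge_square \<Omega> p x x a b = 0" for x a b
      by (simp add: wedge_square_def alt)
    show "wedge_square \<Omega> p a x x b = 0" for x a b
      by (simp add: wedge_square_def alt)
    show "wedge_square \<Omega> p a b x x = 0" for x a b
      by (simp add: wedge_square_def alt)
  qed (rule linearI; simp add: wedge_square_def b algebra_simps)+
qed

lemma wedge_square_proportional:
  assumes vol: "parallel_volume_form vol" and \<Omega>: "parallel_symplectic_form \<Omega>"
  shows "\<exists>k. \<forall>p a b c d. wedge_square \<Omega> p a b c d = k * vol p a b c d"
proof -
  interpret volume_form "vol 0" by (rule parallel_volume_form_imp_volume_form[OF vol])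
  obtain a b c d where abcd: "vol 0 a b c d \<noteq> 0" using vol unfolding parallel_volume_form_def by blast
  define e where "e i = (if i = 1 then a else if i = 2 then b else if i = 3 then c else d)" for i :: 4
  have e: "vol4 e \<noteq> 0" using abcd by (simp add: vol4_def e_def)
  have "volume_form (wedge_square \<Omega> 0)"
    using \<Omega> by (intro wedge_square_volume_form) (auto simp: parallel_symplectic_form_def)
  from proportional[OF this e]
  have "wedge_square \<Omega> p a b c d = wedge_square \<Omega> 0 (e 1) (e 2) (e 3) (e 4) / vol4 e * vol p a b c d" for p a b c d
    unfolding parallel_volume_form_const[OF vol, of p] wedge_square_def parallel_symplectic_form_const[OF \<Omega>, of p] .
  then show ?thesis by blast
qed

text \<open>A nonzero row annihilating (1, t) has a nonzero second entry, since otherwise its first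
  entry would vanish too. Such a row expresses t as a quotient of its entries.\<close>

lemma rank_one_kernel:
  fixes A :: "real^2^'n"
  assumes "rank A = 1" and t: "A *v vector [1, t] = 0"
  obtains i where "A $ i $ 2 \<noteq> 0"
proof -
  have "A \<noteq> 0" using assms(1) by auto
  then obtain i j where ij: "A $ i $ j \<noteq> 0" by (auto simp: vec_eq_iff)
  have row: "A $ i $ 1 + A $ i $ 2 * t = 0"
    using t by (simp add: vec_eq_iff matrix_vector_mult_def sum_2)
  have "A $ i $ 2 \<noteq> 0" using exhaust_2[of j] ij row by auto
  then show thesis by (rule that)
qed

text \<open>The absolute value is there because A^2 + \<epsilon> B^2 can be negative for an
  indefinite metric; the formula is the same on both sides of 0.\<close>

lemma inverse_sqrt_abs_has_derivative:
  fixes u :: real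
  assumes "u \<noteq> 0"
  shows "((\<lambda>x. 1 / sqrt \<bar>x\<bar>) has_real_derivative - (1 / sqrt \<bar>u\<bar>) / (2 * u)) (at u)"
proof -
  have pos: "((\<lambda>x. 1 / sqrt x) has_real_derivative - (1 / sqrt v) / (2 * v)) (at v)" if "v > 0" for v
    using that by (auto intro!: derivative_eq_intros simp: field_simps)
  consider "u > 0" | "u < 0" using assms by linarith
  then show ?thesis
  proof cases
    case 1
    then have "((\<lambda>x. 1 / sqrt x) has_real_derivative - (1 / sqrt \<bar>u\<bar>) / (2 * u)) (at u)" using pos by simp
    then show ?thesis
      unfolding has_field_derivative_def
      by (rule has_derivative_transform_within_open[where s = "{0<..}"]) (use 1 in auto)
  next
    case 2
    have "((\<lambda>x. 1 / sqrt (- x)) has_real_derivative - (1 / sqrt (- u)) / (2 * - u) * - 1) (at u)"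
      by (rule DERIV_chain2[where f = "\<lambda>x. 1 / sqrt x" and g = "\<lambda>x. - x", OF pos])
        (use 2 in \<open>auto intro!: derivative_eq_intros\<close>)
    then have "((\<lambda>x. 1 / sqrt (- x)) has_real_derivative - (1 / sqrt \<bar>u\<bar>) / (2 * u)) (at u)" using 2 by simp
    then show ?thesis
      unfolding has_field_derivative_def
      by (rule has_derivative_transform_within_open[where s = "{..<0}"]) (use 2 in auto)
  qed
qed

text \<open>The last clause allows local forms to be glued along a connected surface: they need only agree up
  to a factor, so no choice of sign for the kernel of \<open>H\<close> is involved.\<close>

definition unique_lagrangian_form :: "R4 set \<Rightarrow> R4 set \<Rightarrow> (R4 \<Rightarrow> R4 \<Rightarrow> real) \<Rightarrow> bool" where
  "unique_lagrangian_form M N \<Omega> \<longleftrightarrow>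
    openin (top_of_set M) N \<and> bilinear \<Omega> \<and> (\<forall>v. \<Omega> v v = 0) \<and>
    (\<forall>v. (\<forall>w. \<Omega> v w = 0) \<longrightarrow> v = 0) \<and> isotropic M \<Omega> N \<and>
    (\<forall>\<Omega>' N'. bilinear \<Omega>' \<and> (\<forall>v. \<Omega>' v v = 0) \<and> openin (top_of_set M) N' \<and> N' \<subseteq> N \<and> N' \<noteq> {} \<and>
      isotropic M \<Omega>' N' \<longrightarrow> (\<exists>s. \<forall>v w. \<Omega>' v w = s * \<Omega> v w))"

section \<open>Construction of local parallel forms\<close>

context normal_frame
begin

lemma form_expansion:
  assumes q: "q \<in> V" and bil: "bilinear \<Omega>"
    and J: "\<And>a b. \<Omega> (E a q) (E b q) = J (\<epsilon> q) A B a b"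
  shows "\<Omega> v w = form A B q v w"
proof -
  have lin: "linear (\<Omega> x)" "linear (\<lambda>x. \<Omega> x y)" for x y using bil by (auto simp: bilinear_def)
  have x: "x = (\<Sum>a\<in>UNIV. coord (\<lambda>c. E c q) a x *\<^sub>R E a q)" for x
    by (rule coord_expansion) (simp add: vol4_E[OF q])
  have "\<Omega> v w = (\<Sum>a\<in>UNIV. coord (\<lambda>c. E c q) a v * \<Omega> (E a q) w)"
    by (subst x[of v]) (simp add: linear_sum[OF lin(2)] linear_scale[OF lin(2)])
  moreover have "\<Omega> (E a q) w = (\<Sum>b\<in>UNIV. coord (\<lambda>c. E c q) b w * J (\<epsilon> q) A B a b)" for a
    by (subst x[of w]) (simp add: linear_sum[OF lin(1)] linear_scale[OF lin(1)] J)
  ultimately show ?thesis by (simp add: form_def sum_distrib_left mult_ac)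
qed

lemma form_E:
  assumes q: "q \<in> V"
  shows "form A B q v (E b q) = (\<Sum>a\<in>UNIV. J (\<epsilon> q) A B a b * coord (\<lambda>c. E c q) a v)"
  by (simp add: form_def coord_E[OF q] if_distrib[of "(*) _"] cong: if_cong)

lemma form_bilinear: "bilinear (form A B q)"
proof -
  note l = linear_add[OF linear_coord] linear_scale[OF linear_coord]
  show ?thesis
    unfolding bilinear_def
    by (intro conjI allI linearI)
      (simp_all add: form_def l sum.distrib sum_distrib_left algebra_simps)
qed

lemma form_alternating: "form A B q v v = 0"
  by (simp add: form_def sum_4 J_def)

lemma form_tangent:
  assumes "q \<in> V" "v \<in> tangent_space M q" "w \<in> tangent_space M q"
  shows "form A B q v w = 0"
  using coord_tangent[OF assms(1,2)] coord_tangent[OF assms(1,3)] by (simp add: form_def sum_4 J_def)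

lemma form_scale: "form (r * A) (r * B) q v w = r * form A B q v w"
  by (simp add: form_def sum_4 J_def algebra_simps)

text \<open>In the frame the matrix of the form splits into two blocks whose determinants are
  \<plusminus>(A^2 + \<epsilon> B^2), up to sign the Pfaffian.\<close>

lemma form_nondegenerate:
  assumes q: "q \<in> V" and AB: "A\<^sup>2 + \<epsilon> q * B\<^sup>2 \<noteq> 0" and 0: "\<And>w. form A B q v w = 0"
  shows "v = 0"
proof -
  let ?c = "\<lambda>a. coord (\<lambda>c. E c q) a v"
  have "(\<Sum>a\<in>UNIV. J (\<epsilon> q) A B a b * ?c a) = 0" for b
    using 0[of "E b q"] form_E[OF q, of A B v b] by simp
  from this[of 1] this[of 2] this[of 3] this[of 4]
  have eqs: "A * ?c 4 + B * ?c 3 = 0" "A * ?c 3 - \<epsilon> q * B * ?c 4 = 0"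
    "A * ?c 2 + B * ?c 1 = 0" "A * ?c 1 - \<epsilon> q * B * ?c 2 = 0"
    by (simp_all add: sum_4 J_def algebra_simps)
  have elim: "x = 0 \<and> y = 0" if "A * x + B * y = 0" "A * y - \<epsilon> q * B * x = 0" for x y
  proof -
    have "(A\<^sup>2 + \<epsilon> q * B\<^sup>2) * x = A * (A * x + B * y) - B * (A * y - \<epsilon> q * B * x)"
      "(A\<^sup>2 + \<epsilon> q * B\<^sup>2) * y = \<epsilon> q * B * (A * x + B * y) + A * (A * y - \<epsilon> q * B * x)"
      by (simp_all add: algebra_simps power2_eq_square)
    then have "(A\<^sup>2 + \<epsilon> q * B\<^sup>2) * x = 0" "(A\<^sup>2 + \<epsilon> q * B\<^sup>2) * y = 0"
      unfolding that by simp_all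
    then show ?thesis using AB by simp
  qed
  from elim[OF eqs(1,2)] elim[OF eqs(3,4)] show ?thesis
    using coord_expansion_E[OF q, of v] by simp
qed

lemma in_kernel_scale: "in_kernel A B q \<Longrightarrow> in_kernel (r * A) (r * B) q"
proof -
  have "x * (r * A) + y * (r * B) = r * (x * A + y * B)" for x y :: real by (simp add: algebra_simps)
  then show "in_kernel A B q \<Longrightarrow> in_kernel (r * A) (r * B) q" unfolding in_kernel_def by simp
qed

text \<open>The two identities of \<open>DA_DB_kernel\<close> form a linear system with determinant
  A^2 + \<epsilon> B^2. Its solution is an infinitesimal circular or hyperbolic rotation with speed
  \<open>D\<eta> k q\<close>.\<close>

lemma DA_DB_solved:
  assumes q: "q \<in> V" and ker: "in_kernel A B q" and AB: "A\<^sup>2 + \<epsilon> q * B\<^sup>2 \<noteq> 0"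
  shows "DA k A B q = - \<epsilon> q * B * D\<eta> k q" "DB k A B q = A * D\<eta> k q"
proof -
  note e = DA_DB_kernel[OF q ker, of k]
  have "(A\<^sup>2 + \<epsilon> q * B\<^sup>2) * DA k A B q = A * (A * DA k A B q + \<epsilon> q * B * DB k A B q)
      - \<epsilon> q * B * (A * DB k A B q - B * DA k A B q)"
    "(A\<^sup>2 + \<epsilon> q * B\<^sup>2) * DB k A B q = B * (A * DA k A B q + \<epsilon> q * B * DB k A B q)
      + A * (A * DB k A B q - B * DA k A B q)"
    by (simp_all add: algebra_simps power2_eq_square)
  then have "(A\<^sup>2 + \<epsilon> q * B\<^sup>2) * DA k A B q = (A\<^sup>2 + \<epsilon> q * B\<^sup>2) * (- \<epsilon> q * B * D\<eta> k q)"
    "(A\<^sup>2 + \<epsilon> q * B\<^sup>2) * DB k A B q = (A\<^sup>2 + \<epsilon> q * B\<^sup>2) * (A * D\<eta> k q)"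
    unfolding e by simp_all
  then show "DA k A B q = - \<epsilon> q * B * D\<eta> k q" "DB k A B q = A * D\<eta> k q"
    using AB mult_left_cancel by blast+
qed

lemma lagrangian_star_equations:
  assumes \<sigma>: "\<And>q. q \<in> V \<Longrightarrow> \<sigma> q = span {\<xi> 1 q, \<xi> 2 q}"
    and \<epsilon>: "\<And>q. q \<in> V \<Longrightarrow> \<epsilon> q = metric_sign M vol X q"
    and bil: "bilinear \<Omega>" and alt: "\<And>v. \<Omega> v v = 0"
    and lag: "isotropic M \<Omega> V"
    and q: "q \<in> V"
  defines "A \<equiv> \<lambda>q. \<Omega> (X 1 q) (\<xi> 2 q)" and "B \<equiv> \<lambda>q. \<Omega> (X 1 q) (\<xi> 1 q)"
  assumes def: "eta_defined M vol X A B q"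
  shows "star_equations M vol \<sigma> X \<xi> (eta M vol X A B) q"
proof -
  have c: "in_kernel (A q) (B q) q" "A differentiable (at q within M)" "B differentiable (at q within M)"
    "Dflat M (X k) A q = DA k (A q) (B q) q" "Dflat M (X k) B q = DB k (A q) (B q) q" for k
    using lagrangian_components[OF bil alt lag q] by (simp_all add: A_def B_def)
  obtain A' where A': "(A has_derivative A') (at q within M)" using c(2) by (auto simp: differentiable_def)
  obtain B' where B': "(B has_derivative B') (at q within M)" using c(3) by (auto simp: differentiable_def)
  note D = eta_has_derivative[OF \<epsilon> q A' B' def]
  have "Dflat M (X k) (eta M vol X A B) q = D\<eta> k q" for k
  proof -
    have "A' (X k q) = DA k (A q) (B q) q" "B' (X k q) = DB k (A q) (B q) q"
      using c(4,5) Dflat_eq[where Y = "X k", OF A' X_tangent[OF q]] Dflat_eq[where Y = "X k", OF B' X_tangent[OF q]]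
      by auto
    then show ?thesis
      using Dflat_eq[where Y = "X k", OF D X_tangent[OF q]] DA_DB_kernel(2)[OF q c(1), of k]
        discriminant_nonzero[OF \<epsilon> q def] by simp
  qed
  moreover have "eta M vol X A B differentiable (at q within M)" using D by (auto simp: differentiable_def)
  ultimately show ?thesis using star_equations_iff[OF \<sigma> \<epsilon>[OF q] q] by blast
qed

text \<open>On the kernel of \<open>H\<close> the form is normalised by \<open>A\<^sup>2 + \<epsilon> B\<^sup>2 = \<plusminus>1\<close>, that is, by a constant
  \<open>\<Omega> \<and> \<Omega>\<close>; then the equations for \<open>\<eta>\<close> say that it is parallel.\<close>

lemma local_parallel_form:
  assumes \<xi>: "\<And>i. smooth_along V (\<xi> i)"
    and \<epsilon>: "\<And>q. q \<in> V \<Longrightarrow> \<epsilon> q = metric_sign M vol X q"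
    and rank: "\<And>q. q \<in> V \<Longrightarrow> rank (H q) = 1"
    and ker: "\<And>q. q \<in> V \<Longrightarrow> in_kernel (A q) (B q) q"
    and def: "\<And>q. q \<in> V \<Longrightarrow> eta_defined M vol X A B q"
    and star: "\<And>k q. q \<in> V \<Longrightarrow> Dflat M (X k) (eta M vol X A B) q = D\<eta> k q"
    and p: "p \<in> V"
  shows "\<exists>N \<Omega>. p \<in> N \<and> unique_lagrangian_form M N \<Omega>"
proof -
  \<comment> \<open>No continuity of the given section is assumed, and \<open>eta\<close> depends
    only on the ratio. So the section is replaced by (1, t) and then rescaled to (a, b) with a^2 +
    \<epsilon> b^2 = \<plusminus>1.\<close>
  define t where "t q = B q / A q" for q
  have A0: "A q \<noteq> 0" if "q \<in> V" for q using def[OF that] by (simp add: eta_defined_def)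
  have def': "eta_defined M vol X (\<lambda>_. 1) t q" if "q \<in> V" for q
    using def[OF that] A0[OF that] by (auto simp: eta_defined_def t_def)
  have eta': "eta M vol X A B = eta M vol X (\<lambda>_. 1) t"
    by (simp add: eta_def fun_eq_iff t_def)
  have kert: "in_kernel 1 (t q) q" if "q \<in> V" for q
    using in_kernel_scale[OF ker[OF that], of "inverse (A q)"] A0[OF that] by (simp add: t_def field_simps)
  have Ht: "H q *v vector [1, t q] = 0" if "q \<in> V" for q
    using kert[OF that] by (simp add: H_kernel)
  define u where "u q = 1 + \<epsilon> q * (t q)\<^sup>2" for q
  have u0: "u q \<noteq> 0" if "q \<in> V" for q
    using discriminant_nonzero[OF \<epsilon> that def'[OF that]] by (simp add: u_def)
  define a where "a q = 1 / sqrt \<bar>u q\<bar>" for q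
  define b where "b q = a q * t q" for q
  have a0: "a q \<noteq> 0" if "q \<in> V" for q using u0[OF that] by (simp add: a_def)
  have kerab: "in_kernel (a q) (b q) q" if "q \<in> V" for q
    using in_kernel_scale[OF kert[OF that], of "a q"] by (simp add: b_def)
  have ab0: "(a q)\<^sup>2 + \<epsilon> q * (b q)\<^sup>2 \<noteq> 0" if "q \<in> V" for q
  proof -
    have "(a q)\<^sup>2 + \<epsilon> q * (b q)\<^sup>2 = (a q)\<^sup>2 * u q" by (simp add: b_def u_def power_mult_distrib algebra_simps)
    then show ?thesis using a0[OF that] u0[OF that] by simp
  qed
  have parallel: "\<exists>f'. ((\<lambda>q. form (a q) (b q) q v w) has_derivative f') (at q within M)
      \<and> (\<forall>x\<in>tangent_space M q. f' x = 0)" if q: "q \<in> V" for v w q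
  proof -
    \<comment> \<open>Near \<open>q\<close> the ratio t is a quotient of two entries of this row,
      which makes it differentiable.\<close>
    obtain i where i: "H q $ i $ 2 \<noteq> 0" using rank_one_kernel[OF rank[OF q] Ht[OF q]] .
    have Hd: "(\<lambda>q. H q $ i $ j) differentiable (at q within M)" for j
      by (rule H_differentiable[OF \<xi> q])
    have "((\<lambda>q. H q $ i $ 2) \<longlongrightarrow> H q $ i $ 2) (at q within M)"
      using differentiable_imp_continuous_within[OF Hd] by (simp add: continuous_within)
    then have "\<forall>\<^sub>F x in at q within M. H x $ i $ 2 \<noteq> 0"
      using i by (rule tendsto_imp_eventually_ne)
    moreover have "\<forall>\<^sub>F x in at q within M. x \<in> V"
      using q openin_subset_at_within[OF openin_V q, symmetric] by (simp add: eventually_at_filter)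
    moreover have t_eq: "- (H x $ i $ 1) / H x $ i $ 2 = t x" if "H x $ i $ 2 \<noteq> 0" "x \<in> V" for x
    proof -
      have "H x $ i $ 1 + H x $ i $ 2 * t x = 0"
        using Ht[OF that(2)] by (simp add: vec_eq_iff matrix_vector_mult_def sum_2)
      then show ?thesis using that(1) by (simp add: field_simps)
    qed
    ultimately have ev: "\<forall>\<^sub>F x in at q within M. - (H x $ i $ 1) / H x $ i $ 2 = t x"
      by (auto elim: eventually_elim2)
    have "(\<lambda>x. - (H x $ i $ 1) / H x $ i $ 2) differentiable (at q within M)"
      by (intro differentiable_divide differentiable_minus Hd i)
    then obtain t' where "((\<lambda>x. - (H x $ i $ 1) / H x $ i $ 2) has_derivative t') (at q within M)"
      by (auto simp: differentiable_def)
    moreover have qM: "q \<in> M" using q openin_V openin_imp_subset by blast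
    ultimately have t': "(t has_derivative t') (at q within M)"
      using has_derivative_transform_eventually[OF _ ev t_eq[OF i q]] by blast
    \<comment> \<open>Since d\<eta> = dt / (1 + \<epsilon> t^2), the equations for \<eta> determine
      dt.\<close>
    have t'X: "t' (X k q) = D\<eta> k q * u q" for k
    proof -
      have "Dflat M (X k) (eta M vol X A B) q = t' (X k q) / u q"
        using Dflat_eq[where Y = "X k", OF eta_has_derivative[OF \<epsilon> q has_derivative_const t' def'[OF q]] X_tangent[OF q]]
        by (simp add: eta' u_def)
      then show ?thesis using star[OF q, of k] u0[OF q] by (simp add: field_simps)
    qed
    have u': "(u has_derivative (\<lambda>h. 2 * \<epsilon> q * t q * t' h)) (at q within M)"
      unfolding u_def[abs_def] power2_eq_square
      by (rule has_derivative_eq_rhs, (rule derivative_intros \<epsilon>_has_derivative[OF q] t')+)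
        (simp add: fun_eq_iff algebra_simps)
    have a': "(a has_derivative (\<lambda>h. 2 * \<epsilon> q * t q * t' h * (- a q / (2 * u q)))) (at q within M)"
      using DERIV_compose_FDERIV[OF inverse_sqrt_abs_has_derivative[OF u0[OF q]] u'] by (simp add: a_def[abs_def])
    have b': "(b has_derivative (\<lambda>h. a q * t' h + 2 * \<epsilon> q * t q * t' h * (- a q / (2 * u q)) * t q)) (at q within M)"
      unfolding b_def[abs_def] by (rule has_derivative_mult[OF a' t'])
    have "Dflat M (X k) a q = DA k (a q) (b q) q" "Dflat M (X k) b q = DB k (a q) (b q) q" for k
    proof -
      have "Dflat M (X k) a q = - \<epsilon> q * b q * D\<eta> k q"
        using Dflat_eq[where Y = "X k", OF a' X_tangent[OF q]] u0[OF q] by (simp add: t'X b_def)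
      then show "Dflat M (X k) a q = DA k (a q) (b q) q"
        using DA_DB_solved[OF q kerab[OF q] ab0[OF q]] by simp
      have "Dflat M (X k) b q = a q * D\<eta> k q * (u q - \<epsilon> q * (t q)\<^sup>2)"
        using Dflat_eq[where Y = "X k", OF b' X_tangent[OF q]] u0[OF q]
        by (simp add: t'X power2_eq_square algebra_simps)
      also have "\<dots> = a q * D\<eta> k q" by (simp add: u_def)
      finally show "Dflat M (X k) b q = DB k (a q) (b q) q"
        using DA_DB_solved[OF q kerab[OF q] ab0[OF q]] by simp
    qed
    then show ?thesis
      using a' b' by (intro form_parallel q kerab) (auto simp: differentiable_def)
  qed
  \<comment> \<open>All pairs of vectors are taken together, to obtain one neighbourhood on which
    the entire form is constant.\<close>
  let ?F = "range (\<lambda>(v, w). \<lambda>q. form (a q) (b q) q v w)"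
  have "\<exists>f'. (f has_derivative f') (at q within M) \<and> (\<forall>x\<in>tangent_space M q. f' x = 0)"
    if "f \<in> ?F" "q \<in> V" for f q
    using that parallel by auto
  then obtain N where N: "openin (top_of_set M) N" "p \<in> N" "N \<subseteq> V"
      "\<And>f q. f \<in> ?F \<Longrightarrow> q \<in> N \<Longrightarrow> f q = f p"
    using locally_constant_on_surface[OF surface openin_V p, of ?F] by blast
  define \<Omega> where "\<Omega> = form (a p) (b p) p"
  have \<Omega>: "\<Omega> v w = form (a q) (b q) q v w" if "q \<in> N" for q v w
    using N(4)[of "\<lambda>q. form (a q) (b q) q v w" q] that by (force simp: \<Omega>_def)
  show ?thesis
    unfolding unique_lagrangian_form_def
  proof (intro exI[of _ N] exI[of _ \<Omega>] conjI allI impI)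
    show "openin (top_of_set M) N" "p \<in> N" by (rule N)+
    show "bilinear \<Omega>" unfolding \<Omega>_def by (rule form_bilinear)
    show "\<Omega> v v = 0" for v unfolding \<Omega>_def by (rule form_alternating)
    show "v = 0" if "\<forall>w. \<Omega> v w = 0" for v
      using form_nondegenerate[OF p ab0[OF p]] that unfolding \<Omega>_def by blast
    show "isotropic M \<Omega> N"
      using form_tangent N(3) \<Omega> by (simp add: isotropic_def subset_iff)
    fix \<Omega>' :: "R4 \<Rightarrow> R4 \<Rightarrow> real" and N'
    assume "bilinear \<Omega>' \<and> (\<forall>v. \<Omega>' v v = 0) \<and> openin (top_of_set M) N' \<and> N' \<subseteq> N \<and> N' \<noteq> {} \<and>
      isotropic M \<Omega>' N'"
    then have bil: "bilinear \<Omega>'" and alt: "\<And>v. \<Omega>' v v = 0"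
      and N': "openin (top_of_set M) N'" "N' \<subseteq> N" "N' \<noteq> {}" and lag: "isotropic M \<Omega>' N'" by auto
    interpret r: normal_frame \<mu> M N' X \<xi> \<epsilon> by (rule restrict[OF N'(1)]) (use N' N in blast)
    \<comment> \<open>Constant forms can be compared at a single point. There the components of any
      competitor lie in the kernel of \<open>H\<close>, and rank one makes them proportional to (a,
      b).\<close>
    obtain q where q: "q \<in> N'" using N'(3) by blast
    then have qV: "q \<in> V" and qN: "q \<in> N" using N' N by auto
    define A' B' where "A' = \<Omega>' (X 1 q) (\<xi> 2 q)" and "B' = \<Omega>' (X 1 q) (\<xi> 1 q)"
    have ker': "in_kernel A' B' q"
      using r.lagrangian_components(2)[OF bil alt lag q] by (simp add: A'_def B'_def)
    obtain i where i: "H q $ i $ 2 \<noteq> 0" using rank_one_kernel[OF rank[OF qV] Ht[OF qV]] .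
    have "H q $ i $ 1 + H q $ i $ 2 * t q = 0" "H q $ i $ 1 * A' + H q $ i $ 2 * B' = 0"
      using Ht[OF qV] ker'[folded H_kernel] by (simp_all add: vec_eq_iff matrix_vector_mult_def sum_2)
    then have "H q $ i $ 2 * (B' - t q * A') = 0" by algebra
    then have B': "B' = t q * A'" using i by simp
    have "\<Omega>' v w = form A' B' q v w" for v w
      by (rule form_expansion[OF qV bil])
        (use r.lagrangian_components(1)[OF bil alt lag q] in \<open>simp add: A'_def B'_def\<close>)
    also have "form A' B' q v w = A' / a q * \<Omega> v w" for v w
      using form_scale[of "A' / a q" "a q" "b q" q v w] a0[OF qV] by (simp add: B' b_def \<Omega>[OF qN] mult.commute)
    finally show "\<exists>s. \<forall>v w. \<Omega>' v w = s * \<Omega> v w" by blast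
  qed
qed

end

section \<open>From local statements to the whole surface\<close>

lemma parallel_symplectic_form_exists: "\<exists>\<Omega>. parallel_symplectic_form \<Omega>"
proof -
  define \<omega> :: "R4 \<Rightarrow> R4 \<Rightarrow> real" where
    "\<omega> v w = v $ 1 * w $ 3 - v $ 3 * w $ 1 + v $ 2 * w $ 4 - v $ 4 * w $ 2" for v w
  have "v = 0" if "\<forall>w. \<omega> v w = 0" for v
  proof -
    have "\<omega> v (axis 1 1) = 0" "\<omega> v (axis 2 1) = 0" "\<omega> v (axis 3 1) = 0" "\<omega> v (axis 4 1) = 0"
      using that by auto
    then show ?thesis by (simp add: \<omega>_def axis_def vec_eq_iff forall_4)
  qed
  moreover have "bilinear \<omega>"
    unfolding bilinear_def by (intro conjI allI linearI) (simp_all add: \<omega>_def algebra_simps)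
  ultimately have "parallel_symplectic_form (\<lambda>_. \<omega>)"
    by (auto simp: parallel_symplectic_form_def \<omega>_def)
  then show ?thesis by blast
qed

text \<open>The assertion concerns every point of \<open>M\<close>, and no adapted frame is given
  there; the frame of \<open>normal_frame_exists\<close> takes its place.\<close>

lemma lagrangian_normal_bundle:
  assumes M: "smooth_surface M" and vol: "parallel_volume_form vol" and normal: "affine_normal_bundle M vol \<sigma>"
    and \<Omega>: "parallel_symplectic_form \<Omega>" and lag: "lagrangian_surface \<Omega> M"
  shows "lagrangian_bundle \<Omega> M \<sigma>"
  unfolding lagrangian_bundle_def
proof (intro ballI)
  fix p v w assume p: "p \<in> M" and v: "v \<in> \<sigma> p" and w: "w \<in> \<sigma> p"
  note const = parallel_symplectic_form_const[OF \<Omega>]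
  obtain V X \<xi> where V: "p \<in> V" "normal_frame (vol 0) M V X \<xi> (metric_sign M vol X)"
    "\<And>q. q \<in> V \<Longrightarrow> \<sigma> q = span {\<xi> 1 q, \<xi> 2 q}"
    using normal_frame_exists[OF M vol normal p] by blast
  interpret normal_frame "vol 0" M V X \<xi> "metric_sign M vol X" by (rule V)
  have bil: "bilinear (\<Omega> 0)" and alt: "\<Omega> 0 v v = 0" for v
    using \<Omega> by (auto simp: parallel_symplectic_form_def)
  have "isotropic M (\<Omega> 0) V"
    using lag openin_imp_subset[OF openin_V] unfolding isotropic_def lagrangian_surface_def lagrangian_bundle_def
    by (metis const subsetD)
  from lagrangian_components(1)[OF bil alt this V(1), of 3 4]
  have 34: "\<Omega> 0 (\<xi> 1 p) (\<xi> 2 p) = 0" by (simp add: E_simps J_def)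
  obtain x y x' y' where "v = x *\<^sub>R \<xi> 1 p + y *\<^sub>R \<xi> 2 p" "w = x' *\<^sub>R \<xi> 1 p + y' *\<^sub>R \<xi> 2 p"
    using v w unfolding V(3)[OF V(1)] in_span_pair_iff by blast
  then have "\<Omega> 0 v w = 0"
    using alternating_swap[OF bil alt, of "\<xi> 2 p" "\<xi> 1 p"]
    by (simp add: bilinear_ladd[OF bil] bilinear_radd[OF bil] bilinear_lmul[OF bil] bilinear_rmul[OF bil] alt 34)
  then show "\<Omega> p v w = 0" using const[of p] by simp
qed

lemma lagrangian_adapted_frame:
  assumes M: "smooth_surface M" and vol: "parallel_volume_form vol" and normal: "affine_normal_bundle M vol \<sigma>"
    and \<Omega>: "parallel_symplectic_form \<Omega>" and lag: "lagrangian_surface \<Omega> M"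
    and adapted: "adapted_frame M vol \<sigma> V X \<xi>" and p: "p \<in> V"
  defines "A \<equiv> \<lambda>p. \<Omega> p (X 1 p) (\<xi> 2 p)" and "B \<equiv> \<lambda>p. \<Omega> p (X 1 p) (\<xi> 1 p)"
  shows "A p = \<Omega> p (X 2 p) (\<xi> 1 p)" "B p = - metric_sign M vol X p * \<Omega> p (X 2 p) (\<xi> 2 p)"
    "H_matrix M vol \<sigma> X \<xi> p *v vector [A p, B p] = 0"
    "eta_defined M vol X A B p \<Longrightarrow> star_equations M vol \<sigma> X \<xi> (eta M vol X A B) p"
proof -
  note const = parallel_symplectic_form_const[OF \<Omega>]
  note frame = adapted_frame_normal_frame[OF M vol normal adapted]
  interpret normal_frame "vol 0" M V X \<xi> "metric_sign M vol X" by (rule frame)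
  have bil: "bilinear (\<Omega> 0)" and alt: "\<Omega> 0 v v = 0" for v
    using \<Omega> by (auto simp: parallel_symplectic_form_def)
  have lag': "isotropic M (\<Omega> 0) V"
    using lag openin_imp_subset[OF openin_V] unfolding isotropic_def lagrangian_surface_def lagrangian_bundle_def
    by (metis const subsetD)
  have AB: "A = (\<lambda>p. \<Omega> 0 (X 1 p) (\<xi> 2 p))" "B = (\<lambda>p. \<Omega> 0 (X 1 p) (\<xi> 1 p))"
    unfolding A_def B_def using const by metis+
  note J = lagrangian_components(1)[OF bil alt lag' p]
  show "A p = \<Omega> p (X 2 p) (\<xi> 1 p)" "B p = - metric_sign M vol X p * \<Omega> p (X 2 p) (\<xi> 2 p)"
    using J[of 2 3] J[of 2 4] \<epsilon>_cases[OF p] unfolding const[of p] by (auto simp: E_simps J_def AB)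
  show "H_matrix M vol \<sigma> X \<xi> p *v vector [A p, B p] = 0"
  proof -
    have "H_matrix M vol \<sigma> X \<xi> p = H p" by (rule H_matrix_eq[OF frame(2) refl p])
    then show ?thesis using lagrangian_components(2)[OF bil alt lag' p] by (simp add: AB H_kernel)
  qed
  show "eta_defined M vol X A B p \<Longrightarrow> star_equations M vol \<sigma> X \<xi> (eta M vol X A B) p"
    using lagrangian_star_equations[OF frame(2) refl bil alt lag' p] by (simp add: AB)
qed

lemma parallel_form_near:
  assumes M: "smooth_surface M" and vol: "parallel_volume_form vol" and normal: "affine_normal_bundle M vol \<sigma>"
    and adapted: "adapted_frame M vol \<sigma> V X \<xi>" and p: "p \<in> V"
    and H: "\<And>q. q \<in> V \<Longrightarrow> rank (H_matrix M vol \<sigma> X \<xi> q) = 1 \<and>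
                 H_matrix M vol \<sigma> X \<xi> q *v vector [A q, B q] = 0 \<and>
                 eta_defined M vol X A B q \<and>
                 star_equations M vol \<sigma> X \<xi> (eta M vol X A B) q"
  shows "\<exists>N \<Omega>. p \<in> N \<and> unique_lagrangian_form M N \<Omega>"
proof -
  note frame = adapted_frame_normal_frame[OF M vol normal adapted]
  interpret normal_frame "vol 0" M V X \<xi> "metric_sign M vol X" by (rule frame)
  have H_eq: "H_matrix M vol \<sigma> X \<xi> q = H q" if "q \<in> V" for q
    by (rule H_matrix_eq[OF frame(2) refl that])
  have 1: "rank (H q) = 1" "in_kernel (A q) (B q) q" "eta_defined M vol X A B q"
    "Dflat M (X k) (eta M vol X A B) q = D\<eta> k q" if q: "q \<in> V" for q k
    using H[OF q] star_equations_iff[OF frame(2) refl q] H_eq[OF q] H_kernel by auto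
  show ?thesis
    by (rule local_parallel_form[OF frame(3) refl 1 p])
qed

theorem theorem1p1:
  fixes M :: "R4 set"
    and vol :: "R4 \<Rightarrow> R4 \<Rightarrow> R4 \<Rightarrow> R4 \<Rightarrow> R4 \<Rightarrow> real"
    and \<sigma> :: "R4 \<Rightarrow> R4 set"
  assumes "smooth_surface M"
    and "parallel_volume_form vol"
    and "nondegenerate M vol"
    and "affine_normal_bundle M vol \<sigma>"
  shows
    "(\<forall>\<Omega>. parallel_symplectic_form \<Omega> \<and> lagrangian_surface \<Omega> M \<longrightarrow>
        lagrangian_bundle \<Omega> M \<sigma> \<and>
        (\<exists>k. \<forall>p a b c d. wedge_square \<Omega> p a b c d = k * vol p a b c d) \<and>
        (\<forall>V X \<xi>. adapted_frame M vol \<sigma> V X \<xi> \<longrightarrow>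
          (let A = (\<lambda>p. \<Omega> p (X 1 p) (\<xi> 2 p)); B = (\<lambda>p. \<Omega> p (X 1 p) (\<xi> 1 p)) in
           \<forall>p\<in>V.
             A p = \<Omega> p (X 2 p) (\<xi> 1 p) \<and>
             B p = - metric_sign M vol X p * \<Omega> p (X 2 p) (\<xi> 2 p) \<and>
             H_matrix M vol \<sigma> X \<xi> p *v vector [A p, B p] = 0 \<and>
             (eta_defined M vol X A B p \<longrightarrow>
                star_equations M vol \<sigma> X \<xi> (eta M vol X A B) p))))
     \<and>
     (connected M \<and>
      (\<forall>p\<in>M. \<exists>V X \<xi> A B. p \<in> V \<and> adapted_frame M vol \<sigma> V X \<xi> \<and>
         (\<forall>q\<in>V. rank (H_matrix M vol \<sigma> X \<xi> q) = 1 \<and>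
                 H_matrix M vol \<sigma> X \<xi> q *v vector [A q, B q] = 0 \<and>
                 eta_defined M vol X A B q \<and>
                 star_equations M vol \<sigma> X \<xi> (eta M vol X A B) q))
      \<longrightarrow> (\<exists>\<Omega>. parallel_symplectic_form \<Omega> \<and> lagrangian_surface \<Omega> M))"
proof (intro conjI allI impI)
  fix \<Omega> assume "parallel_symplectic_form \<Omega> \<and> lagrangian_surface \<Omega> M"
  then have \<Omega>: "parallel_symplectic_form \<Omega>" "lagrangian_surface \<Omega> M" by auto
  show "lagrangian_bundle \<Omega> M \<sigma>"
    by (rule lagrangian_normal_bundle[OF assms(1,2,4) \<Omega>])
  show "\<exists>k. \<forall>p a b c d. wedge_square \<Omega> p a b c d = k * vol p a b c d"
    by (rule wedge_square_proportional[OF assms(2) \<Omega>(1)])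
  fix V X \<xi> assume "adapted_frame M vol \<sigma> V X \<xi>"
  from lagrangian_adapted_frame[OF assms(1,2,4) \<Omega> this]
  show "let A = (\<lambda>p. \<Omega> p (X 1 p) (\<xi> 2 p)); B = (\<lambda>p. \<Omega> p (X 1 p) (\<xi> 1 p)) in
           \<forall>p\<in>V.
             A p = \<Omega> p (X 2 p) (\<xi> 1 p) \<and>
             B p = - metric_sign M vol X p * \<Omega> p (X 2 p) (\<xi> 2 p) \<and>
             H_matrix M vol \<sigma> X \<xi> p *v vector [A p, B p] = 0 \<and>
             (eta_defined M vol X A B p \<longrightarrow>
                star_equations M vol \<sigma> X \<xi> (eta M vol X A B) p)"
    unfolding Let_def by blast
next
  assume *: "connected M \<and>
      (\<forall>p\<in>M. \<exists>V X \<xi> A B. p \<in> V \<and> adapted_frame M vol \<sigma> V X \<xi> \<and>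
         (\<forall>q\<in>V. rank (H_matrix M vol \<sigma> X \<xi> q) = 1 \<and>
                 H_matrix M vol \<sigma> X \<xi> q *v vector [A q, B q] = 0 \<and>
                 eta_defined M vol X A B q \<and>
                 star_equations M vol \<sigma> X \<xi> (eta M vol X A B) q))"
  have loc: "\<exists>N \<Omega>. p \<in> N \<and> unique_lagrangian_form M N \<Omega>" if p: "p \<in> M" for p
  proof -
    obtain V X \<xi> A B where V: "p \<in> V" "adapted_frame M vol \<sigma> V X \<xi>"
      "\<And>q. q \<in> V \<Longrightarrow> rank (H_matrix M vol \<sigma> X \<xi> q) = 1 \<and>
                 H_matrix M vol \<sigma> X \<xi> q *v vector [A q, B q] = 0 \<and>
                 eta_defined M vol X A B q \<and>
                 star_equations M vol \<sigma> X \<xi> (eta M vol X A B) q"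
      using * p by meson
    show ?thesis by (rule parallel_form_near[OF assms(1,2,4) V(2,1,3)])
  qed
  show "\<exists>\<Omega>. parallel_symplectic_form \<Omega> \<and> lagrangian_surface \<Omega> M"
  proof (cases "M = {}")
    \<comment> \<open>Without points there is no local form to extend, and any symplectic form will
      do.\<close>
    case True
    then show ?thesis
      using parallel_symplectic_form_exists by (auto simp: lagrangian_surface_def lagrangian_bundle_def)
  next
    case False
    then obtain p0 where p0: "p0 \<in> M" by blast
    obtain N0 \<Omega> where N0: "p0 \<in> N0" "unique_lagrangian_form M N0 \<Omega>"
      using loc[OF p0] by blast
    then have N0': "openin (top_of_set M) N0" "isotropic M \<Omega> N0"
      and \<Omega>: "bilinear \<Omega>" "\<forall>v. \<Omega> v v = 0" "\<forall>v. (\<forall>w. \<Omega> v w = 0) \<longrightarrow> v = 0"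
      unfolding unique_lagrangian_form_def by simp_all
    \<comment> \<open>The largest open part of \<open>M\<close> on which the form found near
      \<open>p0\<close> is isotropic; connectedness applies once it is shown to be closed as
      well.\<close>
    define S where "S = \<Union> {N. openin (top_of_set M) N \<and> isotropic M \<Omega> N}"
    have S_open: "openin (top_of_set M) S" unfolding S_def by (rule openin_Union) auto
    have sub: "N \<subseteq> S" if "openin (top_of_set M) N" "isotropic M \<Omega> N" for N using that by (auto simp: S_def)
    have "\<exists>N. openin (top_of_set M) N \<and> p \<in> N \<and> N \<subseteq> M - S" if p: "p \<in> M - S" for p
    proof -
      have pM: "p \<in> M" using p by simp
      obtain N \<Omega>' where pN: "p \<in> N" and form: "unique_lagrangian_form M N \<Omega>'"
        using loc[OF pM] by blast
      then have N: "openin (top_of_set M) N" "isotropic M \<Omega>' N"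
        unfolding unique_lagrangian_form_def by simp_all
      \<comment> \<open>Where \<open>N\<close> meets \<open>S\<close>, the fixed form is a multiple
        of the one belonging to \<open>N\<close>. This is an identity between constant forms, so it
        makes the fixed form isotropic on all of \<open>N\<close>, and \<open>p\<close> would lie in
        \<open>S\<close>.\<close>
      have "N \<inter> S = {}"
      proof (rule ccontr)
        assume ne: "N \<inter> S \<noteq> {}"
        have "isotropic M \<Omega> (N \<inter> S)" unfolding S_def isotropic_def by blast
        moreover have "bilinear \<Omega> \<and> (\<forall>v. \<Omega> v v = 0) \<and> openin (top_of_set M) (N \<inter> S) \<and> N \<inter> S \<subseteq> N \<and>
            N \<inter> S \<noteq> {} \<and> isotropic M \<Omega> (N \<inter> S) \<longrightarrow> (\<exists>s. \<forall>v w. \<Omega> v w = s * \<Omega>' v w)"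
          using form unfolding unique_lagrangian_form_def
          by (elim conjE allE[where x = \<Omega>] allE[where x = "N \<inter> S"]) assumption
        ultimately have "\<exists>s. \<forall>v w. \<Omega> v w = s * \<Omega>' v w"
          using \<Omega>(1,2) ne openin_Int[OF N(1) S_open] by simp
        then obtain s where "\<And>v w. \<Omega> v w = s * \<Omega>' v w" by blast
        then have "isotropic M \<Omega> N" using N(2) by (simp add: isotropic_def)
        then show False using sub[OF N(1)] pN p by blast
      qed
      then show ?thesis using N(1) pN openin_imp_subset[OF N(1)] by (intro exI[of _ N]) auto
    qed
    then have "openin (top_of_set M) (M - S)" by (subst openin_subopen) blast
    then have "closedin (top_of_set M) S"
      using openin_imp_subset[OF S_open] by (simp add: closedin_def)
    then have "S = {} \<or> S = M" using * S_open unfolding connected_clopen by blast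
    then have "S = M" using sub[OF N0'] N0(1) by blast
    then have iso: "isotropic M \<Omega> M" unfolding S_def isotropic_def by blast
    have "parallel_symplectic_form (\<lambda>_. \<Omega>)" using \<Omega> by (simp add: parallel_symplectic_form_def)
    moreover have "lagrangian_surface (\<lambda>_. \<Omega>) M"
      using iso by (simp add: isotropic_def lagrangian_surface_def lagrangian_bundle_def)
    ultimately show ?thesis by blast
  qed
qed

end
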